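(* Let $K$ satisfy the kernel assumption (Existence) stated in the context. Let $\rho\ge0$ and consider a sequence of triples $(N,L,\epsilon)$ with $N,L\to\infty$, $\epsilon\to0$, $\frac{N\epsilon}{L}\to\rho$, $\overline\rho=\sup\frac{N\epsilon}{L}$, and $L\,\omega_{\overline\varphi}(\epsilon)\to0$ where $\overline\varphi(x)=(1+x)\varphi(x)$. Suppose the law $\mathbb P^{N,L,\epsilon}=C^L_\#\mu_{N,L,\epsilon}$ is induced by a microscopic evolution, where $\mu_{N,L,\epsilon}(t,\cdot)\in\mathcal P(V^{N,L,\epsilon})$ is the law at time $t$ of a Markov process with the microscopic generator $\mathcal L^{N,L,\epsilon}$, and suppose $\mathbb P^{N,L,\epsilon}\to\mathbb P$ weakly in $D([0,\infty),\mathcal P_{\le\overline\rho})$. Moreover assume that for some $b>0$ $$\sup\ \frac1L H\bigl(\mu_{N,L,\epsilon}(0)\,\big|\,\nu_{L,\epsilon,b}\bigr)<+\infty ,$$ the supremum being along the sequence. Then $\mathbb P$ is concentrated on paths $(c_t)_{t\ge0}$ such that the probability measure $c_t$ on $\mathbb R_+$ has a Lebesgue density for almost all $t\ge0$.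
   Context: Notation. $\mathbb R_+=[0,\infty)$, $\mathbb N_0=\{0,1,2,\dots\}$; $\mathcal P(X)$ denotes probability measures on $X$. $\mathcal P^1$ is the set of Borel probability measures on $\mathbb R_+$ with finite first moment, with metric $W_1(\mu,\nu)=\int_0^\infty|T_\mu(x)-T_\nu(x)|\,\mathrm dx$, $T_\mu(x)=\mu([x,\infty))$; $\mathcal P_{\le\rho}\subset\mathcal P^1$ is the closed subset of measures with first moment $\le\rho$. $D([0,\infty),\mathcal P_{\le\overline\rho})$ is the Skorokhod space of càdlàg paths. $H(\mu|\nu)=\int\log\frac{\mathrm d\mu}{\mathrm d\nu}\,\mathrm d\mu$ is the relative entropy ($+\infty$ if $\mu\not\ll\nu$). For a uniformly continuous $h$, $\omega_h$ is its modulus of continuity. Kernel assumption (Existence). $K:(0,\infty)\times\mathbb R_+\times\mathbb R_+\to\mathbb R_+$; for all $z\ge0$, $K(\cdot,\cdot,z)$ is continuous on $(0,\infty)\times\mathbb R_+$ and $K(x,y,z)\le C_K(1+x)(1+y)\varphi(z)$ for some constant $C_K$ and some $\varphi:\mathbb R_+\to\mathbb R_+$ such that $z\mapsto\varphi(z)$ and $z\mapsto z\varphi(z)$ are uniformly continuous and integrable. Moreover the functions $z\mapsto K(x,y,z)$, $x>0,y\ge0$, are uniformly continuous with a common modulus of continuity. Microscopic system. For $N,L\in\mathbb N$ ($L\ge2$) and $\epsilon>0$, $V^{N,L,\epsilon}=\{\eta\in(\epsilon\mathbb N_0)^L:\sum_i\eta_i=N\epsilon\}$. The microscopic generator is $$\mathcal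 L^{N,L,\epsilon}H(\eta)=\frac1{L-1}\sum_{x,y=1,\ x\ne y}^L\ \sum_{1\le d\le\eta_x/\epsilon}K(\eta_x,\eta_y,d\epsilon)\,\epsilon\,\bigl(H(\eta^{x\stackrel{d\epsilon}{\to}y})-H(\eta)\bigr),$$ where $\eta^{x\stackrel{d\epsilon}{\to}y}$ is $\eta$ with $\eta_x$ replaced by $\eta_x-d\epsilon$ and $\eta_y$ replaced by $\eta_y+d\epsilon$. The empirical cluster distribution map is $C^L[\eta]=\frac1L\sum_{i=1}^L\delta_{\eta_i}\in\mathcal P(\mathbb R_+)$; $C^L_\#\mu_{N,L,\epsilon}$ is the law of the path $t\mapsto C^L[\eta(t)]$. Reference measure. For $b>0$, $\nu_{L,\epsilon,b}$ is the product probability measure on $(\epsilon\mathbb N_0)^L$ given by $\nu_{L,\epsilon,b}(A)=\sum_{\eta\in A}\prod_{i=1}^Lg_{\epsilon,b}(\eta_i)$, with $g_{\epsilon,b}(m\epsilon)=b\int_{m\epsilon}^{(m+1)\epsilon}e^{-bx}\,\mathrm dx$ for $m\in\mathbb N_0$. Measures on $V^{N,L,\epsilon}$ are viewed as measures on $(\epsilon\mathbb N_0)^L$ when taking relative entropies. *)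

theory Defs
  imports "HOL-Probability.Probability"
begin

section \<open>The Wasserstein space of measures on the half-line\<close>

text \<open>A Borel measure on \<open>[0, \<infinity>)\<close> is represented as a Borel measure on the real line that gives full
  mass to \<open>[0, \<infinity>)\<close>.\<close>

definition P1 :: "real measure set" where
  "P1 = {\<mu>. prob_space \<mu> \<and> sets \<mu> = sets borel \<and> measure \<mu> {0..} = 1 \<and> integrable \<mu> (\<lambda>x. x)}"

definition tail :: "real measure \<Rightarrow> real \<Rightarrow> real" where
  "tail \<mu> x = measure \<mu> {x..}"

definition W1 :: "real measure \<Rightarrow> real measure \<Rightarrow> real" where
  "W1 \<mu> \<nu> = (LBINT x:{0..}. \<bar>tail \<mu> x - tail \<nu> x\<bar>)"

lemma P1_facts:
  assumes "\<mu> \<in> P1"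
  shows "prob_space \<mu>" "sets \<mu> = sets borel" "space \<mu> = UNIV" "measure \<mu> {0..} = 1"
    "integrable \<mu> (\<lambda>x. x)" "AE x in \<mu>. 0 \<le> x"
proof -
  show *: "prob_space \<mu>" "sets \<mu> = sets borel" "measure \<mu> {0..} = 1" "integrable \<mu> (\<lambda>x. x)"
    using assms by (auto simp: P1_def)
  show "space \<mu> = UNIV"
    using sets_eq_imp_space_eq[OF *(2)] by simp
  have "AE x in \<mu>. x \<in> {0..}"
    using prob_space.AE_prob_1[OF *(1) *(3)] by simp
  then show "AE x in \<mu>. 0 \<le> x" by simp
qed

lemma tail_measurable:
  assumes "\<mu> \<in> P1"
  shows "tail \<mu> \<in> borel_measurable borel"
proof -
  interpret prob_space \<mu> using P1_facts[OF assms] by simp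
  have "mono (\<lambda>x. - tail \<mu> x)"
    unfolding tail_def using P1_facts[OF assms]
    by (auto simp: mono_def intro!: finite_measure_mono)
  from borel_measurable_mono[OF this] show ?thesis
    by (subst (asm) borel_measurable_uminus_eq)
qed

lemma tail_integrable:
  assumes "\<mu> \<in> P1"
  shows "set_integrable lborel {0..} (tail \<mu>)"
proof -
  note facts = P1_facts[OF assms]
  interpret prob_space \<mu> using facts by simp
  interpret pair_sigma_finite lborel \<mu> ..
  have [measurable_cong]: "sets \<mu> = sets borel" by fact
  have meas: "(\<lambda>(x, y). indicator {p. 0 \<le> fst p \<and> fst p \<le> snd p} (x, y) :: ennreal)
      \<in> borel_measurable (lborel \<Otimes>\<^sub>M \<mu>)"
  proof -
    have "(\<lambda>p::real\<times>real. indicator {p. 0 \<le> fst p \<and> fst p \<le> snd p} p :: ennreal)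
      \<in> borel_measurable (lborel \<Otimes>\<^sub>M \<mu>)"
      by measurable
    then show ?thesis by (simp add: case_prod_beta')
  qed
  have tm[measurable]: "tail \<mu> \<in> borel_measurable borel" by (rule tail_measurable[OF assms])
  have "(\<integral>\<^sup>+x. ennreal (norm (indicator {0..} x *\<^sub>R tail \<mu> x)) \<partial>lborel)
      = (\<integral>\<^sup>+x. (\<integral>\<^sup>+y. indicator {p. 0 \<le> fst p \<and> fst p \<le> snd p} (x, y) \<partial>\<mu>) \<partial>lborel)"
  proof (rule nn_integral_cong)
    fix x :: real
    have "(\<integral>\<^sup>+y. indicator {p. 0 \<le> fst p \<and> fst p \<le> snd p} (x, y) \<partial>\<mu>)
        = (\<integral>\<^sup>+y. indicator (if 0 \<le> x then {x..} else {}) y \<partial>\<mu>)"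
      by (intro nn_integral_cong) (auto simp: indicator_def)
    also have "\<dots> = emeasure \<mu> (if 0 \<le> x then {x..} else {})"
      using facts by (intro nn_integral_indicator) auto
    also have "\<dots> = ennreal (norm (indicator {0..} x *\<^sub>R tail \<mu> x))"
      by (auto simp: tail_def emeasure_eq_measure)
    finally show "ennreal (norm (indicator {0..} x *\<^sub>R tail \<mu> x))
        = (\<integral>\<^sup>+y. indicator {p. 0 \<le> fst p \<and> fst p \<le> snd p} (x, y) \<partial>\<mu>)" by simp
  qed
  also have "\<dots> = (\<integral>\<^sup>+y. (\<integral>\<^sup>+x. indicator {p. 0 \<le> fst p \<and> fst p \<le> snd p} (x, y) \<partial>lborel) \<partial>\<mu>)"
    by (rule Fubini'[OF meas, symmetric])
  also have "\<dots> = (\<integral>\<^sup>+y. ennreal (norm y) \<partial>\<mu>)"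
  proof (rule nn_integral_cong_AE)
    show "AE y in \<mu>. (\<integral>\<^sup>+x. indicator {p. 0 \<le> fst p \<and> fst p \<le> snd p} (x, y) \<partial>lborel)
        = ennreal (norm y)"
      using facts(6)
    proof eventually_elim
      fix y :: real assume y: "0 \<le> y"
      have "(\<integral>\<^sup>+x. indicator {p. 0 \<le> fst p \<and> fst p \<le> snd p} (x, y) \<partial>lborel)
          = (\<integral>\<^sup>+x. indicator {0..y} x \<partial>lborel)"
        by (intro nn_integral_cong) (auto simp: indicator_def)
      then show "(\<integral>\<^sup>+x. indicator {p. 0 \<le> fst p \<and> fst p \<le> snd p} (x, y) \<partial>lborel)
          = ennreal (norm y)"
        using y by simp
    qed
  qed
  also have "\<dots> < \<infinity>"
    using facts(5) by (simp add: integrable_iff_bounded)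
  finally show ?thesis
    unfolding set_integrable_def by (intro integrableI_bounded) auto
qed

lemma W1_integrable:
  assumes "\<mu> \<in> P1" "\<nu> \<in> P1"
  shows "set_integrable lborel {0..} (\<lambda>x. \<bar>tail \<mu> x - tail \<nu> x\<bar>)"
  by (intro set_integrable_abs set_integral_diff tail_integrable assms)

lemma tail_left_continuous:
  assumes "\<mu> \<in> P1"
  shows "(\<lambda>n. tail \<mu> (x - 1 / real (Suc n))) \<longlonglongrightarrow> tail \<mu> x"
proof -
  note facts = P1_facts[OF assms]
  interpret prob_space \<mu> using facts by simp
  have "(\<lambda>n. measure \<mu> {x - 1 / real (Suc n)..}) \<longlonglongrightarrow> measure \<mu> (\<Inter>n. {x - 1 / real (Suc n)..})"
    using facts
    by (intro finite_Lim_measure_decseq) (auto simp: decseq_def field_simps)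
  moreover have "(\<Inter>n. {x - 1 / real (Suc n)..}) = {x..}"
  proof (intro set_eqI iffI)
    fix y assume "y \<in> (\<Inter>n. {x - 1 / real (Suc n)..})"
    then have "x - y \<le> 1 / real (Suc n)" for n by (auto simp: algebra_simps)
    then have "x - y \<le> 0"
      by (intro LIMSEQ_le_const[OF LIMSEQ_inverse_real_of_nat]) (auto simp: inverse_eq_divide)
    then show "y \<in> {x..}" by simp
  next
    fix y assume "y \<in> {x..}"
    then have "x - 1 / real (Suc n) \<le> y" for n
      using order_trans[of "x - 1 / real (Suc n)" x y] by simp
    then show "y \<in> (\<Inter>n. {x - 1 / real (Suc n)..})" by simp
  qed
  ultimately show ?thesis unfolding tail_def by simp
qed

lemma W1_zero_imp_eq:
  assumes "\<mu> \<in> P1" "\<nu> \<in> P1" "W1 \<mu> \<nu> = 0"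
  shows "\<mu> = \<nu>"
proof -
  note f1 = P1_facts[OF assms(1)] and f2 = P1_facts[OF assms(2)]
  interpret M: prob_space \<mu> using f1 by simp
  interpret N: prob_space \<nu> using f2 by simp
  have int: "integrable lborel (\<lambda>x. indicator {0..} x *\<^sub>R \<bar>tail \<mu> x - tail \<nu> x\<bar>)"
    using W1_integrable[OF assms(1,2)] by (simp add: set_integrable_def)
  have "AE x in lborel. indicator {0..} x *\<^sub>R \<bar>tail \<mu> x - tail \<nu> x\<bar> = 0"
    using assms(3) integral_nonneg_eq_0_iff_AE[OF int]
    by (simp add: W1_def set_lebesgue_integral_def)
  then have ae: "AE x in lborel. 0 \<le> x \<longrightarrow> tail \<mu> x = tail \<nu> x"
    by eventually_elim (auto simp: indicator_def)
  have dense: "\<exists>z. a < z \<and> z < b \<and> tail \<mu> z = tail \<nu> z" if "0 \<le> a" "a < b" for a b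
  proof (rule ccontr)
    assume "\<not> ?thesis"
    then have "{a<..<b} \<subseteq> {x. \<not> (0 \<le> x \<longrightarrow> tail \<mu> x = tail \<nu> x)}" using that by auto
    moreover obtain Z where Z: "{x \<in> space lborel. \<not> (0 \<le> x \<longrightarrow> tail \<mu> x = tail \<nu> x)} \<subseteq> Z"
      "emeasure lborel Z = 0" "Z \<in> sets lborel"
      using AE_E[OF ae] by blast
    ultimately have "{a<..<b} \<subseteq> Z" by auto
    then have "emeasure lborel {a<..<b} \<le> 0" using emeasure_mono[OF _ Z(3)] Z(2) by metis
    then show False using that by simp
  qed
  have eq_pos: "tail \<mu> x = tail \<nu> x" if "0 < x" for x
  proof -
    have le: "tail a x \<le> tail b x"
      if ab: "a \<in> P1" "b \<in> P1" "\<And>s t. 0 \<le> s \<Longrightarrow> s < t \<Longrightarrow> \<exists>z. s < z \<and> z < t \<and> tail a z = tail b z" for a b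
    proof (rule LIMSEQ_le_const[OF tail_left_continuous[OF ab(2)]])
      obtain n0 where n0: "1 / real (Suc n0) < x" using \<open>0 < x\<close> nat_approx_posE by metis
      have "tail a x \<le> tail b (x - 1 / real (Suc n))" if "n0 \<le> n" for n
      proof -
        have "1 / real (Suc n) \<le> 1 / real (Suc n0)" using that by (simp add: field_simps)
        then have "0 \<le> x - 1 / real (Suc n)" using n0 by simp
        moreover have "x - 1 / real (Suc n) < x" by simp
        ultimately obtain z where z: "x - 1 / real (Suc n) < z" "z < x" "tail a z = tail b z"
          using ab(3) by blast
        interpret A: prob_space a using P1_facts[OF ab(1)] by simp
        interpret B: prob_space b using P1_facts[OF ab(2)] by simp
        have "tail a x \<le> tail a z" unfolding tail_def
          using z P1_facts[OF ab(1)] by (intro A.finite_measure_mono) auto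
        also have "\<dots> \<le> tail b (x - 1 / real (Suc n))" unfolding \<open>tail a z = tail b z\<close> unfolding tail_def
          using z(1,2) P1_facts[OF ab(2)] by (intro B.finite_measure_mono) auto
        finally show ?thesis .
      qed
      then show "\<exists>N. \<forall>n\<ge>N. tail a x \<le> tail b (x - 1 / real (Suc n))" by blast
    qed
    show ?thesis
      using le[OF assms(1,2)] le[OF assms(2,1)] dense by (intro antisym) metis+
  qed
  have one: "tail a x = 1" if "a \<in> P1" "x \<le> 0" for a x
  proof -
    interpret A: prob_space a using P1_facts[OF that(1)] by simp
    have "measure a {0..} \<le> measure a {x..}"
      using that P1_facts[OF that(1)] by (intro A.finite_measure_mono) auto
    then show ?thesis
      using P1_facts[OF that(1)] A.prob_le_1[of "{x..}"] unfolding tail_def by simp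
  qed
  have eq: "tail \<mu> x = tail \<nu> x" for x
    using eq_pos[of x] one[OF assms(1), of x] one[OF assms(2), of x] by (cases "0 < x") auto
  show ?thesis
  proof (rule measure_eqI_generator_eq[where E = "range (\<lambda>x::real. {x..})" and \<Omega> = UNIV
        and A = "\<lambda>n. {- real n..}"])
    show "Int_stable (range (\<lambda>x::real. {x..}))"
    proof (rule Int_stableI_image)
      fix a b :: real
      have "{a..} \<inter> {b..} = {max a b..}" by auto
      then show "\<exists>c\<in>UNIV. {a..} \<inter> {b..} = {c..}" by blast
    qed
    show "sets \<mu> = sigma_sets UNIV (range (\<lambda>x::real. {x..}))"
      "sets \<nu> = sigma_sets UNIV (range (\<lambda>x::real. {x..}))"
      using f1 f2 by (auto simp: borel_Ici)
    show "(\<Union>i. {- real i..}) = UNIV"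
    proof (intro set_eqI iffI UNIV_I)
      fix x :: real
      obtain n where "- x \<le> real n" using real_arch_simple by blast
      then show "x \<in> (\<Union>i. {- real i..})" by (auto intro!: exI[of _ n])
    qed
    fix X :: "real set" assume "X \<in> range (\<lambda>x::real. {x..})"
    then show "emeasure \<mu> X = emeasure \<nu> X"
      using eq by (auto simp: M.emeasure_eq_measure N.emeasure_eq_measure tail_def)
  qed auto
qed

lemma Metric_space_P1: "Metric_space P1 W1"
proof
  show "0 \<le> W1 \<mu> \<nu>" for \<mu> \<nu>
    unfolding W1_def set_lebesgue_integral_def by (intro integral_nonneg_AE) auto
  show "W1 \<mu> \<nu> = W1 \<nu> \<mu>" for \<mu> \<nu>
    unfolding W1_def by (simp add: abs_minus_commute)
  show "W1 \<mu> \<nu> = 0 \<longleftrightarrow> \<mu> = \<nu>" if "\<mu> \<in> P1" "\<nu> \<in> P1" for \<mu> \<nu>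
    using W1_zero_imp_eq[OF that] by (auto simp: W1_def set_lebesgue_integral_def)
  show "W1 \<mu> \<kappa> \<le> W1 \<mu> \<nu> + W1 \<nu> \<kappa>" if "\<mu> \<in> P1" "\<nu> \<in> P1" "\<kappa> \<in> P1" for \<mu> \<nu> \<kappa>
  proof -
    have "W1 \<mu> \<kappa> \<le> (LBINT x:{0..}. \<bar>tail \<mu> x - tail \<nu> x\<bar> + \<bar>tail \<nu> x - tail \<kappa> x\<bar>)"
      unfolding W1_def
      by (intro set_integral_mono W1_integrable set_integral_add that) auto
    also have "\<dots> = W1 \<mu> \<nu> + W1 \<nu> \<kappa>"
      unfolding W1_def by (intro set_integral_add W1_integrable that)
    finally show ?thesis .
  qed
qed

definition P1_metric :: "real measure metric" where
  "P1_metric = metric (P1, W1)"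

lemma mspace_P1_metric [simp]: "mspace P1_metric = P1"
  and mdist_P1_metric [simp]: "mdist P1_metric = W1"
  by (simp_all add: P1_metric_def Metric_space.mspace_metric Metric_space.mdist_metric Metric_space_P1)

definition P_le :: "real \<Rightarrow> real measure metric" where
  "P_le \<rho> = submetric P1_metric {\<mu>. (\<integral>x. x \<partial>\<mu>) \<le> \<rho>}"


section \<open>The Skorokhod space of paths on the half-line\<close>

text \<open>Paths are functions on \<open>[0, \<infinity>)\<close>, i.e. functions on the reals that are \<open>undefined\<close> at negative
  times.\<close>

definition cadlag :: "'a metric \<Rightarrow> (real \<Rightarrow> 'a) set" where
  "cadlag m = {c \<in> {0..} \<rightarrow>\<^sub>E mspace m.
     (\<forall>t\<ge>0. limitin (mtopology_of m) c (c t) (at_right t)) \<and>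
     (\<forall>t>0. \<exists>l. limitin (mtopology_of m) c l (at_left t))}"

definition time_change :: "(real \<Rightarrow> real) \<Rightarrow> bool" where
  "time_change \<tau> \<longleftrightarrow> strict_mono_on {0..} \<tau> \<and> \<tau> ` {0..} = {0..}"

text \<open>The Skorokhod (J1) topology is generated by the following neighbourhood bases. In this topology
  \<open>c\<^sub>n\<close> converges to \<open>c\<close> iff there are time changes \<open>\<tau>\<^sub>n\<close> with \<open>sup {\<bar>\<tau>\<^sub>n s - s\<bar> | s. s \<ge> 0} \<rightarrow> 0\<close> and
  \<open>sup {d (c\<^sub>n (\<tau>\<^sub>n s)) (c s) | s. s \<le> T} \<rightarrow> 0\<close> for every \<open>T\<close>, see Jacod and Shiryaev, Limit Theorems for
  Stochastic Processes, Theorem VI.1.14, or Ethier and Kurtz, Markov Processes, Proposition 3.5.3.\<close>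

definition skorokhod_nhd :: "'a metric \<Rightarrow> (real \<Rightarrow> 'a) \<Rightarrow> real \<Rightarrow> real \<Rightarrow> (real \<Rightarrow> 'a) set" where
  "skorokhod_nhd m c T r = {c' \<in> cadlag m. \<exists>\<tau>. time_change \<tau> \<and>
     (\<forall>s\<ge>0. \<bar>\<tau> s - s\<bar> < r) \<and> (\<forall>s\<in>{0..T}. mdist m (c' (\<tau> s)) (c s) < r)}"

definition skorokhod_topology :: "'a metric \<Rightarrow> (real \<Rightarrow> 'a) topology" where
  "skorokhod_topology m = topology (\<lambda>U. U \<subseteq> cadlag m \<and>
     (\<forall>c\<in>U. \<exists>T>0. \<exists>r>0. skorokhod_nhd m c T r \<subseteq> U))"

lemma skorokhod_nhd_mono: "T' \<le> T \<Longrightarrow> r \<le> r' \<Longrightarrow> skorokhod_nhd m c T r \<subseteq> skorokhod_nhd m c T' r'"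
  unfolding skorokhod_nhd_def by (smt (verit) Collect_mono_iff atLeastAtMost_iff)

lemma openin_skorokhod_topology:
  "openin (skorokhod_topology m) U \<longleftrightarrow> U \<subseteq> cadlag m \<and>
     (\<forall>c\<in>U. \<exists>T>0. \<exists>r>0. skorokhod_nhd m c T r \<subseteq> U)"
proof -
  have "istopology (\<lambda>U. U \<subseteq> cadlag m \<and> (\<forall>c\<in>U. \<exists>T>0. \<exists>r>0. skorokhod_nhd m c T r \<subseteq> U))"
    unfolding istopology_def
  proof (intro conjI allI impI ballI)
    fix S U c
    assume S: "S \<subseteq> cadlag m \<and> (\<forall>c\<in>S. \<exists>T>0. \<exists>r>0. skorokhod_nhd m c T r \<subseteq> S)"
      and U: "U \<subseteq> cadlag m \<and> (\<forall>c\<in>U. \<exists>T>0. \<exists>r>0. skorokhod_nhd m c T r \<subseteq> U)"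
    show "S \<inter> U \<subseteq> cadlag m" using S by auto
    assume "c \<in> S \<inter> U"
    with S U obtain T r T' r' where "T > 0" "r > 0" "skorokhod_nhd m c T r \<subseteq> S"
      "T' > 0" "r' > 0" "skorokhod_nhd m c T' r' \<subseteq> U" by (metis IntD1 IntD2)
    then show "\<exists>T>0. \<exists>r>0. skorokhod_nhd m c T r \<subseteq> S \<inter> U"
      using skorokhod_nhd_mono[of T "max T T'" "min r r'" r m c]
        skorokhod_nhd_mono[of T' "max T T'" "min r r'" r' m c]
      by (intro exI[of _ "max T T'"] exI[of _ "min r r'"] conjI) auto
  next
    fix \<K> c
    assume \<K>: "\<forall>K\<in>\<K>. K \<subseteq> cadlag m \<and> (\<forall>c\<in>K. \<exists>T>0. \<exists>r>0. skorokhod_nhd m c T r \<subseteq> K)"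
    show "\<Union>\<K> \<subseteq> cadlag m" using \<K> by auto
    assume "c \<in> \<Union>\<K>"
    then obtain K where "K \<in> \<K>" "c \<in> K" by auto
    with \<K> obtain T r where "T > 0" "r > 0" "skorokhod_nhd m c T r \<subseteq> K" by metis
    with \<open>K \<in> \<K>\<close> show "\<exists>T>0. \<exists>r>0. skorokhod_nhd m c T r \<subseteq> \<Union>\<K>" by (metis Sup_upper subset_trans)
  qed
  then show ?thesis unfolding skorokhod_topology_def by simp
qed

lemma topspace_skorokhod_topology [simp]: "topspace (skorokhod_topology m) = cadlag m"
proof
  show "topspace (skorokhod_topology m) \<subseteq> cadlag m"
    using openin_skorokhod_topology[of m "topspace (skorokhod_topology m)"] by simp
  have "skorokhod_nhd m c 1 1 \<subseteq> cadlag m" for c by (auto simp: skorokhod_nhd_def)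
  then have "openin (skorokhod_topology m) (cadlag m)"
    unfolding openin_skorokhod_topology using zero_less_one by blast
  then show "cadlag m \<subseteq> topspace (skorokhod_topology m)" by (rule openin_subset)
qed

definition borel_of :: "'a topology \<Rightarrow> 'a measure" where
  "borel_of X = sigma (topspace X) {U. openin X U}"

definition weakly_converges ::
    "'a topology \<Rightarrow> (nat \<Rightarrow> 'a measure) \<Rightarrow> 'a measure \<Rightarrow> bool" where
  "weakly_converges X P Q \<longleftrightarrow>
     (\<forall>F. continuous_map X euclideanreal F \<and> bounded (F ` topspace X)
        \<longrightarrow> (\<lambda>n. \<integral>c. F c \<partial>P n) \<longlonglongrightarrow> (\<integral>c. F c \<partial>Q))"


section \<open>Markov processes on a finite state space\<close>

definition transition_function :: "'v set \<Rightarrow> (real \<Rightarrow> 'v \<Rightarrow> 'v \<Rightarrow> real) \<Rightarrow> bool" where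
  "transition_function V p \<longleftrightarrow>
     (\<forall>t\<ge>0. \<forall>v\<in>V. (\<forall>w\<in>V. 0 \<le> p t v w) \<and> (\<Sum>w\<in>V. p t v w) = 1) \<and>
     (\<forall>v\<in>V. \<forall>w\<in>V. p 0 v w = of_bool (v = w)) \<and>
     (\<forall>s\<ge>0. \<forall>t\<ge>0. \<forall>v\<in>V. \<forall>w\<in>V. p (s + t) v w = (\<Sum>u\<in>V. p s v u * p t u w))"

definition has_generator ::
    "'v set \<Rightarrow> (real \<Rightarrow> 'v \<Rightarrow> 'v \<Rightarrow> real) \<Rightarrow> (('v \<Rightarrow> real) \<Rightarrow> 'v \<Rightarrow> real) \<Rightarrow> bool" where
  "has_generator V p G \<longleftrightarrow>
     (\<forall>f. \<forall>v\<in>V. ((\<lambda>h. ((\<Sum>w\<in>V. p h v w * f w) - f v) / h) \<longlongrightarrow> G f v) (at_right 0))"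

text \<open>The time-homogeneous Markov property is expressed through the finite-dimensional distributions,
  and the paths are required to be cadlag for the discrete topology on the finite set \<open>V\<close>.\<close>

definition markov_process ::
    "'w measure \<Rightarrow> 'v set \<Rightarrow> (('v \<Rightarrow> real) \<Rightarrow> 'v \<Rightarrow> real) \<Rightarrow> (real \<Rightarrow> 'w \<Rightarrow> 'v) \<Rightarrow> bool" where
  "markov_process \<Omega> V G X \<longleftrightarrow>
     prob_space \<Omega> \<and>
     (\<forall>t\<ge>0. X t \<in> measurable \<Omega> (count_space V)) \<and>
     (\<forall>\<omega>\<in>space \<Omega>.
        (\<forall>t\<ge>0. \<forall>\<^sub>F s in at_right t. X s \<omega> = X t \<omega>) \<and>
        (\<forall>t>0. \<exists>v\<in>V. \<forall>\<^sub>F s in at_left t. X s \<omega> = v)) \<and>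
     (\<exists>p. transition_function V p \<and> has_generator V p G \<and>
        (\<forall>k::nat. \<forall>\<tau>::nat \<Rightarrow> real. \<forall>v::nat \<Rightarrow> 'v.
           0 \<le> \<tau> 0 \<and> (\<forall>i\<le>k. \<tau> i < \<tau> (Suc i)) \<and> (\<forall>i\<le>Suc k. v i \<in> V) \<longrightarrow>
           measure \<Omega> {\<omega> \<in> space \<Omega>. \<forall>i\<le>Suc k. X (\<tau> i) \<omega> = v i} =
           measure \<Omega> {\<omega> \<in> space \<Omega>. \<forall>i\<le>k. X (\<tau> i) \<omega> = v i} * p (\<tau> (Suc k) - \<tau> k) (v k) (v (Suc k))))"


section \<open>The microscopic system\<close>

definition modulus_of_continuity :: "real set \<Rightarrow> (real \<Rightarrow> real) \<Rightarrow> real \<Rightarrow> real" where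
  "modulus_of_continuity S h r = (SUP (x, y)\<in>{(x, y). x \<in> S \<and> y \<in> S \<and> \<bar>x - y\<bar> \<le> r}. \<bar>h x - h y\<bar>)"

definition existence_kernel :: "(real \<Rightarrow> real \<Rightarrow> real \<Rightarrow> real) \<Rightarrow> (real \<Rightarrow> real) \<Rightarrow> bool" where
  "existence_kernel K \<phi> \<longleftrightarrow>
     (\<forall>x>0. \<forall>y\<ge>0. \<forall>z\<ge>0. 0 \<le> K x y z) \<and>
     (\<forall>z\<ge>0. continuous_on ({0<..} \<times> {0..}) (\<lambda>(x, y). K x y z)) \<and>
     (\<forall>z\<ge>0. 0 \<le> \<phi> z) \<and>
     (\<exists>C. \<forall>x>0. \<forall>y\<ge>0. \<forall>z\<ge>0. K x y z \<le> C * (1 + x) * (1 + y) * \<phi> z) \<and>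
     uniformly_continuous_on {0..} \<phi> \<and>
     uniformly_continuous_on {0..} (\<lambda>z. z * \<phi> z) \<and>
     set_integrable lborel {0..} \<phi> \<and>
     set_integrable lborel {0..} (\<lambda>z. z * \<phi> z) \<and>
     (\<exists>w. (w \<longlongrightarrow> 0) (at_right 0) \<and>
        (\<forall>x>0. \<forall>y\<ge>0. \<forall>z\<ge>0. \<forall>z'\<ge>0. \<bar>K x y z - K x y z'\<bar> \<le> w \<bar>z - z'\<bar>))"

definition grid :: "nat \<Rightarrow> real \<Rightarrow> (nat \<Rightarrow> real) set" where
  "grid L \<epsilon> = {1..L} \<rightarrow>\<^sub>E range (\<lambda>m::nat. real m * \<epsilon>)"

definition configurations :: "nat \<Rightarrow> nat \<Rightarrow> real \<Rightarrow> (nat \<Rightarrow> real) set" where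
  "configurations N L \<epsilon> = {\<eta> \<in> grid L \<epsilon>. (\<Sum>i=1..L. \<eta> i) = real N * \<epsilon>}"

definition micro_generator ::
    "(real \<Rightarrow> real \<Rightarrow> real \<Rightarrow> real) \<Rightarrow> nat \<Rightarrow> real \<Rightarrow> ((nat \<Rightarrow> real) \<Rightarrow> real) \<Rightarrow> (nat \<Rightarrow> real) \<Rightarrow> real" where
  "micro_generator K L \<epsilon> H \<eta> = 1 / (real L - 1) *
     (\<Sum>x\<in>{1..L}. \<Sum>y\<in>{1..L} - {x}. \<Sum>d | 1 \<le> d \<and> real d \<le> \<eta> x / \<epsilon>.
        K (\<eta> x) (\<eta> y) (real d * \<epsilon>) * \<epsilon> *
        (H (\<eta>(x := \<eta> x - real d * \<epsilon>, y := \<eta> y + real d * \<epsilon>)) - H \<eta>))"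

definition empirical :: "nat \<Rightarrow> (nat \<Rightarrow> real) \<Rightarrow> real measure" where
  "empirical L \<eta> = distr (uniform_count_measure {1..L}) borel \<eta>"

lemma emeasure_empirical:
  assumes "A \<in> sets borel"
  shows "emeasure (empirical L \<eta>) A = ennreal (1 / real L) * (\<Sum>i=1..L. indicator A (\<eta> i))"
proof -
  have m: "\<eta> \<in> measurable (uniform_count_measure {1..L}) borel"
    by (auto simp: uniform_count_measure_def point_measure_def)
  have "emeasure (empirical L \<eta>) A = (\<Sum>i\<in>\<eta> -` A \<inter> {1..L}. ennreal (1 / real L))"
    unfolding empirical_def using assms m
    by (subst emeasure_distr)
       (auto simp: space_point_measure uniform_count_measure_def emeasure_point_measure_finite2)
  also have "\<dots> = (\<Sum>i=1..L. ennreal (1 / real L) * indicator A (\<eta> i))"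
    by (rule sum.mono_neutral_cong_left) (auto simp: indicator_def)
  finally show ?thesis by (simp add: sum_distrib_left)
qed

definition empirical_path :: "nat \<Rightarrow> (real \<Rightarrow> 'w \<Rightarrow> nat \<Rightarrow> real) \<Rightarrow> 'w \<Rightarrow> real \<Rightarrow> real measure" where
  "empirical_path L X \<omega> = (\<lambda>t\<in>{0..}. empirical L (X t \<omega>))"

definition g_weight :: "real \<Rightarrow> real \<Rightarrow> real \<Rightarrow> real" where
  "g_weight \<epsilon> b x = b * integral {x..x + \<epsilon>} (\<lambda>y. exp (- b * y))"

definition reference_measure :: "nat \<Rightarrow> real \<Rightarrow> real \<Rightarrow> (nat \<Rightarrow> real) measure" where
  "reference_measure L \<epsilon> b =
     point_measure (grid L \<epsilon>) (\<lambda>\<eta>. ennreal (\<Prod>i=1..L. g_weight \<epsilon> b (\<eta> i)))"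

text \<open>\<open>KL_divergence (exp 1) \<nu> \<mu>\<close> is the Bochner integral of the logarithm of \<open>d\<mu>/d\<nu>\<close> against \<open>\<mu>\<close>. For
  probability measures its negative part is always integrable, so that a non-integrable logarithm
  means an infinite relative entropy.\<close>

definition relative_entropy :: "'a measure \<Rightarrow> 'a measure \<Rightarrow> ereal" where
  "relative_entropy \<mu> \<nu> =
     (if absolutely_continuous \<nu> \<mu> \<and> integrable \<mu> (entropy_density (exp 1) \<nu> \<mu>)
      then ereal (KL_divergence (exp 1) \<nu> \<mu>) else \<infinity>)"

end

theory Submission
  imports Defs
begin

text \<open>
  The idea is that the relative entropy per site with respect to the reference measure stays bounded
  along the microscopic evolution, and that a bound of order \<open>L\<close> on the entropy of \<open>L\<close> sites
  forces the empirical distribution to charge small sets little. This property survives the weak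
  limit and yields absolute continuity.

  Entropy. On configurations with a fixed total mass the reference measure is constant, because the
  product of the geometric weights depends on the total mass only. The evolution need not preserve
  the uniform measure, but its density stays below \<open>exp (\<Lambda> t)\<close> when it is started there, where \<open>\<Lambda>\<close> bounds the column sums
  of the generator (\<open>transition_column_sum_bound\<close>). The growth bound on the kernel gives \<open>\<Lambda> = O(L)\<close>; here
  the condition on the modulus of continuity enters, since it makes a Riemann sum over all jump sizes
  comparable with the integral of \<open>(1 + z) \<phi> z\<close> (\<open>generator_column_sums_linear\<close>). Combined with Jensen's
  inequality and the Gibbs variational inequality at time zero this gives, for every functional \<open>F\<close>,
  \<open>E (F (X t)) \<le> H (\<mu> 0 | \<nu>) + \<Lambda> t + ln (\<Sum>w. \<nu> w * exp (F w))\<close>, see \<open>markov_exponential_bound\<close>.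

  Test functionals. For an open set \<open>W\<close> of Lebesgue measure at most \<open>\<delta>\<close>, let \<open>f\<close> be the indicator of \<open>W\<close>
  averaged over a short window. Then \<open>0 \<le> f \<le> 1\<close>, the integral of \<open>f\<close> is at most \<open>\<delta>\<close>, and \<open>\<mu> \<mapsto> \<integral>f d\<mu>\<close> is
  Lipschitz for \<open>W1\<close>. Take the maximum of \<open>\<integral>f d\<mu>\<close> over the first \<open>k + 1\<close> functions of a countable
  family of such \<open>f\<close>, and let \<open>F\<close> be this maximum for the empirical distribution times \<open>\<theta> L\<close> with
  \<open>b \<delta> exp \<theta> \<le> 1\<close>. The exponential moment factorises over the sites and is at most
  \<open>(k + 1) (2 + o(1))^L\<close>, so the expected maximum at time \<open>t\<close> is at most \<open>(C0 + C1 t + 1) / \<theta> + o(1)\<close>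
  (\<open>expected_max_test_bound\<close>).

  Limit. The time integral over \<open>(0, T]\<close> of the maximum is a bounded continuous function on the Skorokhod space
  (\<open>time_integral_continuous\<close>), so the bound passes to the limit law. Letting first \<open>k\<close> and then \<open>\<theta>\<close> tend
  to infinity shows that, for almost every path and time, the supremum of the masses of open sets of
  Lebesgue measure at most \<open>exp (- \<theta>) / b\<close> becomes arbitrarily small, and then the Radon-Nikodym theorem provides a density
  (\<open>density_at_almost_all_times\<close>). To speak of the law of the empirical path one has to know that it is
  a random element of the Skorokhod space, which is \<open>step_process_measurable_skorokhod\<close>.\<close>

section \<open>Averaged indicators of small open sets\<close>

text \<open>The average of the indicator of \<open>W\<close> over the window of length \<open>1 / l\<close> to the right of \<open>x\<close>. The window is open on
the left so that integrating against \<open>\<mu>\<close> produces differences of the tails \<open>\<mu> {y..}\<close>, whatever the atoms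
of \<open>\<mu>\<close>.\<close>

definition mollified :: "real set \<Rightarrow> real \<Rightarrow> real \<Rightarrow> real" where
  "mollified W l x = l * measure lborel (W \<inter> {x<..x + 1 / l})"

lemma fmeasurable_Ioc_lborel: "{x<..y::real} \<in> fmeasurable lborel"
  by (cases "x \<le> y") (auto simp: fmeasurable_def)

lemma window_finite:
  fixes x l :: real
  assumes "W \<in> sets borel"
  shows "emeasure lborel (W \<inter> {x<..x + 1 / l}) < \<infinity>"
proof -
  have "emeasure lborel (W \<inter> {x<..x + 1 / l}) \<le> emeasure lborel {x<..x + 1 / l}"
    by (intro emeasure_mono) auto
  also have "\<dots> < \<infinity>" using fmeasurable_Ioc_lborel[of x "x + 1 / l"] by (simp add: fmeasurable_def)
  finally show ?thesis .
qed

lemma mollified_bounds: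
  assumes "W \<in> sets borel" "0 < l"
  shows "0 \<le> mollified W l x" "mollified W l x \<le> 1"
proof -
  show "0 \<le> mollified W l x" using assms by (simp add: mollified_def)
  have "measure lborel (W \<inter> {x<..x + 1 / l}) \<le> measure lborel {x<..x + 1 / l}"
    using assms by (intro measure_mono_fmeasurable fmeasurable_Ioc_lborel) auto
  also have "\<dots> = 1 / l" using assms by simp
  finally show "mollified W l x \<le> 1"
    using assms by (simp add: mollified_def field_simps)
qed

text \<open>Moving the left end of the window to the right by \<open>y - x\<close> loses at most the part of \<open>W\<close> in \<open>(x, y]\<close>.
This one-sided bound is what compares the value at a grid point with the values in the cell to its right.\<close>

lemma mollified_increment:
  assumes "W \<in> sets borel" "0 < l" "x \<le> y"
  shows "mollified W l x \<le> mollified W l y + l * (y - x)"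
proof -
  have "measure lborel (W \<inter> {x<..x + 1 / l})
      \<le> measure lborel ((W \<inter> {y<..y + 1 / l}) \<union> {x<..y})"
    using assms window_finite[of W y l]
    by (intro measure_mono_fmeasurable fmeasurable.Un fmeasurable_Ioc_lborel)
       (auto simp: fmeasurable_def)
  also have "\<dots> \<le> measure lborel (W \<inter> {y<..y + 1 / l}) + measure lborel {x<..y}"
    using assms by (intro measure_Un_le) auto
  also have "measure lborel {x<..y} = y - x" using assms by simp
  finally show ?thesis
    using assms mult_left_mono[of "measure lborel (W \<inter> {x<..x + 1 / l})"
      "measure lborel (W \<inter> {y<..y + 1 / l}) + (y - x)" l]
    by (simp add: mollified_def algebra_simps)
qed

abbreviation in_window :: "real \<Rightarrow> real \<Rightarrow> real \<Rightarrow> ennreal" where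
  "in_window l x y \<equiv> indicator {p. fst p < snd p \<and> snd p \<le> fst p + 1 / l} (x, y)"

lemma ennreal_mollified:
  assumes "W \<in> sets borel" "0 < l"
  shows "ennreal (mollified W l x)
    = (\<integral>\<^sup>+y. ennreal l * indicator W y * in_window l x y \<partial>lborel)"
proof -
  have "(\<integral>\<^sup>+y. ennreal l * indicator W y * in_window l x y \<partial>lborel)
    = (\<integral>\<^sup>+y. ennreal l * indicator (W \<inter> {x<..x + 1 / l}) y \<partial>lborel)"
    by (intro nn_integral_cong) (auto simp: indicator_def)
  also have "\<dots> = ennreal l * emeasure lborel (W \<inter> {x<..x + 1 / l})"
    using assms by (simp add: nn_integral_cmult_indicator)
  also have "emeasure lborel (W \<inter> {x<..x + 1 / l}) = ennreal (measure lborel (W \<inter> {x<..x + 1 / l}))"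
    using window_finite[OF assms(1)] by (intro emeasure_eq_ennreal_measure) (auto simp: less_top)
  finally show ?thesis
    using assms by (simp add: mollified_def ennreal_mult)
qed

lemma window_kernel_measurable [measurable]:
  assumes [measurable]: "W \<in> sets borel"
  shows "(\<lambda>(x, y). ennreal l * indicator W y * in_window l x y)
    \<in> borel_measurable (borel \<Otimes>\<^sub>M (borel :: real measure))"
proof -
  have "(\<lambda>p::real\<times>real. ennreal l * indicator W (snd p) * indicator {p. fst p < snd p \<and> snd p \<le> fst p + 1 / l} p)
    \<in> borel_measurable (borel \<Otimes>\<^sub>M borel)"
    by measurable
  then show ?thesis by (simp add: case_prod_beta')
qed

lemma mollified_measurable [measurable]:
  assumes "W \<in> sets borel" "0 < l"
  shows "mollified W l \<in> borel_measurable borel"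
proof -
  have "(\<lambda>p. ennreal l * indicator W (snd p) * indicator {p. fst p < snd p \<and> snd p \<le> fst p + 1 / l} p)
      \<in> borel_measurable (borel \<Otimes>\<^sub>M lborel)"
    using window_kernel_measurable[OF assms(1), of l]
    by (simp add: case_prod_beta' cong: measurable_cong_sets)
  then have "(\<lambda>x. ennreal (mollified W l x)) \<in> borel_measurable borel"
    unfolding ennreal_mollified[OF assms]
    by (intro lborel.borel_measurable_nn_integral) (simp add: case_prod_beta')
  then have "(\<lambda>x. enn2real (ennreal (mollified W l x))) \<in> borel_measurable borel"
    by (rule borel_measurable_enn2real)
  then show ?thesis
    using mollified_bounds[OF assms] by simp
qed

text \<open>Fubini's theorem: \<open>y\<close> lies in the window of \<open>x\<close> iff \<open>x\<close> lies in \<open>[y - 1 / l, y)\<close>. The case of Lebesgue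
measure gives the size of the test function, the case of a probability measure its dependence on the tail.\<close>

lemma nn_integral_mollified:
  assumes W: "W \<in> sets borel" "0 < l" and M: "sigma_finite_measure M" "sets M = sets borel"
  shows "(\<integral>\<^sup>+x. ennreal (mollified W l x) \<partial>M)
    = (\<integral>\<^sup>+y. ennreal l * indicator W y * emeasure M {y - 1 / l..<y} \<partial>lborel)"
proof -
  interpret M: sigma_finite_measure M by fact
  interpret pair_sigma_finite lborel M ..
  have [measurable_cong]: "sets M = sets borel" by fact
  have [measurable]: "W \<in> sets borel" by fact
  have "(\<integral>\<^sup>+x. ennreal (mollified W l x) \<partial>M)
     = (\<integral>\<^sup>+x. \<integral>\<^sup>+y. ennreal l * indicator W y * in_window l x y \<partial>lborel \<partial>M)"
    by (simp add: ennreal_mollified[OF W])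
  also have "\<dots> = (\<integral>\<^sup>+y. \<integral>\<^sup>+x. ennreal l * indicator W y * in_window l x y \<partial>M \<partial>lborel)"
  proof (rule Fubini')
    have "(\<lambda>p::real\<times>real. ennreal l * indicator W (fst p) * in_window l (snd p) (fst p))
      \<in> borel_measurable (lborel \<Otimes>\<^sub>M M)"
      unfolding indicator_def by measurable
    then show "(\<lambda>(y, x). ennreal l * indicator W y * in_window l x y)
      \<in> borel_measurable (lborel \<Otimes>\<^sub>M M)" by (simp add: case_prod_beta')
  qed
  also have "\<dots> = (\<integral>\<^sup>+y. ennreal l * indicator W y * emeasure M {y - 1 / l..<y} \<partial>lborel)"
  proof (rule nn_integral_cong)
    fix y :: real
    have "(\<integral>\<^sup>+x. ennreal l * indicator W y * in_window l x y \<partial>M)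
      = (\<integral>\<^sup>+x. ennreal l * indicator W y * indicator {y - 1 / l..<y} x \<partial>M)"
      by (intro nn_integral_cong) (auto simp: indicator_def)
    also have "\<dots> = ennreal l * indicator W y * emeasure M {y - 1 / l..<y}"
      using M by (simp add: nn_integral_cmult_indicator)
    finally show "(\<integral>\<^sup>+x. ennreal l * indicator W y * in_window l x y \<partial>M)
      = ennreal l * indicator W y * emeasure M {y - 1 / l..<y}" .
  qed
  finally show ?thesis .
qed

lemma nn_integral_mollified_lborel:
  assumes W: "W \<in> sets borel" "0 < l"
  shows "(\<integral>\<^sup>+x. ennreal (mollified W l x) \<partial>lborel) = emeasure lborel W"
proof -
  have "(\<integral>\<^sup>+x. ennreal (mollified W l x) \<partial>lborel)
    = (\<integral>\<^sup>+y. ennreal l * indicator W y * emeasure lborel {y - 1 / l..<y} \<partial>lborel)"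
    by (intro nn_integral_mollified W lborel.sigma_finite_measure_axioms) simp
  also have "\<dots> = (\<integral>\<^sup>+y. indicator W y \<partial>lborel)"
  proof (rule nn_integral_cong)
    fix y :: real
    have "ennreal l * emeasure lborel {y - 1 / l..<y} = 1"
      using W(2) by (simp add: emeasure_lborel_Ico ennreal_mult[symmetric])
    then show "ennreal l * indicator W y * emeasure lborel {y - 1 / l..<y} = indicator W y"
      by (metis mult.commute mult.left_commute mult.right_neutral)
  qed
  finally show ?thesis using W by simp
qed

lemma integral_mollified_P1:
  assumes W: "W \<in> sets borel" "0 < l" "emeasure lborel W < \<infinity>" and M: "\<mu> \<in> P1"
  shows "integrable lborel (\<lambda>y. indicator W y * (l * (tail \<mu> (y - 1 / l) - tail \<mu> y)))"
    and "(\<integral>x. mollified W l x \<partial>\<mu>) = (\<integral>y. indicator W y * (l * (tail \<mu> (y - 1 / l) - tail \<mu> y)) \<partial>lborel)"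
proof -
  let ?g = "\<lambda>y. indicator W y * (l * (tail \<mu> (y - 1 / l) - tail \<mu> y))"
  note f = P1_facts[OF M]
  interpret prob_space \<mu> by fact
  have [measurable]: "tail \<mu> \<in> borel_measurable borel" by (rule tail_measurable[OF M])
  have [measurable]: "W \<in> sets borel" by fact
  have diff: "measure \<mu> {y - 1 / l..<y} = tail \<mu> (y - 1 / l) - tail \<mu> y" for y
  proof -
    have "{y - 1 / l..<y} = {y - 1 / l..} - {y..}" by auto
    moreover have "measure \<mu> ({y - 1 / l..} - {y..}) = measure \<mu> {y - 1 / l..} - measure \<mu> {y..}"
      using W f by (intro finite_measure_Diff) auto
    ultimately show ?thesis by (simp add: tail_def)
  qed
  have nonneg: "0 \<le> tail \<mu> (y - 1 / l) - tail \<mu> y" for y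
    unfolding diff[symmetric] by simp
  have le1: "tail \<mu> (y - 1 / l) - tail \<mu> y \<le> 1" for y
    unfolding diff[symmetric] by simp
  show int: "integrable lborel ?g"
  proof (rule Bochner_Integration.integrable_bound)
    show "integrable lborel (\<lambda>y. l * indicator W y :: real)" using W by simp
    show "AE y in lborel. norm (?g y) \<le> norm (l * indicator W y)"
      using nonneg le1 W by (auto simp: indicator_def abs_mult)
  qed simp
  have "ennreal (\<integral>x. mollified W l x \<partial>\<mu>) = (\<integral>\<^sup>+x. ennreal (mollified W l x) \<partial>\<mu>)"
  proof (rule nn_integral_eq_integral[symmetric])
    show "integrable \<mu> (mollified W l)"
      using mollified_bounds[OF W(1,2)] mollified_measurable[OF W(1,2)] f(2)
      by (intro integrable_const_bound[of _ 1]) (auto cong: measurable_cong_sets)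
  qed (use mollified_bounds[OF W(1,2)] in auto)
  also have "\<dots> = (\<integral>\<^sup>+y. ennreal l * indicator W y * emeasure \<mu> {y - 1 / l..<y} \<partial>lborel)"
    by (intro nn_integral_mollified W f sigma_finite_measure_axioms)
  also have "\<dots> = (\<integral>\<^sup>+y. ennreal (?g y) \<partial>lborel)"
    using W nonneg by (intro nn_integral_cong)
      (auto simp: emeasure_eq_measure diff indicator_def ennreal_mult)
  also have "\<dots> = ennreal (\<integral>y. ?g y \<partial>lborel)"
    using W nonneg by (intro nn_integral_eq_integral int) auto
  finally show "(\<integral>x. mollified W l x \<partial>\<mu>) = (\<integral>y. ?g y \<partial>lborel)"
    using W nonneg mollified_bounds[OF W(1,2)]
    by (subst (asm) ennreal_inj) (auto intro!: integral_nonneg_AE)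
qed

text \<open>Tails of measures on the half-line equal one at negative arguments, so negative arguments do not
contribute; this makes translations of the tails available.\<close>

lemma W1_eq_full_integral:
  assumes "\<mu> \<in> P1" "\<nu> \<in> P1"
  shows "integrable lborel (\<lambda>y. \<bar>tail \<mu> y - tail \<nu> y\<bar>)"
    and "W1 \<mu> \<nu> = (\<integral>y. \<bar>tail \<mu> y - tail \<nu> y\<bar> \<partial>lborel)"
proof -
  have one: "tail a x = 1" if "a \<in> P1" "x \<le> 0" for a x
  proof -
    interpret A: prob_space a using P1_facts[OF that(1)] by simp
    have "measure a {0..} \<le> measure a {x..}"
      using that P1_facts[OF that(1)] by (intro A.finite_measure_mono) auto
    then show ?thesis
      using P1_facts[OF that(1)] A.prob_le_1[of "{x..}"] unfolding tail_def by simp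
  qed
  have eq: "indicator {0..} y *\<^sub>R \<bar>tail \<mu> y - tail \<nu> y\<bar> = \<bar>tail \<mu> y - tail \<nu> y\<bar>" for y :: real
    using one[OF assms(1), of y] one[OF assms(2), of y] by (auto simp: indicator_def)
  show "integrable lborel (\<lambda>y. \<bar>tail \<mu> y - tail \<nu> y\<bar>)"
    using W1_integrable[OF assms] unfolding set_integrable_def eq .
  show "W1 \<mu> \<nu> = (\<integral>y. \<bar>tail \<mu> y - tail \<nu> y\<bar> \<partial>lborel)"
    unfolding W1_def set_lebesgue_integral_def eq ..
qed

text \<open>By \<open>integral_mollified_P1\<close> the integral depends on \<open>\<mu>\<close> only through its tail and the tail shifted by \<open>1 / l\<close>.
Each of the two contributes \<open>l\<close> times the \<open>L1\<close> distance of the tails, which is \<open>W1\<close>.\<close>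

lemma mollified_W1_lipschitz:
  assumes W: "W \<in> sets borel" "0 < l" "emeasure lborel W < \<infinity>" and M: "\<mu> \<in> P1" "\<nu> \<in> P1"
  shows "\<bar>(\<integral>x. mollified W l x \<partial>\<mu>) - (\<integral>x. mollified W l x \<partial>\<nu>)\<bar> \<le> 2 * l * W1 \<mu> \<nu>"
proof -
  let ?g = "\<lambda>\<mu> y. indicator W y * (l * (tail \<mu> (y - 1 / l) - tail \<mu> y))"
  let ?D = "\<lambda>y. \<bar>tail \<mu> y - tail \<nu> y\<bar>"
  note D = W1_eq_full_integral[OF M]
  have D': "integrable lborel (\<lambda>y. ?D (y - 1 / l))"
    using lborel_integrable_real_affine[OF D(1), of 1 "- 1 / l"] by simp
  have D'': "(\<integral>y. ?D (y - 1 / l) \<partial>lborel) = W1 \<mu> \<nu>"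
    unfolding D(2) using lborel_integral_real_affine[of 1 ?D "- 1 / l"] by simp
  note I = integral_mollified_P1[OF W M(1)] and J = integral_mollified_P1[OF W M(2)]
  have "\<bar>(\<integral>x. mollified W l x \<partial>\<mu>) - (\<integral>x. mollified W l x \<partial>\<nu>)\<bar>
    = \<bar>\<integral>y. ?g \<mu> y - ?g \<nu> y \<partial>lborel\<bar>"
    unfolding I(2) J(2) by (subst Bochner_Integration.integral_diff[OF I(1) J(1)]) simp
  also have "\<dots> \<le> (\<integral>y. \<bar>?g \<mu> y - ?g \<nu> y\<bar> \<partial>lborel)"
    by (rule integral_abs_bound)
  also have "\<dots> \<le> (\<integral>y. l * ?D (y - 1 / l) + l * ?D y \<partial>lborel)"
  proof (rule integral_mono)
    show "integrable lborel (\<lambda>y. \<bar>?g \<mu> y - ?g \<nu> y\<bar>)"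
      by (intro integrable_abs Bochner_Integration.integrable_diff I J)
    show "integrable lborel (\<lambda>y. l * ?D (y - 1 / l) + l * ?D y)"
      using D D' by simp
    fix y :: real
    have "\<bar>l * (tail \<mu> (y - 1 / l) - tail \<mu> y) - l * (tail \<nu> (y - 1 / l) - tail \<nu> y)\<bar>
        = l * \<bar>(tail \<mu> (y - 1 / l) - tail \<nu> (y - 1 / l)) - (tail \<mu> y - tail \<nu> y)\<bar>"
      using W(2) by (simp add: right_diff_distrib[symmetric] abs_mult)
    also have "\<dots> \<le> l * (?D (y - 1 / l) + ?D y)"
      using W(2) by (intro mult_left_mono) auto
    finally show "\<bar>?g \<mu> y - ?g \<nu> y\<bar>
      \<le> l * ?D (y - 1 / l) + l * ?D y"
      using W(2) by (auto simp: indicator_def algebra_simps)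
  qed
  also have "\<dots> = 2 * l * W1 \<mu> \<nu>"
    using D D' D'' by simp
  finally show ?thesis .
qed

text \<open>At a point of the open set \<open>W\<close> all sufficiently short windows lie in \<open>W\<close>, so the averages converge to one there.\<close>

lemma open_measure_le_of_mollified:
  assumes "open W" "prob_space \<mu>" "sets \<mu> = sets borel"
    and le: "\<And>n. (\<integral>x. mollified W (real (Suc n)) x \<partial>\<mu>) \<le> s"
  shows "measure \<mu> W \<le> s"
proof -
  interpret prob_space \<mu> by fact
  have W: "W \<in> sets borel" using assms by simp
  have "(\<lambda>n. \<integral>x. mollified W (real (Suc n)) x * indicator W x \<partial>\<mu>) \<longlonglongrightarrow> (\<integral>x. indicator W x \<partial>\<mu>)"
  proof (rule integral_dominated_convergence[where w = "\<lambda>_. 1"])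
    show "AE x in \<mu>. (\<lambda>n. mollified W (real (Suc n)) x * indicator W x) \<longlonglongrightarrow> indicator W x"
    proof (rule AE_I2)
      fix x
      show "(\<lambda>n. mollified W (real (Suc n)) x * indicator W x) \<longlonglongrightarrow> indicator W x"
      proof (cases "x \<in> W")
        case True
        then obtain e where e: "0 < e" "ball x e \<subseteq> W" using \<open>open W\<close> open_contains_ball by blast
        obtain n0 where n0: "1 / real (Suc n0) < e" using nat_approx_posE e(1) by metis
        have "mollified W (real (Suc n)) x = 1" if "n0 \<le> n" for n
        proof -
          have "1 / real (Suc n) \<le> 1 / real (Suc n0)" using that by (simp add: field_simps)
          then have "{x<..x + 1 / real (Suc n)} \<subseteq> ball x e" using n0 by (auto simp: dist_real_def)
          then have "W \<inter> {x<..x + 1 / real (Suc n)} = {x<..x + 1 / real (Suc n)}" using e by auto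
          then show ?thesis by (simp add: mollified_def del: of_nat_Suc)
        qed
        then have "\<forall>\<^sub>F n in sequentially. mollified W (real (Suc n)) x * indicator W x = 1"
          using True by (auto simp: eventually_sequentially intro!: exI[of _ n0])
        then show ?thesis using True by (simp add: tendsto_eventually)
      qed simp
    qed
    show "AE x in \<mu>. norm (mollified W (real (Suc n)) x * indicator W x) \<le> 1" for n
      using mollified_bounds[OF W, of "real (Suc n)"] by (auto simp: indicator_def simp del: of_nat_Suc)
    show "(\<lambda>x. mollified W (real (Suc n)) x * indicator W x) \<in> borel_measurable \<mu>" for n
      using mollified_measurable[OF W, of "real (Suc n)"] W assms(3)
      by (auto simp del: of_nat_Suc cong: measurable_cong_sets)
  qed (use W assms in \<open>auto cong: measurable_cong_sets\<close>)
  then have "(\<integral>x. indicator W x \<partial>\<mu>) \<le> s"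
  proof (rule LIMSEQ_le_const2)
    have "(\<integral>x. mollified W (real (Suc n)) x * indicator W x \<partial>\<mu>) \<le> (\<integral>x. mollified W (real (Suc n)) x \<partial>\<mu>)" for n
    proof (rule integral_mono)
      show "integrable \<mu> (mollified W (real (Suc n)))"
        using mollified_bounds[OF W, of "real (Suc n)"] mollified_measurable[OF W, of "real (Suc n)"] assms(3)
        by (intro integrable_const_bound[of _ 1]) (auto cong: measurable_cong_sets simp del: of_nat_Suc)
      then show "integrable \<mu> (\<lambda>x. mollified W (real (Suc n)) x * indicator W x)"
        using W assms(3) by (intro integrable_mult_indicator[where 'b = real, simplified mult.commute real_scaleR_def]) auto
    qed (use mollified_bounds[OF W, of "real (Suc n)"] in \<open>auto simp: indicator_def simp del: of_nat_Suc\<close>)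
    then show "\<exists>N. \<forall>n\<ge>N. (\<integral>x. mollified W (real (Suc n)) x * indicator W x \<partial>\<mu>) \<le> s"
      using le order_trans by blast
  qed
  then show ?thesis using W assms by simp
qed

text \<open>By convexity \<open>exp (\<theta> f) \<le> 1 + exp \<theta> * f\<close> for \<open>0 \<le> f \<le> 1\<close>. The exponential density integrates to one and is at
most \<open>b\<close>, and \<open>f\<close> integrates to the measure of \<open>W\<close>. This is how small sets pay for a large parameter \<open>\<theta>\<close>.\<close>

lemma exp_moment_mollified:
  assumes W: "W \<in> sets borel" "0 < l" and b: "0 < b" and lam: "0 \<le> \<theta>"
  shows "(\<integral>\<^sup>+x. ennreal (b * exp (- b * x) * exp (\<theta> * mollified W l x)) * indicator {0..} x \<partial>lborel)
    \<le> 1 + ennreal (b * exp \<theta>) * emeasure lborel W"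
proof -
  have "(\<integral>\<^sup>+x. ennreal (b * exp (- b * x) * exp (\<theta> * mollified W l x)) * indicator {0..} x \<partial>lborel)
     \<le> (\<integral>\<^sup>+x. ennreal (exponential_density b x) + ennreal (b * exp \<theta>) * ennreal (mollified W l x) \<partial>lborel)"
  proof (rule nn_integral_mono)
    fix x :: real
    let ?f = "mollified W l x"
    note f = mollified_bounds[OF W, of x]
    show "ennreal (b * exp (- b * x) * exp (\<theta> * ?f)) * indicator {0..} x
      \<le> ennreal (exponential_density b x) + ennreal (b * exp \<theta>) * ennreal ?f"
    proof (cases "0 \<le> x")
      case True
      have "exp ((1 - ?f) *\<^sub>R 0 + ?f *\<^sub>R \<theta>) \<le> (1 - ?f) * exp 0 + ?f * exp \<theta>"
        using f by (intro convex_onD[OF exp_convex]) auto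
      then have "exp (\<theta> * ?f) \<le> 1 + exp \<theta> * ?f"
        using f by (simp add: algebra_simps)
      then have "b * exp (- b * x) * exp (\<theta> * ?f) \<le> b * exp (- b * x) * (1 + exp \<theta> * ?f)"
        using b by (intro mult_left_mono) auto
      also have "\<dots> \<le> b * exp (- b * x) + b * exp \<theta> * ?f"
      proof -
        have "exp (- b * x) * (b * exp \<theta> * ?f) \<le> 1 * (b * exp \<theta> * ?f)"
          using True b f by (intro mult_right_mono) auto
        then show ?thesis by (simp add: algebra_simps)
      qed
      finally show ?thesis using True b f
        by (simp add: exponential_density_def ennreal_plus[symmetric] ennreal_mult[symmetric] mult.commute del: ennreal_plus)
    qed simp
  qed
  also have "\<dots> = (\<integral>\<^sup>+x. ennreal (exponential_density b x) \<partial>lborel)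
      + ennreal (b * exp \<theta>) * (\<integral>\<^sup>+x. ennreal (mollified W l x) \<partial>lborel)"
    using mollified_measurable[OF W] by (subst nn_integral_add) (auto simp: nn_integral_cmult)
  also have "(\<integral>\<^sup>+x. ennreal (exponential_density b x) \<partial>lborel) = 1"
    using prob_space.emeasure_space_1[OF prob_space_exponential_density[OF b]]
    by (simp add: emeasure_density)
  finally show ?thesis by (simp add: nn_integral_mollified_lborel[OF W])
qed


definition rat_interval :: "nat \<Rightarrow> real set" where
  "rat_interval n = (case prod_decode n of (i, j) \<Rightarrow>
     {real_of_rat (nat_to_rat_surj i)<..<real_of_rat (nat_to_rat_surj j)})"

lemma open_eq_Union_rat_interval:
  assumes "open U"
  shows "U = (\<Union>n\<in>{n. rat_interval n \<subseteq> U}. rat_interval n)"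
proof (intro equalityI subsetI)
  fix x assume "x \<in> U"
  then obtain e where e: "0 < e" "ball x e \<subseteq> U" using assms open_contains_ball by blast
  obtain p q where p: "x - e < real_of_rat p" "real_of_rat p < x"
    and q: "x < real_of_rat q" "real_of_rat q < x + e"
    using of_rat_dense[of "x - e" x] of_rat_dense[of x "x + e"] e(1) by auto
  obtain i j where ij: "nat_to_rat_surj i = p" "nat_to_rat_surj j = q"
    using surj_nat_to_rat_surj by (metis surjD)
  have "rat_interval (prod_encode (i, j)) = {real_of_rat p<..<real_of_rat q}"
    using ij by (simp add: rat_interval_def)
  moreover have "{real_of_rat p<..<real_of_rat q} \<subseteq> ball x e"
    using p q by (auto simp: dist_real_def)
  ultimately show "x \<in> (\<Union>n\<in>{n. rat_interval n \<subseteq> U}. rat_interval n)"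
    using p q e by (intro UN_I[of "prod_encode (i, j)"]) auto
qed auto

text \<open>An enumeration of the finite unions of rational intervals of measure at most \<open>\<delta>\<close>; a union that is too
large is replaced by the empty set, so that the bound on the measure holds for every index.\<close>

definition test_set :: "real \<Rightarrow> nat \<Rightarrow> real set" where
  "test_set \<delta> n = (let W = (\<Union>i\<in>set_decode n. rat_interval i) in
     if emeasure lborel W \<le> ennreal \<delta> then W else {})"

lemma test_set:
  shows "open (test_set \<delta> n)" "test_set \<delta> n \<in> sets borel" "emeasure lborel (test_set \<delta> n) \<le> ennreal \<delta>"
proof -
  have "open (rat_interval i)" for i by (auto simp: rat_interval_def split: prod.split)
  then show "open (test_set \<delta> n)" by (auto simp: test_set_def Let_def)
  then show "test_set \<delta> n \<in> sets borel" by simp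
  show "emeasure lborel (test_set \<delta> n) \<le> ennreal \<delta>" by (auto simp: test_set_def Let_def)
qed

definition test_fun :: "real \<Rightarrow> nat \<Rightarrow> real \<Rightarrow> real" where
  "test_fun \<delta> j = (case prod_decode j of (n, m) \<Rightarrow> mollified (test_set \<delta> n) (real (Suc m)))"

definition test_slope :: "nat \<Rightarrow> real" where
  "test_slope j = real (Suc (snd (prod_decode j)))"

lemma test_slope_pos: "0 < test_slope j"
  by (simp add: test_slope_def)

lemma test_fun_alt: "test_fun \<delta> j = mollified (test_set \<delta> (fst (prod_decode j))) (test_slope j)"
  by (simp add: test_fun_def test_slope_def split: prod.split)

lemma test_fun:
  shows "0 \<le> test_fun \<delta> j x" "test_fun \<delta> j x \<le> 1" "test_fun \<delta> j \<in> borel_measurable borel"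
    and "x \<le> y \<Longrightarrow> test_fun \<delta> j x \<le> test_fun \<delta> j y + test_slope j * (y - x)"
  unfolding test_fun_alt using test_set(2) test_slope_pos
  by (auto intro: mollified_bounds mollified_measurable mollified_increment)

definition max_test :: "real \<Rightarrow> nat \<Rightarrow> real measure \<Rightarrow> real" where
  "max_test \<delta> k \<mu> = Max ((\<lambda>j. \<integral>x. test_fun \<delta> j x \<partial>\<mu>) ` {..k})"

lemma test_fun_integral_bounds:
  assumes "prob_space \<mu>" "sets \<mu> = sets borel"
  shows "integrable \<mu> (test_fun \<delta> j)" "0 \<le> (\<integral>x. test_fun \<delta> j x \<partial>\<mu>)" "(\<integral>x. test_fun \<delta> j x \<partial>\<mu>) \<le> 1"
proof -
  interpret prob_space \<mu> by fact
  show *: "integrable \<mu> (test_fun \<delta> j)"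
    using test_fun(1-3)[of \<delta> j] assms(2)
    by (intro integrable_const_bound[of _ 1]) (auto cong: measurable_cong_sets)
  show "0 \<le> (\<integral>x. test_fun \<delta> j x \<partial>\<mu>)" "(\<integral>x. test_fun \<delta> j x \<partial>\<mu>) \<le> 1"
    using test_fun(1-3)[of \<delta> j] * by (auto intro!: integral_nonneg_AE integral_le_const)
qed

lemma max_test_bounds:
  assumes "prob_space \<mu>" "sets \<mu> = sets borel"
  shows "0 \<le> max_test \<delta> k \<mu>" "max_test \<delta> k \<mu> \<le> 1"
proof -
  have "(\<integral>x. test_fun \<delta> 0 x \<partial>\<mu>) \<le> max_test \<delta> k \<mu>"
    unfolding max_test_def by (intro Max_ge) auto
  then show "0 \<le> max_test \<delta> k \<mu>"
    using test_fun_integral_bounds(2)[OF assms, of \<delta> 0] by simp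
  show "max_test \<delta> k \<mu> \<le> 1"
    unfolding max_test_def using test_fun_integral_bounds[OF assms] by (subst Max_le_iff) auto
qed

lemma max_test_mono: "k \<le> k' \<Longrightarrow> max_test \<delta> k \<mu> \<le> max_test \<delta> k' \<mu>"
  unfolding max_test_def by (intro Max_mono) auto

text \<open>A maximum of finitely many Lipschitz functions is Lipschitz with the largest of the constants.\<close>

lemma max_test_W1_lipschitz:
  assumes "\<mu> \<in> P1" "\<nu> \<in> P1"
  shows "\<bar>max_test \<delta> k \<mu> - max_test \<delta> k \<nu>\<bar> \<le> 2 * Max (test_slope ` {..k}) * W1 \<mu> \<nu>"
proof -
  have W1: "0 \<le> W1 a c" for a c using Metric_space.nonneg[OF Metric_space_P1] .
  have *: "max_test \<delta> k \<mu> \<le> max_test \<delta> k \<nu> + 2 * Max (test_slope ` {..k}) * W1 \<mu> \<nu>"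
    if "\<mu> \<in> P1" "\<nu> \<in> P1" for \<mu> \<nu>
  proof -
    have "(\<integral>x. test_fun \<delta> j x \<partial>\<mu>) \<le> max_test \<delta> k \<nu> + 2 * Max (test_slope ` {..k}) * W1 \<mu> \<nu>" if "j \<le> k" for j
    proof -
      have "emeasure lborel (test_set \<delta> n) < \<infinity>" for n
        using test_set(3)[of \<delta> n] by (rule order_le_less_trans) simp
      then have "\<bar>(\<integral>x. test_fun \<delta> j x \<partial>\<mu>) - (\<integral>x. test_fun \<delta> j x \<partial>\<nu>)\<bar> \<le> 2 * test_slope j * W1 \<mu> \<nu>"
        unfolding test_fun_alt
        by (intro mollified_W1_lipschitz test_set test_slope_pos \<open>\<mu> \<in> P1\<close> \<open>\<nu> \<in> P1\<close>)
      also have "\<dots> \<le> 2 * Max (test_slope ` {..k}) * W1 \<mu> \<nu>"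
        using that by (intro mult_right_mono mult_left_mono W1 Max_ge) auto
      finally have "(\<integral>x. test_fun \<delta> j x \<partial>\<mu>) \<le> (\<integral>x. test_fun \<delta> j x \<partial>\<nu>) + 2 * Max (test_slope ` {..k}) * W1 \<mu> \<nu>"
        by simp
      moreover have "(\<integral>x. test_fun \<delta> j x \<partial>\<nu>) \<le> max_test \<delta> k \<nu>"
        unfolding max_test_def using that by (intro Max_ge) auto
      ultimately show ?thesis by simp
    qed
    then show ?thesis
      by (subst max_test_def) (simp add: Max_le_iff)
  qed
  show ?thesis
    using *[OF assms] *[OF assms(2,1)] Metric_space.commute[OF Metric_space_P1, of \<mu> \<nu>] by (simp add: abs_le_iff)
qed

text \<open>Every finite union of rational intervals inside \<open>U\<close> belongs to the family of test sets, and \<open>U\<close> is the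
increasing limit of such unions.\<close>

lemma open_measure_le_of_max_test:
  assumes "open U" "emeasure lborel U \<le> ennreal \<delta>" "prob_space \<mu>" "sets \<mu> = sets borel"
    and le: "\<And>k. max_test \<delta> k \<mu> \<le> s"
  shows "measure \<mu> U \<le> s"
proof -
  interpret prob_space \<mu> by fact
  define W where "W k = (\<Union>i\<in>{i. i < k \<and> rat_interval i \<subseteq> U}. rat_interval i)" for k :: nat
  have "measure \<mu> (W k) \<le> s" for k
  proof -
    have "finite {i. i < k \<and> rat_interval i \<subseteq> U}" by simp
    then have "set_decode (set_encode {i. i < k \<and> rat_interval i \<subseteq> U}) = {i. i < k \<and> rat_interval i \<subseteq> U}"
      by simp
    moreover have "emeasure lborel (W k) \<le> ennreal \<delta>"
    proof -
      have "emeasure lborel (W k) \<le> emeasure lborel U"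
        using \<open>open U\<close> by (intro emeasure_mono) (auto simp: W_def)
      then show ?thesis using assms(2) by simp
    qed
    ultimately have W: "W k = test_set \<delta> (set_encode {i. i < k \<and> rat_interval i \<subseteq> U})"
      by (simp add: test_set_def W_def Let_def)
    have "(\<integral>x. mollified (W k) (real (Suc m)) x \<partial>\<mu>) \<le> s" for m
    proof -
      define j where "j = prod_encode (set_encode {i. i < k \<and> rat_interval i \<subseteq> U}, m)"
      have "(\<integral>x. mollified (W k) (real (Suc m)) x \<partial>\<mu>) = (\<integral>x. test_fun \<delta> j x \<partial>\<mu>)"
        by (simp add: test_fun_def j_def W)
      also have "\<dots> \<le> max_test \<delta> j \<mu>"
        unfolding max_test_def by (intro Max_ge) auto
      finally show ?thesis using le[of j] by simp
    qed
    moreover have "open (W k)" unfolding W by (rule test_set)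
    ultimately show ?thesis
      using assms by (intro open_measure_le_of_mollified)
  qed
  moreover have "(\<lambda>k. measure \<mu> (W k)) \<longlonglongrightarrow> measure \<mu> (\<Union>k. W k)"
  proof (rule finite_Lim_measure_incseq)
    have "open (W k)" for k
      unfolding W_def by (intro open_UN) (auto simp: rat_interval_def split: prod.split)
    then show "range W \<subseteq> sets \<mu>" using assms(4) by auto
    show "incseq W" unfolding incseq_def W_def by (intro allI impI UN_mono) auto
  qed
  moreover have "(\<Union>k. W k) = U"
  proof (intro equalityI subsetI)
    fix x assume "x \<in> U"
    then obtain i where "rat_interval i \<subseteq> U" "x \<in> rat_interval i"
      by (subst (asm) open_eq_Union_rat_interval[OF \<open>open U\<close>]) auto
    then have "x \<in> W (Suc i)" unfolding W_def by blast
    then show "x \<in> (\<Union>k. W k)" by blast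
  qed (auto simp: W_def)
  ultimately show ?thesis by (auto intro: LIMSEQ_le_const2)
qed

text \<open>A Lebesgue null set is contained in open sets of arbitrarily small Lebesgue measure, by outer regularity.
Thus the hypothesis makes it a null set of \<open>\<mu>\<close>, and the Radon-Nikodym theorem applies.\<close>

lemma density_exists_if_max_test_small:
  assumes "prob_space \<mu>" "sets \<mu> = sets borel" and \<delta>: "\<And>m. 0 < \<delta> m"
    and small: "\<And>e. 0 < e \<Longrightarrow> \<exists>m. \<forall>k. max_test (\<delta> m) k \<mu> \<le> e"
  shows "\<exists>f :: real \<Rightarrow> ennreal. f \<in> borel_measurable lborel \<and> \<mu> = density lborel f"
proof -
  interpret prob_space \<mu> by fact
  have "absolutely_continuous (lborel :: real measure) \<mu>"
    unfolding absolutely_continuous_def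
  proof
    fix A :: "real set" assume "A \<in> null_sets lborel"
    then have A: "A \<in> sets borel" "emeasure lborel A = 0" by (auto simp: null_sets_def)
    have small_A: "measure \<mu> A \<le> e" if "0 < e" for e
    proof -
      obtain m where m: "\<And>k. max_test (\<delta> m) k \<mu> \<le> e" using small \<open>0 < e\<close> by blast
      obtain U where U: "open U" "A \<subseteq> U" "emeasure lborel (U - A) < ennreal (\<delta> m)"
        using outer_regular_lborel[of A "\<delta> m"] A \<delta> by auto
      have "emeasure lborel U \<le> emeasure lborel ((U - A) \<union> A)"
        using U A by (intro emeasure_mono) auto
      also have "\<dots> \<le> emeasure lborel (U - A) + emeasure lborel A"
        using U A by (intro emeasure_subadditive) auto
      finally have "emeasure lborel U \<le> ennreal (\<delta> m)" using U A by simp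
      then have "measure \<mu> U \<le> e"
        using open_measure_le_of_max_test[OF U(1) _ assms(1,2) m] by simp
      moreover have "measure \<mu> A \<le> measure \<mu> U"
        using U assms(2) by (intro finite_measure_mono) auto
      ultimately show ?thesis by simp
    qed
    have "measure \<mu> A \<le> 0"
      by (rule dense_ge) (rule small_A)
    then have "measure \<mu> A = 0" using measure_nonneg[of \<mu> A] by simp
    then show "A \<in> null_sets \<mu>"
      using A assms(2) by (simp add: null_sets_def emeasure_eq_measure)
  qed
  then obtain f :: "real \<Rightarrow> ennreal" where "f \<in> borel_measurable lborel" "density lborel f = \<mu>"
    using sigma_finite_measure.Radon_Nikodym[OF sigma_finite_lborel, of \<mu>] assms(2) by auto
  then show ?thesis by blast
qed

section \<open>Time integrals on the Skorokhod space\<close>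

text \<open>Where a one-sided limit exists, values close to the limit point on that side are close to each other; so the
points at which the oscillation is at least \<open>e\<close> cannot accumulate from that side.\<close>

lemma one_sided_limit_small_oscillation:
  fixes g :: "real \<Rightarrow> real"
  assumes lim: "(g \<longlongrightarrow> l) (at y within S)" and S: "open S" "y \<notin> S" and e: "0 < e"
  shows "\<forall>\<^sub>F t in at y within S. \<exists>d>0. \<forall>s. \<bar>s - t\<bar> < d \<longrightarrow> \<bar>g s - g t\<bar> < e"
proof -
  obtain d where d: "0 < d" "\<And>x. x \<in> S \<Longrightarrow> x \<noteq> y \<Longrightarrow> dist x y < d \<Longrightarrow> dist (g x) l < e / 2"
    using tendstoD[OF lim, of "e / 2"] e unfolding eventually_at by auto
  show ?thesis
    unfolding eventually_at
  proof (rule exI[of _ d], intro conjI ballI impI)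
    fix t assume t: "t \<in> S" "t \<noteq> y \<and> dist t y < d"
    have "open (S \<inter> ball y d)" "t \<in> S \<inter> ball y d" using S t by (auto simp: dist_commute)
    then obtain d' where d': "0 < d'" "ball t d' \<subseteq> S \<inter> ball y d" using open_contains_ball by meson
    have "\<bar>g s - g t\<bar> < e" if "\<bar>s - t\<bar> < d'" for s
    proof -
      have "s \<in> S \<inter> ball y d" using that d' by (auto simp: subset_iff dist_real_def)
      then have "dist (g s) l < e / 2" using d(2)[of s] S by (auto simp: dist_commute)
      moreover have "dist (g t) l < e / 2" using d(2)[of t] t by auto
      ultimately show ?thesis unfolding dist_real_def by linarith
    qed
    then show "\<exists>d>0. \<forall>s. \<bar>s - t\<bar> < d \<longrightarrow> \<bar>g s - g t\<bar> < e" using d' by blast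
  qed (use d in simp)
qed

text \<open>For each \<open>e > 0\<close> the points of oscillation at least \<open>e\<close> have no accumulation point in \<open>(0, \<infinity>)\<close>, hence are countable.\<close>

lemma cadlag_real_countable_discontinuities:
  fixes g :: "real \<Rightarrow> real"
  assumes right: "\<And>t. 0 < t \<Longrightarrow> (g \<longlongrightarrow> g t) (at_right t)"
    and left: "\<And>t. 0 < t \<Longrightarrow> \<exists>l. (g \<longlongrightarrow> l) (at_left t)"
  shows "countable {t. 0 < t \<and> \<not> isCont g t}"
proof -
  define D where "D e = {t. \<not> (\<exists>d>0. \<forall>s. \<bar>s - t\<bar> < d \<longrightarrow> \<bar>g s - g t\<bar> < e)}" for e
  have "D e sparse_in {0<..}" if "0 < e" for e
    unfolding sparse_in_eventually_iff[OF open_greaterThan]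
  proof (intro ballI)
    fix y :: real assume "y \<in> {0<..}"
    then have y: "0 < y" by simp
    obtain l where l: "(g \<longlongrightarrow> l) (at_left y)" using left[OF y] by blast
    have "\<forall>\<^sub>F t in at_left y. t \<notin> D e" "\<forall>\<^sub>F t in at_right y. t \<notin> D e"
      using one_sided_limit_small_oscillation[OF l _ _ that]
        one_sided_limit_small_oscillation[OF right[OF y] _ _ that] by (auto simp: D_def)
    then show "\<forall>\<^sub>F t in at y. t \<notin> D e" by (simp add: eventually_at_split)
  qed
  then have "countable ({0<..} \<inter> D (1 / real (Suc n)))" for n
    by (intro sparse_imp_countable) (auto simp del: of_nat_Suc)
  then have "countable (\<Union>n. {0<..} \<inter> D (1 / real (Suc n)))" by blast
  moreover have "{t. 0 < t \<and> \<not> isCont g t} \<subseteq> (\<Union>n. {0<..} \<inter> D (1 / real (Suc n)))"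
  proof (intro subsetI, rule ccontr)
    fix t assume t: "t \<in> {t. 0 < t \<and> \<not> isCont g t}" "t \<notin> (\<Union>n. {0<..} \<inter> D (1 / real (Suc n)))"
    have "isCont g t"
      unfolding isCont_def LIM_def
    proof (intro allI impI)
      fix r :: real assume "0 < r"
      obtain n where n: "1 / real (Suc n) < r" using nat_approx_posE[OF \<open>0 < r\<close>] .
      from t have "t \<notin> D (1 / real (Suc n))" by auto
      then obtain d where "0 < d" "\<And>s. \<bar>s - t\<bar> < d \<Longrightarrow> \<bar>g s - g t\<bar> < 1 / real (Suc n)"
        unfolding D_def by blast
      then show "\<exists>s>0. \<forall>x. x \<noteq> t \<and> dist x t < s \<longrightarrow> dist (g x) (g t) < r"
        using n by (intro exI[of _ d]) (auto simp: dist_real_def intro: less_trans)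
    qed
    with t show False by simp
  qed
  ultimately show ?thesis by (rule countable_subset[rotated])
qed

text \<open>A right continuous process is the limit of the processes that read off its value at the next point of the
grid of mesh \<open>1 / (n + 1)\<close>, and these involve only countably many time points.\<close>

lemma right_continuous_jointly_measurable:
  fixes Z :: "real \<Rightarrow> 'w \<Rightarrow> real"
  assumes meas: "\<And>t. 0 \<le> t \<Longrightarrow> Z t \<in> borel_measurable \<Omega>"
    and right: "\<And>t \<omega>. 0 \<le> t \<Longrightarrow> \<omega> \<in> space \<Omega> \<Longrightarrow> ((\<lambda>s. Z s \<omega>) \<longlongrightarrow> Z t \<omega>) (at_right t)"
  shows "(\<lambda>(t, \<omega>). indicator {0<..T} t * Z t \<omega>) \<in> borel_measurable (lborel \<Otimes>\<^sub>M \<Omega>)"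
proof -
  \<comment> \<open>the grid point strictly to the right of \<open>t\<close>, so that right continuity applies\<close>
  define q where "q n t = real_of_int (\<lfloor>real (Suc n) * t\<rfloor> + 1) / real (Suc n)" for n t
  have q: "t < q n t" "q n t \<le> t + 1 / real (Suc n)" for n t
  proof -
    have "real (Suc n) * t < real_of_int (\<lfloor>real (Suc n) * t\<rfloor> + 1)"
      "real_of_int (\<lfloor>real (Suc n) * t\<rfloor> + 1) \<le> real (Suc n) * t + 1" by linarith+
    then show "t < q n t" "q n t \<le> t + 1 / real (Suc n)"
      unfolding q_def by (simp_all add: pos_less_divide_eq pos_divide_le_eq algebra_simps del: of_nat_Suc)
  qed
  let ?F = "\<lambda>n p. indicator {0<..T} (fst p) * Z (max 0 (q n (fst p))) (snd p)"
  have "(\<lambda>p. indicator {0<..T} (fst p) * Z (fst p) (snd p)) \<in> borel_measurable (lborel \<Otimes>\<^sub>M \<Omega>)"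
  proof (rule borel_measurable_LIMSEQ_real)
    fix n
    have "(\<lambda>p. Z (max 0 (real_of_int (\<lfloor>real (Suc n) * fst p\<rfloor> + 1) / real (Suc n))) (snd p))
      \<in> borel_measurable (lborel \<Otimes>\<^sub>M \<Omega>)"
    proof (rule measurable_compose_countable[where g = "\<lambda>p. \<lfloor>real (Suc n) * fst p\<rfloor>"
          and f = "\<lambda>i p. Z (max 0 (real_of_int (i + 1) / real (Suc n))) (snd p)"])
      show "(\<lambda>p. Z (max 0 (real_of_int (i + 1) / real (Suc n))) (snd p)) \<in> borel_measurable (lborel \<Otimes>\<^sub>M \<Omega>)" for i
        using meas[of "max 0 (real_of_int (i + 1) / real (Suc n))"]
        by (intro measurable_compose[OF measurable_snd]) auto
    qed measurable
    then show "?F n \<in> borel_measurable (lborel \<Otimes>\<^sub>M \<Omega>)"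
      unfolding q_def by measurable
  next
    fix p :: "real \<times> 'w" assume "p \<in> space (lborel \<Otimes>\<^sub>M \<Omega>)"
    then have p: "snd p \<in> space \<Omega>" by (auto simp: space_pair_measure)
    show "(\<lambda>n. ?F n p) \<longlonglongrightarrow> indicator {0<..T} (fst p) * Z (fst p) (snd p)"
    proof (cases "0 < fst p")
      case True
      have "(\<lambda>n. fst p + 1 / real (Suc n)) \<longlonglongrightarrow> fst p + 0"
        using LIMSEQ_inverse_real_of_nat by (intro tendsto_intros) (simp add: inverse_eq_divide)
      then have "(\<lambda>n. q n (fst p)) \<longlonglongrightarrow> fst p"
        by (intro tendsto_sandwich[of "\<lambda>_. fst p" "\<lambda>n. q n (fst p)" _ "\<lambda>n. fst p + 1 / real (Suc n)"])
          (use q less_imp_le[OF q(1)] in auto)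
      then have "filterlim (\<lambda>n. q n (fst p)) (at_right (fst p)) sequentially"
        using q less_imp_neq[OF q(1), symmetric] by (simp add: filterlim_at)
      then have "(\<lambda>n. Z (q n (fst p)) (snd p)) \<longlonglongrightarrow> Z (fst p) (snd p)"
        using right[OF less_imp_le[OF True] p] by (rule filterlim_compose[rotated])
      moreover have "max 0 (q n (fst p)) = q n (fst p)" for n
        using q(1)[of "fst p" n] True by simp
      ultimately show ?thesis by (intro tendsto_mult) auto
    qed simp
  qed
  then show ?thesis by (simp add: case_prod_beta')
qed

lemma right_continuous_measurable:
  fixes g :: "real \<Rightarrow> real"
  assumes "\<And>t. 0 \<le> t \<Longrightarrow> (g \<longlongrightarrow> g t) (at_right t)"
  shows "(\<lambda>t. indicator {0<..T} t * g t) \<in> borel_measurable lborel"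
proof -
  have "(\<lambda>(t, \<omega>). indicator {0<..T} t * g t) \<in> borel_measurable (lborel \<Otimes>\<^sub>M count_space (UNIV :: unit set))"
    using assms by (intro right_continuous_jointly_measurable[where Z = "\<lambda>t _. g t"]) auto
  then have "(\<lambda>t. (\<lambda>(t, \<omega>). indicator {0<..T} t * g t) (t, ())) \<in> borel_measurable lborel"
    by (rule measurable_compose[rotated]) simp
  then show ?thesis by simp
qed

lemma continuous_map_borel_of_measurable:
  assumes "continuous_map X euclideanreal F"
  shows "F \<in> borel_measurable (borel_of X)"
proof -
  have sub: "{U. openin X U} \<subseteq> Pow (topspace X)" using openin_subset by auto
  show ?thesis
  proof (rule borel_measurableI)
    fix S :: "real set" assume "open S"
    then have "openin X {x \<in> topspace X. F x \<in> S}"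
      using assms by (auto simp: continuous_map_def)
    moreover have "F -` S \<inter> space (borel_of X) = {x \<in> topspace X. F x \<in> S}"
      using sub by (auto simp: borel_of_def)
    ultimately show "F -` S \<inter> space (borel_of X) \<in> sets (borel_of X)"
      using sub by (simp add: borel_of_def)
  qed
qed

definition time_integral :: "('a \<Rightarrow> real) \<Rightarrow> real \<Rightarrow> (real \<Rightarrow> 'a) \<Rightarrow> real" where
  "time_integral \<psi> T c = (\<integral>t. indicator {0<..T} t * \<psi> (c t) \<partial>lborel)"

lemma cadlag_lipschitz_compose:
  assumes c: "c \<in> cadlag m"
    and lip: "\<And>x y. x \<in> mspace m \<Longrightarrow> y \<in> mspace m \<Longrightarrow> \<bar>\<psi> x - \<psi> y\<bar> \<le> \<Lambda> * mdist m x y"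
  shows "0 \<le> t \<Longrightarrow> ((\<lambda>s. \<psi> (c s)) \<longlongrightarrow> \<psi> (c t)) (at_right t)"
    and "0 < t \<Longrightarrow> \<exists>l. ((\<lambda>s. \<psi> (c s)) \<longlongrightarrow> l) (at_left t)"
proof -
  interpret M: Metric_space "mspace m" "mdist m" by simp
  have *: "((\<lambda>s. \<psi> (c s)) \<longlongrightarrow> \<psi> l) F" if "limitin (mtopology_of m) c l F" for l F
  proof -
    have l: "l \<in> mspace m" "\<forall>\<^sub>F s in F. c s \<in> mspace m" "((\<lambda>s. mdist m (c s) l) \<longlongrightarrow> 0) F"
      using that by (auto simp: mtopology_of_def M.limitin_metric_dist_null)
    have "((\<lambda>s. \<psi> (c s) - \<psi> l) \<longlongrightarrow> 0) F"
    proof (rule Lim_null_comparison)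
      show "\<forall>\<^sub>F s in F. norm (\<psi> (c s) - \<psi> l) \<le> \<Lambda> * mdist m (c s) l"
        using l(2) by eventually_elim (use lip l(1) in auto)
      show "((\<lambda>s. \<Lambda> * mdist m (c s) l) \<longlongrightarrow> 0) F" using tendsto_mult_right_zero[OF l(3)] .
    qed
    then show ?thesis by (simp add: LIM_zero_iff)
  qed
  show "0 \<le> t \<Longrightarrow> ((\<lambda>s. \<psi> (c s)) \<longlongrightarrow> \<psi> (c t)) (at_right t)"
    "0 < t \<Longrightarrow> \<exists>l. ((\<lambda>s. \<psi> (c s)) \<longlongrightarrow> l) (at_left t)"
    using c * unfolding cadlag_def by blast+
qed

text \<open>If \<open>c\<^sub>n\<close> tends to \<open>c\<close> then \<open>c\<^sub>n t\<close> is close to \<open>c s\<close> at some time \<open>s\<close> that tends to \<open>t\<close>. So \<open>\<psi> (c\<^sub>n t)\<close> tends to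
\<open>\<psi> (c t)\<close> at every continuity point \<open>t\<close> of \<open>\<psi> \<circ> c\<close>, that is, outside a countable set of times, and dominated
convergence applies. Fixed times would not do, since evaluation at a time of discontinuity is not
continuous.\<close>

lemma time_integral_continuous:
  fixes m :: "'a metric"
  assumes lip: "\<And>x y. x \<in> mspace m \<Longrightarrow> y \<in> mspace m \<Longrightarrow> \<bar>\<psi> x - \<psi> y\<bar> \<le> \<Lambda> * mdist m x y"
    and bound: "\<And>x. x \<in> mspace m \<Longrightarrow> \<bar>\<psi> x\<bar> \<le> B"
  shows "continuous_map (skorokhod_topology m) euclideanreal (time_integral \<psi> T)"
proof -
  interpret M: Metric_space "mspace m" "mdist m" by simp
  have in_space: "c t \<in> mspace m" if "c \<in> cadlag m" "0 \<le> t" for c t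
    using that unfolding cadlag_def by auto
  have meas: "(\<lambda>t. indicator {0<..T} t * \<psi> (c t)) \<in> borel_measurable lborel" if "c \<in> cadlag m" for c
    using cadlag_lipschitz_compose(1)[OF that lip] by (intro right_continuous_measurable) auto
  have near: "\<exists>n. \<forall>c'\<in>skorokhod_nhd m c (real (Suc n)) (1 / real (Suc n)).
      \<bar>time_integral \<psi> T c' - time_integral \<psi> T c\<bar> < e" if c: "c \<in> cadlag m" and e: "0 < e" for c e
  proof (rule ccontr)
    assume "\<not> ?thesis"
    \<comment> \<open>a sequence of paths that converges to \<open>c\<close> while its time integrals stay away from that of \<open>c\<close>\<close>
    then obtain C where C: "\<And>n. C n \<in> skorokhod_nhd m c (real (Suc n)) (1 / real (Suc n))"
      "\<And>n. e \<le> \<bar>time_integral \<psi> T (C n) - time_integral \<psi> T c\<bar>" by (auto simp: not_less) metis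
    define g where "g t = \<psi> (c t)" for t
    have Ccad: "C n \<in> cadlag m" for n using C(1)[of n] by (simp add: skorokhod_nhd_def)
    have cnt: "countable {t. 0 < t \<and> \<not> isCont g t}"
      using cadlag_lipschitz_compose[OF c lip] unfolding g_def
      by (intro cadlag_real_countable_discontinuities) auto
    have conv: "(\<lambda>n. \<psi> (C n t)) \<longlonglongrightarrow> g t" if t: "0 < t" "t \<le> T" "isCont g t" for t
    proof -
      have "\<exists>s\<ge>0. \<bar>t - s\<bar> < 1 / real (Suc n) \<and> (s \<le> real (Suc n) \<longrightarrow> mdist m (C n t) (c s) < 1 / real (Suc n))" for n
      proof -
        obtain \<tau> where \<tau>: "time_change \<tau>" "\<And>s. 0 \<le> s \<Longrightarrow> \<bar>\<tau> s - s\<bar> < 1 / real (Suc n)"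
          "\<And>s. s \<in> {0..real (Suc n)} \<Longrightarrow> mdist m (C n (\<tau> s)) (c s) < 1 / real (Suc n)"
          using C(1)[of n] unfolding skorokhod_nhd_def by blast
        have "t \<in> \<tau> ` {0..}" using \<tau>(1) t by (simp add: time_change_def)
        then obtain s where s: "0 \<le> s" "t = \<tau> s" by auto
        then show ?thesis using \<tau>(2)[of s] \<tau>(3)[of s] by (intro exI[of _ s]) auto
      qed
      then obtain s where s: "\<And>n. 0 \<le> s n" "\<And>n. \<bar>t - s n\<bar> < 1 / real (Suc n)"
        "\<And>n. s n \<le> real (Suc n) \<Longrightarrow> mdist m (C n t) (c (s n)) < 1 / real (Suc n)" by metis
      have inv0: "(\<lambda>n. 1 / real (Suc n)) \<longlonglongrightarrow> 0"
        using LIMSEQ_inverse_real_of_nat by (simp add: inverse_eq_divide)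
      have "(\<lambda>n. t - s n) \<longlonglongrightarrow> 0"
        by (rule Lim_null_comparison[OF _ inv0]) (use s(2) in \<open>auto intro!: always_eventually less_imp_le\<close>)
      then have "(\<lambda>n. t - (t - s n)) \<longlonglongrightarrow> t - 0" by (intro tendsto_intros)
      then have "s \<longlonglongrightarrow> t" by simp
      then have gs: "(\<lambda>n. g (s n)) \<longlonglongrightarrow> g t" using t(3) by (simp add: isCont_tendsto_compose)
      obtain n0 where n0: "T + 1 \<le> real n0" using real_arch_simple by blast
      have "(\<lambda>n. \<psi> (C n t) - g (s n)) \<longlonglongrightarrow> 0"
      proof (rule Lim_null_comparison)
        show "(\<lambda>n. \<bar>\<Lambda>\<bar> * (1 / real (Suc n))) \<longlonglongrightarrow> 0" using tendsto_mult_right_zero[OF inv0] .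
        show "\<forall>\<^sub>F n in sequentially. norm (\<psi> (C n t) - g (s n)) \<le> \<bar>\<Lambda>\<bar> * (1 / real (Suc n))"
        proof (rule eventually_sequentiallyI[of n0])
          fix n assume n: "n0 \<le> n"
          have "1 / real (Suc n) \<le> 1" by simp
          then have "s n \<le> T + 1" using s(2)[of n] t by linarith
          then have "s n \<le> real (Suc n)" using n n0 by simp
          then have d: "mdist m (C n t) (c (s n)) < 1 / real (Suc n)" by (rule s)
          have "\<bar>\<psi> (C n t) - g (s n)\<bar> \<le> \<Lambda> * mdist m (C n t) (c (s n))"
            unfolding g_def using t s(1) in_space[OF Ccad] in_space[OF c] by (intro lip) auto
          also have "\<dots> \<le> \<bar>\<Lambda>\<bar> * (1 / real (Suc n))"
            using d by (intro mult_mono) auto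
          finally show "norm (\<psi> (C n t) - g (s n)) \<le> \<bar>\<Lambda>\<bar> * (1 / real (Suc n))" by simp
        qed
      qed
      from tendsto_add[OF this gs] show ?thesis by simp
    qed
    have "(\<lambda>n. time_integral \<psi> T (C n)) \<longlonglongrightarrow> time_integral \<psi> T c"
      unfolding time_integral_def
    proof (rule integral_dominated_convergence[where w = "\<lambda>t. indicator {0<..T} t * B"])
      show "integrable lborel (\<lambda>t. indicator {0<..T} t * B :: real)"
        by (cases "0 \<le> T") auto
      have "AE t in lborel. t \<notin> {t. 0 < t \<and> \<not> isCont g t}"
        using cnt by (intro AE_not_in countable_imp_null_set_lborel)
      then show "AE t in lborel. (\<lambda>n. indicator {0<..T} t * \<psi> (C n t)) \<longlonglongrightarrow> indicator {0<..T} t * \<psi> (c t)"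
        by eventually_elim (auto simp: indicator_def g_def[symmetric] intro: conv)
      show "AE t in lborel. norm (indicator {0<..T} t * \<psi> (C n t)) \<le> indicator {0<..T} t * B" for n
        using bound in_space[OF Ccad[of n]] by (auto simp: indicator_def)
    qed (use meas c Ccad in auto)
    then have "\<forall>\<^sub>F n in sequentially. dist (time_integral \<psi> T (C n)) (time_integral \<psi> T c) < e"
      using e by (rule tendstoD)
    then show False using C(2) by (auto simp: eventually_sequentially dist_real_def not_less[symmetric])
  qed
  show ?thesis
    unfolding continuous_map_def
  proof (intro conjI allI impI)
    fix U assume "openin euclideanreal U"
    then have U: "open U" by simp
    show "openin (skorokhod_topology m) {c \<in> topspace (skorokhod_topology m). time_integral \<psi> T c \<in> U}"
      unfolding openin_skorokhod_topology topspace_skorokhod_topology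
    proof (intro conjI ballI)
      fix c assume c: "c \<in> {c \<in> cadlag m. time_integral \<psi> T c \<in> U}"
      then obtain e where e: "0 < e" "\<And>y. dist y (time_integral \<psi> T c) < e \<Longrightarrow> y \<in> U"
        using U unfolding open_dist by auto
      obtain n where n: "\<And>c'. c' \<in> skorokhod_nhd m c (real (Suc n)) (1 / real (Suc n)) \<Longrightarrow>
        \<bar>time_integral \<psi> T c' - time_integral \<psi> T c\<bar> < e" using near[of c e] c e(1) by auto
      show "\<exists>T'>0. \<exists>r>0. skorokhod_nhd m c T' r \<subseteq> {c \<in> cadlag m. time_integral \<psi> T c \<in> U}"
      proof (rule exI[of _ "real (Suc n)"], rule conjI, simp, rule exI[of _ "1 / real (Suc n)"], intro conjI subsetI)
        fix c' assume c': "c' \<in> skorokhod_nhd m c (real (Suc n)) (1 / real (Suc n))"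
        then have "c' \<in> cadlag m" by (simp add: skorokhod_nhd_def)
        then show "c' \<in> {c \<in> cadlag m. time_integral \<psi> T c \<in> U}"
          using n[OF c'] e(2) by (simp add: dist_real_def)
      qed auto
    qed auto
  qed auto
qed

section \<open>Step processes in the Skorokhod space\<close>

text \<open>The paths on \<open>[0, \<infinity>)\<close> that are cadlag for the discrete topology: in bounded time they jump finitely often.\<close>

definition step_path :: "(real \<Rightarrow> 'v) \<Rightarrow> bool" where
  "step_path x \<longleftrightarrow> (\<forall>t\<ge>0. \<forall>\<^sub>F s in at_right t. x s = x t) \<and>
     (\<forall>t>0. \<exists>v. \<forall>\<^sub>F s in at_left t. x s = v)"

lemma step_path_right:
  assumes "step_path x" "0 \<le> t"
  obtains b where "t < b" "\<And>s. t \<le> s \<Longrightarrow> s < b \<Longrightarrow> x s = x t"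
proof -
  have "\<forall>\<^sub>F s in at_right t. x s = x t" using assms by (auto simp: step_path_def)
  then obtain b where "t < b" "\<And>s. t < s \<Longrightarrow> s < b \<Longrightarrow> x s = x t"
    unfolding eventually_at_right_field by blast
  then show ?thesis using that by (metis order_le_less)
qed

lemma step_path_left:
  assumes "step_path x" "0 < t"
  obtains a v where "a < t" "\<And>s. a < s \<Longrightarrow> s < t \<Longrightarrow> x s = v"
proof -
  obtain v where "\<forall>\<^sub>F s in at_left t. x s = v" using assms by (auto simp: step_path_def)
  then show ?thesis using that unfolding eventually_at_left_field by blast
qed

lemma step_path_rational_right:
  assumes "step_path x" "0 \<le> t" "t < b"
  obtains q where "q \<in> \<rat>" "t < q" "q < b" "x q = x t"
proof -
  obtain b' where b': "t < b'" "\<And>s. t \<le> s \<Longrightarrow> s < b' \<Longrightarrow> x s = x t"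
    using step_path_right[OF assms(1,2)] by blast
  obtain q where "q \<in> \<rat>" "t < q" "q < min b b'" using Rats_dense_in_real[of t "min b b'"] assms b' by auto
  then show ?thesis using that[of q] b'(2)[of q] by simp
qed

text \<open>The path goes from \<open>u\<close> to \<open>v\<close> on \<open>[p, q]\<close> by a single jump in the open interval \<open>(p, q)\<close>, where \<open>u = v\<close> expresses
that the path is constant. The condition is spelled out at rational times, so that it defines a
measurable event; for right continuous paths this loses nothing, see \<open>one_jumpE\<close>. Requiring the value \<open>v\<close>
already before \<open>q\<close> keeps the jump away from the endpoint, so that the jump times of two such paths can be
matched by a time change that fixes \<open>p\<close> and \<open>q\<close>.\<close>

definition one_jump :: "(real \<Rightarrow> 'v) \<Rightarrow> real \<Rightarrow> real \<Rightarrow> 'v \<Rightarrow> 'v \<Rightarrow> bool" where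
  "one_jump x p q u v \<longleftrightarrow> x p = u \<and> (\<exists>s\<in>\<rat> \<inter> {p<..<q}. \<forall>s'\<in>\<rat> \<inter> {s..q}. x s' = v) \<and>
     (\<forall>s\<in>\<rat> \<inter> {p..q}. \<forall>s'\<in>\<rat> \<inter> {s<..q}. x s = u \<or> x s' = v)"

lemma one_jumpI:
  assumes "p < \<sigma>" "\<sigma> < q" "\<And>s. p \<le> s \<Longrightarrow> s < \<sigma> \<Longrightarrow> x s = u" "\<And>s. \<sigma> \<le> s \<Longrightarrow> s \<le> q \<Longrightarrow> x s = v"
  shows "one_jump x p q u v"
proof -
  obtain s where "s \<in> \<rat>" "\<sigma> < s" "s < q" using Rats_dense_in_real[OF assms(2)] by blast
  then have "\<exists>s\<in>\<rat> \<inter> {p<..<q}. \<forall>s'\<in>\<rat> \<inter> {s..q}. x s' = v"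
    using assms by (intro bexI[of _ s]) auto
  moreover have "x s = u \<or> x s' = v" if "p \<le> s" "s < s'" "s' \<le> q" for s s'
    using assms that by (cases "s < \<sigma>") auto
  ultimately show ?thesis using assms unfolding one_jump_def by auto
qed

lemma one_jumpE:
  assumes x: "step_path x" and pq: "p \<in> \<rat>" "q \<in> \<rat>" "0 \<le> p" "p < q" and J: "one_jump x p q u v"
  obtains \<sigma> where "p < \<sigma>" "\<sigma> < q" "\<And>s. p \<le> s \<Longrightarrow> s < \<sigma> \<Longrightarrow> x s = u" "\<And>s. \<sigma> \<le> s \<Longrightarrow> s \<le> q \<Longrightarrow> x s = v"
proof -
  obtain s0 where s0: "s0 \<in> \<rat>" "p < s0" "s0 < q" "\<And>s. s \<in> \<rat> \<Longrightarrow> s0 \<le> s \<Longrightarrow> s \<le> q \<Longrightarrow> x s = v"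
    using J by (auto simp: one_jump_def)
  have xp: "x p = u" using J by (simp add: one_jump_def)
  have xq: "x q = v" using s0(4)[of q] s0(3) pq by simp
  have R: "x s = u \<or> x s' = v" if s: "p \<le> s" "s < s'" "s' \<le> q" for s s'
  proof -
    obtain r where r: "r \<in> \<rat>" "s < r" "r < s'" "x r = x s"
      using step_path_rational_right[OF x _ s(2)] s(1) pq(3) by auto
    obtain r' where r': "r' \<in> \<rat>" "s' \<le> r'" "r' \<le> q" "x r' = x s'"
    proof (cases "s' = q")
      case True
      then show ?thesis using that[of q] pq by simp
    next
      case False
      then have "s' < q" using s by simp
      then obtain r' where "r' \<in> \<rat>" "s' < r'" "r' < q" "x r' = x s'"
        using step_path_rational_right[OF x, of s' q] s pq by auto
      then show ?thesis using that[of r'] by simp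
    qed
    have "\<forall>s\<in>\<rat> \<inter> {p..q}. \<forall>s'\<in>\<rat> \<inter> {s<..q}. x s = u \<or> x s' = v"
      using J by (simp add: one_jump_def)
    moreover have "r \<in> \<rat> \<inter> {p..q}" "r' \<in> \<rat> \<inter> {r<..q}" using r(1-3) r'(1-3) s by auto
    ultimately have "x r = u \<or> x r' = v" by blast
    then show ?thesis unfolding r(4) r'(4) .
  qed
  define A where "A = {s. p \<le> s \<and> s \<le> q \<and> x s \<noteq> u}"
  show ?thesis
  proof (cases "A = {}")
    case True
    then have "x s = u" if "p \<le> s" "s \<le> q" for s using that by (auto simp: A_def)
    moreover from this have "u = v" using xq pq by auto
    ultimately show ?thesis using pq by (intro that[of "(p + q) / 2"]) auto
  next
    case False
    \<comment> \<open>the first time at which the path has left \<open>u\<close>\<close>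
    define \<sigma> where "\<sigma> = Inf A"
    have bdd: "bdd_below A" by (auto simp: A_def intro: bdd_belowI[of _ p])
    have before: "x s = u" if "p \<le> s" "s < \<sigma>" "s \<le> q" for s
      using that cInf_lower[OF _ bdd, of s] by (auto simp: \<sigma>_def A_def)
    have after: "x s = v" if "\<sigma> < s" "s \<le> q" for s
    proof -
      obtain a where "a \<in> A" "a < s" using cInf_lessD[OF False, of s] \<open>\<sigma> < s\<close> unfolding \<sigma>_def by blast
      then show ?thesis using R[of a s] that by (auto simp: A_def)
    qed
    obtain b where b: "p < b" "\<And>s. p \<le> s \<Longrightarrow> s < b \<Longrightarrow> x s = x p"
      using step_path_right[OF x pq(3)] by blast
    have "b \<le> \<sigma>" unfolding \<sigma>_def
    proof (rule cInf_greatest[OF False])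
      fix s assume "s \<in> A"
      then have "p \<le> s" "x s \<noteq> x p" using xp by (simp_all add: A_def)
      then show "b \<le> s" using b(2) not_le_imp_less by blast
    qed
    then have p\<sigma>: "p < \<sigma>" using b by simp
    have \<sigma>q: "\<sigma> < q"
    proof (cases "u = v")
      case False
      then have "s0 \<in> A" using s0(1-3) s0(4)[of s0] by (auto simp: A_def)
      then show ?thesis using cInf_lower[OF _ bdd, of s0] s0 by (simp add: \<sigma>_def)
    next
      case True
      obtain a where a: "a \<in> A" using False by blast
      then have "a < q" using xq True by (cases "a = q") (auto simp: A_def)
      then show ?thesis using cInf_lower[OF a bdd] by (simp add: \<sigma>_def)
    qed
    obtain b' where b': "\<sigma> < b'" "\<And>s. \<sigma> \<le> s \<Longrightarrow> s < b' \<Longrightarrow> x s = x \<sigma>"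
      using step_path_right[OF x, of \<sigma>] p\<sigma> pq by auto
    obtain s where "\<sigma> < s" "s < min b' q" using dense[of \<sigma> "min b' q"] b' \<sigma>q by auto
    then have "x \<sigma> = v" using after[of s] b'(2)[of s] by simp
    then show ?thesis using p\<sigma> \<sigma>q before after by (intro that[of \<sigma>]) (auto simp: order_le_less)
  qed
qed

text \<open>A discrete code of a step path up to precision \<open>r\<close>: consecutive rational times less than \<open>r\<close> apart,
with the values there, such that the path makes at most one jump between two consecutive times. There
are only countably many codes.\<close>

fun jump_chain :: "(real \<Rightarrow> 'v) \<Rightarrow> real \<Rightarrow> real \<Rightarrow> 'v \<Rightarrow> (rat \<times> 'v) list \<Rightarrow> bool" where
  "jump_chain x r p u [] = True"
| "jump_chain x r p u ((q, v) # l) \<longleftrightarrow>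
     p < of_rat q \<and> of_rat q - p < r \<and> one_jump x p (of_rat q) u v \<and> jump_chain x r (of_rat q) v l"

fun chain_end :: "real \<Rightarrow> (rat \<times> 'v) list \<Rightarrow> real" where
  "chain_end p [] = p"
| "chain_end p ((q, v) # l) = chain_end (of_rat q) l"

text \<open>Consider the rational times from which no code reaches \<open>T\<close>, and let \<open>t\<close> be their supremum. Shortly before
\<open>t\<close> the path is constant and so it is shortly after \<open>t\<close>, so one interval across \<open>t\<close> connects a time just
before \<open>t\<close> (or \<open>t\<close> itself) to one after \<open>t\<close>, from which \<open>T\<close> is reached: a contradiction.\<close>

lemma jump_chain_exists:
  assumes x: "step_path x" "\<And>t. 0 \<le> t \<Longrightarrow> x t \<in> V" and r: "0 < r"
  shows "\<exists>l\<in>lists (UNIV \<times> V). jump_chain x r 0 (x 0) l \<and> T \<le> chain_end 0 l"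
proof (rule ccontr)
  define good where "good p \<longleftrightarrow> (\<exists>l\<in>lists (UNIV \<times> V). jump_chain x r p (x p) l \<and> T \<le> chain_end p l)" for p
  define S where "S = {p \<in> \<rat>. 0 \<le> p \<and> \<not> good p}"
  assume "\<not> ?thesis"
  then have S0: "0 \<in> S" by (simp add: S_def good_def)
  have good_T: "good p" if "T \<le> p" for p
    unfolding good_def using that by (intro bexI[of _ "[]"]) auto
  have good_step: "good p" if "good q" "q \<in> \<rat>" "p < q" "q - p < r" "one_jump x p q (x p) (x q)" "0 \<le> p" for p q
  proof -
    from that obtain l where l: "l \<in> lists (UNIV \<times> V)" "jump_chain x r q (x q) l" "T \<le> chain_end q l"
      by (auto simp: good_def)
    obtain q' where "q = of_rat q'" using \<open>q \<in> \<rat>\<close> by (auto elim: Rats_cases)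
    moreover have "x q \<in> V" using that by (intro x) simp
    ultimately show ?thesis unfolding good_def
      using that l by (intro bexI[of _ "(q', x q) # l"]) auto
  qed
  have bdd: "bdd_above S"
  proof (rule bdd_aboveI)
    fix p assume "p \<in> S"
    then have "\<not> good p" by (simp add: S_def)
    then show "p \<le> T" using good_T[of p] by (rule contrapos_np) simp
  qed
  define t where "t = Sup S"
  have t0: "0 \<le> t" unfolding t_def by (rule cSup_upper[OF S0 bdd])
  obtain b where b: "t < b" "\<And>s. t \<le> s \<Longrightarrow> s < b \<Longrightarrow> x s = x t" using step_path_right[OF x(1) t0] by blast
  obtain q where q: "q \<in> \<rat>" "t < q" "q < min b (t + r / 2)"
    using Rats_dense_in_real[of t "min b (t + r / 2)"] b r by auto
  have gq: "good q"
  proof (rule ccontr)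
    assume "\<not> good q"
    then have "q \<in> S" using q t0 by (auto simp: S_def)
    then show False using cSup_upper[OF _ bdd, of q] q by (simp add: t_def)
  qed
  have xq: "x q = x t" using b(2)[of q] q by simp
  show False
  proof (cases "t \<in> S")
    case True
    have "one_jump x t q (x t) (x q)"
    proof (rule one_jumpI[of t "(t + q) / 2"])
      show "x s = x t" if "t \<le> s" "s < (t + q) / 2" for s using that q by (intro b(2)) auto
      show "x s = x q" if "(t + q) / 2 \<le> s" "s \<le> q" for s unfolding xq using that q by (intro b(2)) auto
    qed (use q in auto)
    then have "good t" using good_step[OF gq q(1,2)] q r t0 by auto
    then show False using True by (simp add: S_def)
  next
    case False
    then have "0 < t" using S0 t0 by (cases "t = 0") auto
    then obtain a v where a: "a < t" "\<And>s. a < s \<Longrightarrow> s < t \<Longrightarrow> x s = v" using step_path_left[OF x(1)] by blast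
    have "max a (t - r / 2) < t" using a r by simp
    then obtain p where p: "p \<in> S" "max a (t - r / 2) < p" using less_cSupD[of S] S0 unfolding t_def by blast
    have "p \<le> t" unfolding t_def by (rule cSup_upper[OF p(1) bdd])
    then have pt: "p < t" using p False by (cases "p = t") auto
    have "one_jump x p q (x p) (x q)"
    proof (rule one_jumpI[of p t])
      show "x s = x p" if "p \<le> s" "s < t" for s using a(2)[of s] a(2)[of p] that p pt by simp
      show "x s = x q" if "t \<le> s" "s \<le> q" for s unfolding xq using that q by (intro b(2)) auto
    qed (use q pt in auto)
    then have "good p" using good_step[OF gq q(1)] q p pt by (auto simp: S_def)
    then show False using p by (simp add: S_def)
  qed
qed

lemma affine_increasing_bijection:
  fixes a b a' b' :: real
  assumes "a < b" "a' < b'"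
  shows "strict_mono_on {a..<b} (\<lambda>s. a' + (s - a) * ((b' - a') / (b - a)))"
    and "(\<lambda>s. a' + (s - a) * ((b' - a') / (b - a))) ` {a..<b} = {a'..<b'}"
proof -
  define k where "k = (b' - a') / (b - a)"
  have k: "0 < k" "(b - a) * k = b' - a'" using assms by (simp_all add: k_def)
  show "strict_mono_on {a..<b} (\<lambda>s. a' + (s - a) * ((b' - a') / (b - a)))"
    unfolding k_def[symmetric]
    using k by (intro strict_mono_onI add_strict_left_mono mult_strict_right_mono) auto
  show "(\<lambda>s. a' + (s - a) * ((b' - a') / (b - a))) ` {a..<b} = {a'..<b'}"
    unfolding k_def[symmetric]
  proof (intro equalityI subsetI)
    fix y assume "y \<in> (\<lambda>s. a' + (s - a) * k) ` {a..<b}"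
    then obtain s where s: "a \<le> s" "s < b" "y = a' + (s - a) * k" by auto
    have "(s - a) * k < (b - a) * k" using s k by (intro mult_strict_right_mono) auto
    moreover have "0 \<le> (s - a) * k" using s k by simp
    ultimately show "y \<in> {a'..<b'}" using s(3) k by auto
  next
    fix y assume y: "y \<in> {a'..<b'}"
    have "y - a' < (b - a) * k" using y k by simp
    then have "(y - a') / k < b - a" using k by (simp add: pos_divide_less_eq)
    moreover have "0 \<le> (y - a') / k" using y k by simp
    moreover have "y = a' + ((y - a') / k) * k" using k by simp
    ultimately show "y \<in> (\<lambda>s. a' + (s - a) * k) ` {a..<b}"
      by (intro image_eqI[of _ _ "a + (y - a') / k"]) auto
  qed
qed

lemma glue_increasing_bijections:
  fixes f g :: "real \<Rightarrow> real"
  assumes f: "strict_mono_on {a..<b} f" "f ` {a..<b} = {a'..<b'}"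
    and g: "strict_mono_on {b..} g" "g ` {b..} = {b'..}" and le: "a \<le> b" "a' \<le> b'"
  shows "strict_mono_on {a..} (\<lambda>s. if s < b then f s else g s)"
    and "(\<lambda>s. if s < b then f s else g s) ` {a..} = {a'..}"
proof -
  have fb: "f s < b'" if "a \<le> s" "s < b" for s using f(2) that by (metis atLeastLessThan_iff imageI)
  have gb: "b' \<le> g s" if "b \<le> s" for s using g(2) that by (metis atLeast_iff imageI)
  show "strict_mono_on {a..} (\<lambda>s. if s < b then f s else g s)"
  proof (rule strict_mono_onI)
    fix s t assume "s \<in> {a..}" "t \<in> {a..}" "s < t"
    then show "(if s < b then f s else g s) < (if t < b then f t else g t)"
      using strict_mono_onD[OF f(1), of s t] strict_mono_onD[OF g(1), of s t] fb[of s] gb[of t] by auto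
  qed
  have "(\<lambda>s. if s < b then f s else g s) ` {a..}
    = (\<lambda>s. if s < b then f s else g s) ` {a..<b} \<union> (\<lambda>s. if s < b then f s else g s) ` {b..}"
    using le by (auto simp: image_Un[symmetric] ivl_disj_un)
  also have "\<dots> = f ` {a..<b} \<union> g ` {b..}"
    by (intro arg_cong2[of _ _ _ _ "(\<union>)"] image_cong) auto
  also have "\<dots> = {a'..}" unfolding f(2) g(2) using le by auto
  finally show "(\<lambda>s. if s < b then f s else g s) ` {a..} = {a'..}" .
qed

text \<open>Two paths with the same code differ by a time change that moves times by less than \<open>r\<close>: on each interval
of the code it fixes the endpoints, takes the jump time of one path to that of the other, and is affine
in between.\<close>

lemma jump_chain_time_change:
  assumes x: "step_path x" and y: "step_path y" and r: "0 < r"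
  shows "p \<in> \<rat> \<Longrightarrow> 0 \<le> p \<Longrightarrow> jump_chain x r p u l \<Longrightarrow> jump_chain y r p u l \<Longrightarrow>
    \<exists>\<tau>. strict_mono_on {p..} \<tau> \<and> \<tau> ` {p..} = {p..} \<and> (\<forall>s\<ge>p. \<bar>\<tau> s - s\<bar> < r) \<and>
      (\<forall>s. p \<le> s \<and> s < chain_end p l \<longrightarrow> y (\<tau> s) = x s)"
proof (induction l arbitrary: p u)
  case Nil
  then show ?case using r by (intro exI[of _ "\<lambda>s. s"]) (auto simp: strict_mono_on_def)
next
  case (Cons a l)
  obtain q' v where a: "a = (q', v)" by (cases a)
  define q where "q = real_of_rat q'"
  have q: "q \<in> \<rat>" "p < q" "q - p < r" "one_jump x p q u v" "one_jump y p q u v"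
    "jump_chain x r q v l" "jump_chain y r q v l"
    using Cons.prems by (auto simp: a q_def)
  obtain \<tau> where \<tau>: "strict_mono_on {q..} \<tau>" "\<tau> ` {q..} = {q..}" "\<And>s. q \<le> s \<Longrightarrow> \<bar>\<tau> s - s\<bar> < r"
    "\<And>s. q \<le> s \<Longrightarrow> s < chain_end q l \<Longrightarrow> y (\<tau> s) = x s"
    using Cons.IH[OF q(1) _ q(6,7)] Cons.prems(2) q(2) by auto
  obtain \<sigma> where \<sigma>: "p < \<sigma>" "\<sigma> < q" "\<And>s. p \<le> s \<Longrightarrow> s < \<sigma> \<Longrightarrow> x s = u" "\<And>s. \<sigma> \<le> s \<Longrightarrow> s \<le> q \<Longrightarrow> x s = v"
    using one_jumpE[OF x Cons.prems(1) q(1) Cons.prems(2) q(2,4)] by blast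
  obtain \<sigma>' where \<sigma>': "p < \<sigma>'" "\<sigma>' < q" "\<And>s. p \<le> s \<Longrightarrow> s < \<sigma>' \<Longrightarrow> y s = u" "\<And>s. \<sigma>' \<le> s \<Longrightarrow> s \<le> q \<Longrightarrow> y s = v"
    using one_jumpE[OF y Cons.prems(1) q(1) Cons.prems(2) q(2,5)] by blast
  define f where "f s = p + (s - p) * ((\<sigma>' - p) / (\<sigma> - p))" for s
  define g where "g s = \<sigma>' + (s - \<sigma>) * ((q - \<sigma>') / (q - \<sigma>))" for s
  define h where "h s = (if s < q then g s else \<tau> s)" for s
  define k where "k s = (if s < \<sigma> then f s else h s)" for s
  have f: "strict_mono_on {p..<\<sigma>} f" "f ` {p..<\<sigma>} = {p..<\<sigma>'}"
    unfolding f_def using affine_increasing_bijection[OF \<sigma>(1) \<sigma>'(1)] by auto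
  have g: "strict_mono_on {\<sigma>..<q} g" "g ` {\<sigma>..<q} = {\<sigma>'..<q}"
    unfolding g_def using affine_increasing_bijection[OF \<sigma>(2) \<sigma>'(2)] by auto
  have h: "strict_mono_on {\<sigma>..} h" "h ` {\<sigma>..} = {\<sigma>'..}"
    unfolding h_def using glue_increasing_bijections[OF g \<tau>(1,2)] \<sigma> \<sigma>' by auto
  have k: "strict_mono_on {p..} k" "k ` {p..} = {p..}"
    unfolding k_def using glue_increasing_bijections[OF f h] \<sigma> \<sigma>' by auto
  have fs: "p \<le> f s" "f s < \<sigma>'" if "p \<le> s" "s < \<sigma>" for s
    using f(2) that by (auto dest: equalityD1 simp: image_subset_iff)
  have gs: "\<sigma>' \<le> g s" "g s < q" if "\<sigma> \<le> s" "s < q" for s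
    using g(2) that by (auto dest: equalityD1 simp: image_subset_iff)
  have "\<bar>k s - s\<bar> < r" if "p \<le> s" for s
    using that fs[of s] gs[of s] \<tau>(3)[of s] \<sigma> \<sigma>' q by (auto simp: k_def h_def abs_less_iff)
  moreover have "y (k s) = x s" if "p \<le> s" "s < chain_end q l" for s
    using that fs[of s] gs[of s] \<tau>(4)[of s] \<sigma> \<sigma>' by (auto simp: k_def h_def)
  ultimately show ?case
    using k by (intro exI[of _ k]) (auto simp: a q_def)
qed

lemma pred_one_jump:
  fixes X :: "real \<Rightarrow> 'b \<Rightarrow> 'v"
  assumes X: "\<And>t u. 0 \<le> t \<Longrightarrow> Measurable.pred \<Omega> (\<lambda>\<omega>. X t \<omega> = u)" and p: "0 \<le> p"
  shows "Measurable.pred \<Omega> (\<lambda>\<omega>. one_jump (\<lambda>t. X t \<omega>) p q u v)"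
  unfolding one_jump_def
proof -
  have cnt: "countable (\<rat> \<inter> A)" for A :: "real set" using countable_rat by blast
  have X': "Measurable.pred \<Omega> (\<lambda>\<omega>. X s \<omega> = u)" if "p \<le> s" for s u using X p that by simp
  have all: "Measurable.pred \<Omega> (\<lambda>\<omega>. \<forall>s\<in>\<rat> \<inter> A. Q s \<omega>)" and ex: "Measurable.pred \<Omega> (\<lambda>\<omega>. \<exists>s\<in>\<rat> \<inter> A. Q s \<omega>)"
    if "\<And>s. s \<in> A \<Longrightarrow> Measurable.pred \<Omega> (Q s)" for A and Q :: "real \<Rightarrow> 'b \<Rightarrow> bool"
    using that cnt[of A]
    by (auto simp: pred_def intro!: sets.sets_Collect_countable_Ball sets.sets_Collect_countable_Bex)
  have "Measurable.pred \<Omega> (\<lambda>\<omega>. \<exists>s\<in>\<rat> \<inter> {p<..<q}. \<forall>s'\<in>\<rat> \<inter> {s..q}. X s' \<omega> = v)"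
    by (intro all ex X') auto
  moreover have "Measurable.pred \<Omega> (\<lambda>\<omega>. \<forall>s\<in>\<rat> \<inter> {p..q}. \<forall>s'\<in>\<rat> \<inter> {s<..q}. X s \<omega> = u \<or> X s' \<omega> = v)"
    by (intro all pred_intros_logic X') auto
  ultimately show "Measurable.pred \<Omega> (\<lambda>\<omega>. X p \<omega> = u \<and> (\<exists>s\<in>\<rat> \<inter> {p<..<q}. \<forall>s'\<in>\<rat> \<inter> {s..q}. X s' \<omega> = v) \<and>
      (\<forall>s\<in>\<rat> \<inter> {p..q}. \<forall>s'\<in>\<rat> \<inter> {s<..q}. X s \<omega> = u \<or> X s' \<omega> = v))"
    using X' by (intro pred_intros_logic) auto
qed

lemma pred_jump_chain:
  assumes X: "\<And>t u. 0 \<le> t \<Longrightarrow> Measurable.pred \<Omega> (\<lambda>\<omega>. X t \<omega> = u)"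
  shows "0 \<le> p \<Longrightarrow> Measurable.pred \<Omega> (\<lambda>\<omega>. jump_chain (\<lambda>t. X t \<omega>) r p u l)"
proof (induction l arbitrary: p u)
  case (Cons a l)
  obtain q v where a: "a = (q, v)" by (cases a)
  show ?case
  proof (cases "p < of_rat q \<and> of_rat q - p < r")
    case True
    have "Measurable.pred \<Omega> (\<lambda>\<omega>. one_jump (\<lambda>t. X t \<omega>) p (of_rat q) u v \<and> jump_chain (\<lambda>t. X t \<omega>) r (of_rat q) v l)"
      using order_trans[OF Cons.prems less_imp_le] True Cons.prems
      by (intro pred_intros_logic Cons.IH pred_one_jump X) blast+
    then show ?thesis using True by (simp add: a)
  next
    case False
    then have "\<not> jump_chain (\<lambda>t. X t \<omega>) r p u (a # l)" for \<omega> by (auto simp: a)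
    then show ?thesis by simp
  qed
qed simp

lemma step_path_image_cadlag:
  assumes x: "step_path x" "\<And>t. 0 \<le> t \<Longrightarrow> x t \<in> V" and Y: "\<And>v. v \<in> V \<Longrightarrow> Y v \<in> mspace m"
  shows "(\<lambda>t\<in>{0..}. Y (x t)) \<in> cadlag m"
proof -
  interpret M: Metric_space "mspace m" "mdist m" by simp
  have lim: "limitin (mtopology_of m) (\<lambda>t\<in>{0..}. Y (x t)) (Y v) F"
    if "\<forall>\<^sub>F s in F. 0 \<le> s \<and> x s = v" "v \<in> V" for v F
    unfolding mtopology_of_def M.limitin_metric
  proof (intro conjI allI impI Y that(2))
    fix e :: real assume "0 < e"
    show "\<forall>\<^sub>F s in F. (\<lambda>t\<in>{0..}. Y (x t)) s \<in> mspace m \<and> mdist m ((\<lambda>t\<in>{0..}. Y (x t)) s) (Y v) < e"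
      using that(1) by (rule eventually_mono) (use Y[OF that(2)] \<open>0 < e\<close> in auto)
  qed
  show ?thesis
    unfolding cadlag_def
  proof (intro CollectI conjI allI impI)
    show "(\<lambda>t\<in>{0..}. Y (x t)) \<in> {0..} \<rightarrow>\<^sub>E mspace m" using x(2) Y by auto
    fix t :: real assume t: "0 \<le> t"
    have "\<forall>\<^sub>F s in at_right t. x s = x t" using x(1) t by (simp add: step_path_def)
    moreover have "\<forall>\<^sub>F s in at_right t. t < s" by (rule eventually_at_right_less)
    ultimately have "\<forall>\<^sub>F s in at_right t. 0 \<le> s \<and> x s = x t"
      by eventually_elim (use t in auto)
    then show "limitin (mtopology_of m) (\<lambda>t\<in>{0..}. Y (x t)) ((\<lambda>t\<in>{0..}. Y (x t)) t) (at_right t)"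
      using lim[OF _ x(2)[OF t]] t by simp
  next
    fix t :: real assume t: "0 < t"
    obtain a v where a: "a < t" "\<And>s. a < s \<Longrightarrow> s < t \<Longrightarrow> x s = v" using step_path_left[OF x(1) t] by blast
    have "v \<in> V" using a(2)[of "(max a 0 + t) / 2"] x(2)[of "(max a 0 + t) / 2"] a(1) t by (auto simp: max_def split: if_splits)
    moreover have "\<forall>\<^sub>F s in at_left t. 0 \<le> s \<and> x s = v"
      unfolding eventually_at_left_field using a t by (intro exI[of _ "max a 0"]) auto
    ultimately show "\<exists>l. limitin (mtopology_of m) (\<lambda>t\<in>{0..}. Y (x t)) l (at_left t)"
      using lim by blast
  qed
qed

text \<open>If the path of \<open>\<omega>\<close> lies in an open set \<open>U\<close>, then so do all paths with the same sufficiently fine and long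
code. Hence the preimage of \<open>U\<close> is a countable union of the measurable events that the path has a given
code.\<close>

lemma step_process_measurable_skorokhod:
  assumes V: "countable V" and X: "\<And>t. 0 \<le> t \<Longrightarrow> X t \<in> measurable \<Omega> (count_space V)"
    and step: "\<And>\<omega>. \<omega> \<in> space \<Omega> \<Longrightarrow> step_path (\<lambda>t. X t \<omega>)"
    and Y: "\<And>v. v \<in> V \<Longrightarrow> Y v \<in> mspace m"
  shows "(\<lambda>\<omega>. \<lambda>t\<in>{0..}. Y (X t \<omega>)) \<in> measurable \<Omega> (borel_of (skorokhod_topology m))"
proof -
  let ?c = "\<lambda>\<omega>. \<lambda>t\<in>{0..}. Y (X t \<omega>)"
  have XV: "X t \<omega> \<in> V" if "0 \<le> t" "\<omega> \<in> space \<Omega>" for t \<omega>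
    using measurable_space[OF X[OF that(1)] that(2)] by simp
  have pred: "Measurable.pred \<Omega> (\<lambda>\<omega>. X t \<omega> = u)" if "0 \<le> t" for t u
    by (rule measurable_compose[OF X[OF that]]) simp
  have cad: "?c \<omega> \<in> cadlag m" if "\<omega> \<in> space \<Omega>" for \<omega>
    using step_path_image_cadlag[where V = V and x = "\<lambda>t. X t \<omega>"] step[OF that] XV that Y by blast
  interpret M: Metric_space "mspace m" "mdist m" by simp
  have sub: "{U. openin (skorokhod_topology m) U} \<subseteq> Pow (topspace (skorokhod_topology m))"
    using openin_subset by blast
  define E where "E = (\<lambda>(n, u, l). {\<omega> \<in> space \<Omega>. X 0 \<omega> = u \<and> jump_chain (\<lambda>t. X t \<omega>) (1 / real (Suc n)) 0 u l})"
  have E: "E i \<in> sets \<Omega>" for i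
  proof -
    obtain n u l where i: "i = (n, u, l)" by (cases i)
    have "Measurable.pred \<Omega> (\<lambda>\<omega>. X 0 \<omega> = u \<and> jump_chain (\<lambda>t. X t \<omega>) (1 / real (Suc n)) 0 u l)"
      by (intro pred_intros_logic pred_jump_chain pred) auto
    then show ?thesis by (simp add: E_def i pred_def)
  qed
  define I where "I = (UNIV :: nat set) \<times> V \<times> lists ((UNIV :: rat set) \<times> V)"
  have I: "countable I" unfolding I_def using V by (intro countable_SIGMA countable_lists) auto
  show ?thesis
    unfolding borel_of_def
  proof (rule measurable_measure_of)
    show "?c \<in> space \<Omega> \<rightarrow> topspace (skorokhod_topology m)" using cad by simp
    fix U assume "U \<in> {U. openin (skorokhod_topology m) U}"
    then have U: "openin (skorokhod_topology m) U" by simp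
    have "?c -` U \<inter> space \<Omega> = (\<Union>i\<in>{i \<in> I. E i \<subseteq> ?c -` U}. E i)"
    proof (intro equalityI subsetI)
      fix \<omega> assume "\<omega> \<in> ?c -` U \<inter> space \<Omega>"
      then have \<omega>: "\<omega> \<in> space \<Omega>" "?c \<omega> \<in> U" by auto
      obtain T r where Tr: "0 < T" "0 < r" "skorokhod_nhd m (?c \<omega>) T r \<subseteq> U"
        using U \<omega>(2) unfolding openin_skorokhod_topology by blast
      obtain n where n: "1 / real (Suc n) < r" using nat_approx_posE[OF Tr(2)] .
      let ?r = "1 / real (Suc n)"
      obtain l where l: "l \<in> lists (UNIV \<times> V)" "jump_chain (\<lambda>t. X t \<omega>) ?r 0 (X 0 \<omega>) l" "T + 1 \<le> chain_end 0 l"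
        using jump_chain_exists[OF step[OF \<omega>(1)] XV[OF _ \<omega>(1)], of ?r "T + 1"] by auto
      have "E (n, X 0 \<omega>, l) \<subseteq> ?c -` U"
      proof
        fix \<omega>' assume "\<omega>' \<in> E (n, X 0 \<omega>, l)"
        then have \<omega>': "\<omega>' \<in> space \<Omega>" "jump_chain (\<lambda>t. X t \<omega>') ?r 0 (X 0 \<omega>) l" by (auto simp: E_def)
        obtain \<tau> where \<tau>: "strict_mono_on {0..} \<tau>" "\<tau> ` {0..} = {0..}" "\<And>s. 0 \<le> s \<Longrightarrow> \<bar>\<tau> s - s\<bar> < ?r"
          "\<And>s. 0 \<le> s \<Longrightarrow> s < chain_end 0 l \<Longrightarrow> X (\<tau> s) \<omega>' = X s \<omega>"
          using jump_chain_time_change[OF step[OF \<omega>(1)] step[OF \<omega>'(1)] _ _ _ l(2) \<omega>'(2)] by auto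
        have pos: "0 \<le> \<tau> s" if "0 \<le> s" for s using \<tau>(2) that by (metis atLeast_iff imageI)
        have "?c \<omega>' \<in> skorokhod_nhd m (?c \<omega>) T r"
          unfolding skorokhod_nhd_def
        proof (intro CollectI conjI exI[of _ \<tau>] allI impI ballI)
          show "time_change \<tau>" using \<tau> by (simp add: time_change_def)
          show "\<bar>\<tau> s - s\<bar> < r" if "0 \<le> s" for s using \<tau>(3)[OF that] n by linarith
          show "mdist m (?c \<omega>' (\<tau> s)) (?c \<omega> s) < r" if "s \<in> {0..T}" for s
            using that pos[of s] \<tau>(4)[of s] l(3) Tr(2) Y XV[OF _ \<omega>(1)] by auto
        qed (rule cad[OF \<omega>'(1)])
        then show "\<omega>' \<in> ?c -` U" using Tr(3) by auto
      qed
      moreover have "\<omega> \<in> E (n, X 0 \<omega>, l)" using \<omega> l by (simp add: E_def)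
      moreover have "(n, X 0 \<omega>, l) \<in> I" using l XV[OF _ \<omega>(1)] by (simp add: I_def)
      ultimately show "\<omega> \<in> (\<Union>i\<in>{i \<in> I. E i \<subseteq> ?c -` U}. E i)" by blast
    qed (use E sets.sets_into_space in blast)
    also have "\<dots> \<in> sets \<Omega>"
      using I E by (intro sets.countable_UN') auto
    finally show "?c -` U \<inter> space \<Omega> \<in> sets \<Omega>" .
  qed (use sub in auto)
qed

section \<open>Entropy bounds for finite Markov processes\<close>

text \<open>With \<open>D\<close> the density of \<open>\<mu>\<close> with respect to \<open>\<nu>\<close>, the inequality \<open>ln q \<le> q - 1\<close> for \<open>q = u / (D * z)\<close> is integrated
against \<open>\<mu>\<close>: the integral of \<open>q\<close> is at most one, since multiplying by \<open>D\<close> turns it into an integral of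
at most \<open>u / z\<close> against \<open>\<nu>\<close>.\<close>

lemma gibbs_variational_inequality:
  assumes mu: "prob_space \<mu>" and nu: "sigma_finite_measure \<nu>" and sets: "sets \<mu> = sets \<nu>"
    and ent: "relative_entropy \<mu> \<nu> \<le> ereal h"
    and u: "u \<in> borel_measurable \<nu>" "AE x in \<mu>. 0 < u x" "integrable \<mu> (\<lambda>x. ln (u x))"
    and z: "(\<integral>\<^sup>+x. ennreal (u x) \<partial>\<nu>) \<le> ennreal z" "0 < z"
  shows "(\<integral>x. ln (u x) \<partial>\<mu>) \<le> h + ln z"
proof -
  interpret M: prob_space \<mu> by fact
  interpret N: sigma_finite_measure \<nu> by fact
  have ac: "absolutely_continuous \<nu> \<mu>" and int: "integrable \<mu> (entropy_density (exp 1) \<nu> \<mu>)"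
    and kl: "KL_divergence (exp 1) \<nu> \<mu> \<le> h"
    using ent by (auto simp: relative_entropy_def split: if_splits)
  define R where "R = RN_deriv \<nu> \<mu>"
  define D where "D x = enn2real (R x)" for x
  have Rm [measurable]: "R \<in> borel_measurable \<nu>" unfolding R_def by simp
  have dens: "density \<nu> R = \<mu>" unfolding R_def by (rule N.density_RN_deriv[OF ac sets])
  have ed: "entropy_density (exp 1) \<nu> \<mu> = (\<lambda>x. ln (D x))"
    by (simp add: entropy_density_def D_def R_def log_def fun_eq_iff)
  have Rfin: "AE x in \<nu>. R x \<noteq> \<infinity>"
    unfolding R_def by (rule N.RN_deriv_finite[OF M.sigma_finite_measure_axioms ac sets])
  have Dpos: "AE x in \<mu>. 0 < D x"
    unfolding dens[symmetric] using Rfin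
    by (subst AE_density) (auto simp: D_def enn2real_positive_iff less_top)
  have [measurable]: "u \<in> borel_measurable \<mu>" "D \<in> borel_measurable \<mu>"
    using u(1) sets unfolding D_def by (auto cong: measurable_cong_sets)
  have [measurable]: "u \<in> borel_measurable \<nu>" "D \<in> borel_measurable \<nu>"
    using u(1) unfolding D_def by auto
  let ?q = "\<lambda>x. u x / (D x * z)"
  have qle: "(\<integral>\<^sup>+x. ennreal (?q x) \<partial>\<mu>) \<le> 1"
  proof -
    have "(\<integral>\<^sup>+x. ennreal (?q x) \<partial>\<mu>) = (\<integral>\<^sup>+x. R x * ennreal (?q x) \<partial>\<nu>)"
      unfolding dens[symmetric] by (intro nn_integral_density) auto
    also have "\<dots> \<le> (\<integral>\<^sup>+x. ennreal (1 / z) * ennreal (u x) \<partial>\<nu>)"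
    proof (rule nn_integral_mono_AE)
      show "AE x in \<nu>. R x * ennreal (?q x) \<le> ennreal (1 / z) * ennreal (u x)"
        using Rfin
      proof eventually_elim
        fix x assume "R x \<noteq> \<infinity>"
        then have R: "R x = ennreal (D x)" by (simp add: D_def less_top)
        have D0: "0 \<le> D x" by (simp add: D_def)
        show "R x * ennreal (?q x) \<le> ennreal (1 / z) * ennreal (u x)"
        proof (cases "0 \<le> u x")
          case True
          then show ?thesis unfolding R using D0 z(2)
            by (cases "D x = 0") (auto simp: ennreal_mult[symmetric])
        next
          case False
          then have "?q x \<le> 0" using D0 z(2) by (simp add: divide_nonpos_nonneg)
          then show ?thesis by (simp add: ennreal_neg)
        qed
      qed
    qed
    also have "\<dots> = ennreal (1 / z) * (\<integral>\<^sup>+x. ennreal (u x) \<partial>\<nu>)"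
      by (intro nn_integral_cmult) auto
    also have "\<dots> \<le> ennreal (1 / z) * ennreal z" by (intro mult_left_mono z) simp
    also have "\<dots> = 1" using z(2) by (simp add: ennreal_mult[symmetric])
    finally show ?thesis .
  qed
  have qpos: "AE x in \<mu>. 0 \<le> ?q x"
    using u(2) by eventually_elim (use z(2) in \<open>auto simp: D_def\<close>)
  have qint: "integrable \<mu> ?q"
    using qle qpos by (intro integrableI_nonneg) (auto simp: le_less_trans)
  have "ennreal (\<integral>x. ?q x \<partial>\<mu>) = (\<integral>\<^sup>+x. ennreal (?q x) \<partial>\<mu>)"
    by (rule nn_integral_eq_integral[symmetric, OF qint qpos])
  then have q1: "(\<integral>x. ?q x \<partial>\<mu>) \<le> 1" using qle by (metis ennreal_le_1)
  have "(\<integral>x. ln (u x) - ln (D x) \<partial>\<mu>) \<le> (\<integral>x. ?q x + (ln z - 1) \<partial>\<mu>)"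
  proof (rule integral_mono_AE)
    show "integrable \<mu> (\<lambda>x. ln (u x) - ln (D x))" using u(3) int unfolding ed by simp
    show "integrable \<mu> (\<lambda>x. ?q x + (ln z - 1))" using qint by simp
    show "AE x in \<mu>. ln (u x) - ln (D x) \<le> ?q x + (ln z - 1)"
      using u(2) Dpos
    proof eventually_elim
      fix x assume x: "0 < u x" "0 < D x"
      have "ln (?q x) \<le> ?q x - 1" using x z(2) by (intro ln_le_minus_one) auto
      moreover have "ln (?q x) = ln (u x) - (ln (D x) + ln z)"
        using x z(2) by (simp add: ln_div ln_mult)
      ultimately show "ln (u x) - ln (D x) \<le> ?q x + (ln z - 1)" by simp
    qed
  qed
  also have "\<dots> = (\<integral>x. ?q x \<partial>\<mu>) + (ln z - 1)" using qint by (simp add: M.prob_space)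
  finally have "(\<integral>x. ln (u x) - ln (D x) \<partial>\<mu>) \<le> ln z" using q1 by simp
  moreover have "(\<integral>x. ln (u x) - ln (D x) \<partial>\<mu>) = (\<integral>x. ln (u x) \<partial>\<mu>) - KL_divergence (exp 1) \<nu> \<mu>"
    using u(3) int unfolding ed KL_divergence_def by simp
  ultimately show ?thesis using kl by simp
qed

text \<open>The largest column sum is submultiplicative in time by the Chapman-Kolmogorov equation, and for short
times \<open>h\<close> it is at most \<open>1 + (\<Lambda> + o(1)) h\<close> by the definition of the generator. Hence it grows at most
exponentially with rate \<open>\<Lambda>\<close>. The column sums are the masses to which the evolution transports the counting
measure.\<close>

lemma transition_column_sum_bound:
  assumes V: "finite V" and p: "transition_function V p" "has_generator V p G"
    and col: "\<And>w. w \<in> V \<Longrightarrow> (\<Sum>v\<in>V. G (\<lambda>u. of_bool (u = w)) v) \<le> \<Lambda>"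
    and t: "0 \<le> t" "w \<in> V"
  shows "(\<Sum>v\<in>V. p t v w) \<le> exp (\<Lambda> * t)"
proof -
  have pos: "0 \<le> p s v w" if "0 \<le> s" "v \<in> V" "w \<in> V" for s v w
    using p(1) that by (auto simp: transition_function_def)
  \<comment> \<open>room is left above \<open>\<Lambda>\<close>, because the derivative at zero is only a limit\<close>
  have bound: "(\<Sum>v\<in>V. p t v w) \<le> exp (\<Lambda>' * t)" if \<Lambda>': "\<Lambda> < \<Lambda>'" for \<Lambda>'
  proof -
    have "\<forall>\<^sub>F h in at_right 0. \<forall>w\<in>V. (\<Sum>v\<in>V. p h v w) \<le> exp (\<Lambda>' * h)"
    proof (rule eventually_ball_finite[OF V], intro ballI)
      fix w assume w: "w \<in> V"
      have "((\<lambda>h. \<Sum>v\<in>V. ((\<Sum>u\<in>V. p h v u * of_bool (u = w)) - of_bool (v = w)) / h)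
          \<longlongrightarrow> (\<Sum>v\<in>V. G (\<lambda>u. of_bool (u = w)) v)) (at_right 0)"
      proof (rule tendsto_sum)
        fix v assume "v \<in> V"
        then show "((\<lambda>h. ((\<Sum>u\<in>V. p h v u * of_bool (u = w)) - of_bool (v = w)) / h)
          \<longlongrightarrow> G (\<lambda>u. of_bool (u = w)) v) (at_right 0)"
          using p(2)[unfolded has_generator_def, THEN spec, of "\<lambda>u. of_bool (u = w)"] by blast
      qed
      moreover have "(\<Sum>v\<in>V. ((\<Sum>u\<in>V. p h v u * of_bool (u = w)) - of_bool (v = w)) / h)
          = ((\<Sum>v\<in>V. p h v w) - 1) / h" for h
      proof -
        have "(\<Sum>u\<in>V. p h v u * of_bool (u = w)) = p h v w" for v
          using w V by (simp add: of_bool_def if_distrib[of "\<lambda>x. p h v _ * x"] sum.delta cong: if_cong)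
        moreover have "(\<Sum>v\<in>V. of_bool (v = w)) = (1 :: real)" using w V by (simp add: of_bool_def sum.delta)
        ultimately show ?thesis by (simp add: sum_divide_distrib[symmetric] sum_subtractf)
      qed
      ultimately have "((\<lambda>h. ((\<Sum>v\<in>V. p h v w) - 1) / h) \<longlongrightarrow> (\<Sum>v\<in>V. G (\<lambda>u. of_bool (u = w)) v)) (at_right 0)"
        by simp
      then have "\<forall>\<^sub>F h in at_right 0. ((\<Sum>v\<in>V. p h v w) - 1) / h < \<Lambda>'"
        by (rule order_tendstoD) (use col[OF w] \<Lambda>' in simp)
      moreover have "\<forall>\<^sub>F h in at_right (0::real). 0 < h" by (rule eventually_at_right_less)
      ultimately show "\<forall>\<^sub>F h in at_right 0. (\<Sum>v\<in>V. p h v w) \<le> exp (\<Lambda>' * h)"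
      proof eventually_elim
        fix h :: real assume h: "((\<Sum>v\<in>V. p h v w) - 1) / h < \<Lambda>'" "0 < h"
        then have "(\<Sum>v\<in>V. p h v w) \<le> 1 + \<Lambda>' * h" by (simp add: pos_divide_less_eq)
        also have "\<dots> \<le> exp (\<Lambda>' * h)" by (rule exp_ge_add_one_self)
        finally show "(\<Sum>v\<in>V. p h v w) \<le> exp (\<Lambda>' * h)" .
      qed
    qed
    then obtain b where b: "0 < b" "\<And>h w. 0 < h \<Longrightarrow> h < b \<Longrightarrow> w \<in> V \<Longrightarrow> (\<Sum>v\<in>V. p h v w) \<le> exp (\<Lambda>' * h)"
      unfolding eventually_at_right_field by auto
    have iter: "(\<Sum>v\<in>V. p (real n * h) v w) \<le> exp (\<Lambda>' * (real n * h))" if h: "0 < h" "h < b" and w: "w \<in> V" for n h w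
      using w
    proof (induction n arbitrary: w)
      case 0
      have "(\<Sum>v\<in>V. p 0 v w) = (\<Sum>v\<in>V. of_bool (v = w))"
        using p(1) 0 by (intro sum.cong) (auto simp: transition_function_def)
      then show ?case using 0 V by (simp add: of_bool_def sum.delta)
    next
      case (Suc n)
      have "(\<Sum>v\<in>V. p (real (Suc n) * h) v w) = (\<Sum>v\<in>V. \<Sum>u\<in>V. p (real n * h) v u * p h u w)"
      proof (intro sum.cong refl)
        fix v assume "v \<in> V"
        moreover have "real (Suc n) * h = real n * h + h" by (simp add: algebra_simps)
        ultimately show "p (real (Suc n) * h) v w = (\<Sum>u\<in>V. p (real n * h) v u * p h u w)"
          using p(1) Suc.prems h by (simp add: transition_function_def)
      qed
      also have "\<dots> = (\<Sum>u\<in>V. (\<Sum>v\<in>V. p (real n * h) v u) * p h u w)"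
        by (subst sum.swap) (simp add: sum_distrib_right)
      also have "\<dots> \<le> (\<Sum>u\<in>V. exp (\<Lambda>' * (real n * h)) * p h u w)"
        using Suc h pos by (intro sum_mono mult_right_mono) auto
      also have "\<dots> = exp (\<Lambda>' * (real n * h)) * (\<Sum>u\<in>V. p h u w)" by (simp add: sum_distrib_left)
      also have "\<dots> \<le> exp (\<Lambda>' * (real n * h)) * exp (\<Lambda>' * h)"
        using b(2)[OF h Suc.prems] by (intro mult_left_mono) auto
      also have "\<dots> = exp (\<Lambda>' * (real (Suc n) * h))"
        by (simp add: exp_add[symmetric] algebra_simps)
      finally show ?case .
    qed
    show ?thesis
    proof (cases "t = 0")
      case True
      then show ?thesis using iter[of "b / 2" w 0] b(1) t by simp
    next
      case False
      obtain n where n: "t / b < real n" using reals_Archimedean2 by blast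
      have "0 < t / b" using t False b(1) by simp
      then have "0 < real n" using n by linarith
      then have "t / real n < b" "0 < t / real n" "real n * (t / real n) = t"
        using n b(1) t False by (simp_all add: field_simps)
      then show ?thesis using iter[of "t / real n" w n] t by simp
    qed
  qed
  have "((\<lambda>l. exp (l * t)) \<longlongrightarrow> exp (\<Lambda> * t)) (at_right \<Lambda>)" by (intro tendsto_intros)
  moreover have "\<forall>\<^sub>F l in at_right \<Lambda>. (\<Sum>v\<in>V. p t v w) \<le> exp (l * t)"
    using eventually_at_right_less[of \<Lambda>] by eventually_elim (rule bound)
  ultimately show ?thesis by (rule tendsto_lowerbound) simp
qed

lemma expectation_finite_range:
  fixes f :: "'v \<Rightarrow> real"
  assumes \<Omega>: "prob_space \<Omega>" and V: "finite V" and X: "X \<in> measurable \<Omega> (count_space V)"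
  shows "(\<integral>\<omega>. f (X \<omega>) \<partial>\<Omega>) = (\<Sum>v\<in>V. measure \<Omega> {\<omega> \<in> space \<Omega>. X \<omega> = v} * f v)"
    and "integrable \<Omega> (\<lambda>\<omega>. f (X \<omega>))"
    and "{\<omega> \<in> space \<Omega>. X \<omega> = v} \<in> sets \<Omega>"
proof -
  interpret prob_space \<Omega> by fact
  have S: "{\<omega> \<in> space \<Omega>. X \<omega> = v} \<in> sets \<Omega>" for v
  proof -
    have "Measurable.pred \<Omega> (\<lambda>\<omega>. X \<omega> = v)" by (rule measurable_compose[OF X]) simp
    then show ?thesis by (simp add: pred_def)
  qed
  then show "{\<omega> \<in> space \<Omega>. X \<omega> = v} \<in> sets \<Omega>" .
  have eq: "f (X \<omega>) = (\<Sum>v\<in>V. indicator {\<omega> \<in> space \<Omega>. X \<omega> = v} \<omega> * f v)" if "\<omega> \<in> space \<Omega>" for \<omega>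
  proof -
    have "X \<omega> \<in> V" using measurable_space[OF X that] by simp
    have "(\<Sum>v\<in>V. indicator {\<omega> \<in> space \<Omega>. X \<omega> = v} \<omega> * f v) = (\<Sum>v\<in>V. if X \<omega> = v then f v else 0)"
      using that by (intro sum.cong) (auto simp: indicator_def)
    then show ?thesis using \<open>X \<omega> \<in> V\<close> V by (simp add: sum.delta')
  qed
  have int: "integrable \<Omega> (\<lambda>\<omega>. indicator {\<omega> \<in> space \<Omega>. X \<omega> = v} \<omega> * f v)" for v
    using S[of v] by (intro integrable_mult_left integrable_real_indicator) (auto simp: less_top[symmetric])
  have "integrable \<Omega> (\<lambda>\<omega>. \<Sum>v\<in>V. indicator {\<omega> \<in> space \<Omega>. X \<omega> = v} \<omega> * f v)"
    using int by (intro Bochner_Integration.integrable_sum)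
  then show "integrable \<Omega> (\<lambda>\<omega>. f (X \<omega>))"
    by (subst Bochner_Integration.integrable_cong[OF refl eq])
  have "(\<integral>\<omega>. f (X \<omega>) \<partial>\<Omega>) = (\<integral>\<omega>. (\<Sum>v\<in>V. indicator {\<omega> \<in> space \<Omega>. X \<omega> = v} \<omega> * f v) \<partial>\<Omega>)"
    by (intro Bochner_Integration.integral_cong refl eq)
  also have "\<dots> = (\<Sum>v\<in>V. \<integral>\<omega>. indicator {\<omega> \<in> space \<Omega>. X \<omega> = v} \<omega> * f v \<partial>\<Omega>)"
    using int by (intro Bochner_Integration.integral_sum)
  also have "\<dots> = (\<Sum>v\<in>V. measure \<Omega> {\<omega> \<in> space \<Omega>. X \<omega> = v} * f v)"
    using S by (intro sum.cong refl) simp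
  finally show "(\<integral>\<omega>. f (X \<omega>) \<partial>\<Omega>) = (\<Sum>v\<in>V. measure \<Omega> {\<omega> \<in> space \<Omega>. X \<omega> = v} * f v)" .
qed

lemma markov_process_transition_function:
  fixes V :: "'v set"
  assumes mp: "markov_process \<Omega> V G X" and V: "finite V"
  shows "\<exists>p. transition_function V p \<and> has_generator V p G \<and> (\<forall>t>0. \<forall>w\<in>V.
      measure \<Omega> {\<omega> \<in> space \<Omega>. X t \<omega> = w} = (\<Sum>v\<in>V. measure \<Omega> {\<omega> \<in> space \<Omega>. X 0 \<omega> = v} * p t v w))"
proof -
  have \<Omega>: "prob_space \<Omega>" and X: "\<And>t. 0 \<le> t \<Longrightarrow> X t \<in> measurable \<Omega> (count_space V)"
    using mp by (auto simp: markov_process_def)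
  obtain p where p: "transition_function V p" "has_generator V p G"
    and fdd: "\<forall>k::nat. \<forall>\<tau>::nat \<Rightarrow> real. \<forall>v::nat \<Rightarrow> 'v.
           0 \<le> \<tau> 0 \<and> (\<forall>i\<le>k. \<tau> i < \<tau> (Suc i)) \<and> (\<forall>i\<le>Suc k. v i \<in> V) \<longrightarrow>
           measure \<Omega> {\<omega> \<in> space \<Omega>. \<forall>i\<le>Suc k. X (\<tau> i) \<omega> = v i} =
           measure \<Omega> {\<omega> \<in> space \<Omega>. \<forall>i\<le>k. X (\<tau> i) \<omega> = v i} * p (\<tau> (Suc k) - \<tau> k) (v k) (v (Suc k))"
    using mp unfolding markov_process_def by (elim conjE exE) (rule that)
  interpret prob_space \<Omega> by fact
  have "measure \<Omega> {\<omega> \<in> space \<Omega>. X t \<omega> = w} = (\<Sum>v\<in>V. measure \<Omega> {\<omega> \<in> space \<Omega>. X 0 \<omega> = v} * p t v w)"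
    if t: "0 < t" and w: "w \<in> V" for t w
  proof -
    have S: "{\<omega> \<in> space \<Omega>. X s \<omega> = v} \<in> sets \<Omega>" if "0 \<le> s" for s v
      by (rule expectation_finite_range(3)[OF \<Omega> V X[OF that]])
    let ?A = "\<lambda>v. {\<omega> \<in> space \<Omega>. X 0 \<omega> = v} \<inter> {\<omega> \<in> space \<Omega>. X t \<omega> = w}"
    have "measure \<Omega> (\<Union>v\<in>V. ?A v) = (\<Sum>v\<in>V. measure \<Omega> (?A v))"
      using V S t by (intro finite_measure_finite_Union) (auto simp: disjoint_family_on_def)
    moreover have "(\<Union>v\<in>V. ?A v) = {\<omega> \<in> space \<Omega>. X t \<omega> = w}"
      using measurable_space[OF X[of 0]] by auto
    moreover have "measure \<Omega> (?A v) = measure \<Omega> {\<omega> \<in> space \<Omega>. X 0 \<omega> = v} * p t v w" if v: "v \<in> V" for v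
    proof -
      define \<tau> where "\<tau> i = (if i = 0 then 0 else t)" for i :: nat
      define vs where "vs i = (if i = 0 then v else w)" for i :: nat
      have "measure \<Omega> {\<omega> \<in> space \<Omega>. \<forall>i\<le>Suc 0. X (\<tau> i) \<omega> = vs i} =
             measure \<Omega> {\<omega> \<in> space \<Omega>. \<forall>i\<le>0. X (\<tau> i) \<omega> = vs i} * p (\<tau> (Suc 0) - \<tau> 0) (vs 0) (vs (Suc 0))"
        using fdd[rule_format, of \<tau> 0 vs] t v w by (auto simp: \<tau>_def vs_def)
      moreover have "{\<omega> \<in> space \<Omega>. \<forall>i\<le>Suc 0. X (\<tau> i) \<omega> = vs i} = ?A v"
        by (auto simp: \<tau>_def vs_def le_Suc_eq)
      moreover have "{\<omega> \<in> space \<Omega>. \<forall>i\<le>0. X (\<tau> i) \<omega> = vs i} = {\<omega> \<in> space \<Omega>. X 0 \<omega> = v}"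
        by (auto simp: \<tau>_def vs_def)
      ultimately show ?thesis by (simp add: \<tau>_def vs_def)
    qed
    ultimately show ?thesis by simp
  qed
  with p show ?thesis by blast
qed

text \<open>Jensen's inequality bounds the expectation of \<open>F (X t)\<close> given \<open>X 0 = v\<close> by the logarithm of \<open>u v\<close>, the
conditional expectation of \<open>exp (F (X t))\<close>. The entropy hypothesis \<open>gibbs\<close> is applied to this \<open>u\<close>, whose
\<open>\<kappa>\<close>-weighted sum is controlled by the column sums.\<close>

lemma markov_exponential_bound:
  fixes F :: "'v \<Rightarrow> real"
  assumes mp: "markov_process \<Omega> V G X" and V: "finite V"
    and col: "\<And>w. w \<in> V \<Longrightarrow> (\<Sum>v\<in>V. G (\<lambda>u. of_bool (u = w)) v) \<le> \<Lambda>"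
    and gibbs: "\<And>u z. (\<And>v. v \<in> V \<Longrightarrow> 0 < u v) \<Longrightarrow> 0 < z \<Longrightarrow> (\<Sum>v\<in>V. \<kappa> * u v) \<le> z \<Longrightarrow>
      (\<integral>\<omega>. ln (u (X 0 \<omega>)) \<partial>\<Omega>) \<le> h + ln z"
    and \<kappa>: "0 < \<kappa>" and t: "0 < t"
  shows "(\<integral>\<omega>. F (X t \<omega>) \<partial>\<Omega>) \<le> h + \<Lambda> * t + ln (\<Sum>w\<in>V. \<kappa> * exp (F w))"
proof -
  have \<Omega>: "prob_space \<Omega>" and X: "\<And>t. 0 \<le> t \<Longrightarrow> X t \<in> measurable \<Omega> (count_space V)"
    using mp by (auto simp: markov_process_def)
  interpret prob_space \<Omega> by fact
  obtain p where p: "transition_function V p" "has_generator V p G"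
    and marg: "\<And>t w. 0 < t \<Longrightarrow> w \<in> V \<Longrightarrow>
      measure \<Omega> {\<omega> \<in> space \<Omega>. X t \<omega> = w} = (\<Sum>v\<in>V. measure \<Omega> {\<omega> \<in> space \<Omega>. X 0 \<omega> = v} * p t v w)"
    using markov_process_transition_function[OF mp V] by blast
  obtain \<omega>0 where "\<omega>0 \<in> space \<Omega>" using not_empty by blast
  then have Vne: "V \<noteq> {}" using measurable_space[OF X[of 0]] by auto
  have p0: "0 \<le> p t v w" if "v \<in> V" "w \<in> V" for v w
    using p(1) t that by (auto simp: transition_function_def)
  have p1: "(\<Sum>w\<in>V. p t v w) = 1" if "v \<in> V" for v
    using p(1) t that by (auto simp: transition_function_def)
  define u where "u v = (\<Sum>w\<in>V. p t v w * exp (F w))" for v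
  have upos: "0 < u v" if "v \<in> V" for v
  proof -
    have "\<exists>w\<in>V. p t v w \<noteq> 0" using p1[OF that] by (metis sum.neutral zero_neq_one)
    then obtain w where w: "w \<in> V" "0 < p t v w" using p0 \<open>v \<in> V\<close> by (metis order_le_less)
    then have "0 < p t v w * exp (F w)" by simp
    also have "\<dots> \<le> u v"
      unfolding u_def using V w p0[OF that] by (intro member_le_sum) auto
    finally show ?thesis .
  qed
  have jensen: "(\<Sum>w\<in>V. p t v w * F w) \<le> ln (u v)" if v: "v \<in> V" for v
  proof -
    have "p t v w * F w \<le> p t v w * (exp (F w) / u v - 1 + ln (u v))" if "w \<in> V" for w
    proof (rule mult_left_mono)
      have "ln (exp (F w) / u v) \<le> exp (F w) / u v - 1"
        using upos[OF v] by (intro ln_le_minus_one) simp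
      then show "F w \<le> exp (F w) / u v - 1 + ln (u v)" using upos[OF v] by (simp add: ln_div)
    qed (rule p0[OF v that])
    then have "(\<Sum>w\<in>V. p t v w * F w) \<le> (\<Sum>w\<in>V. p t v w * exp (F w) / u v + p t v w * (ln (u v) - 1))"
      by (intro sum_mono) (simp add: algebra_simps)
    also have "\<dots> = u v / u v + (ln (u v) - 1)"
      unfolding sum.distrib sum_divide_distrib[symmetric] sum_distrib_right[symmetric] u_def[symmetric] p1[OF v] by simp
    finally show ?thesis using upos[OF v] by simp
  qed
  let ?Z = "\<Sum>w\<in>V. \<kappa> * exp (F w)"
  have Z: "0 < ?Z" using V Vne \<kappa> by (intro sum_pos) auto
  have mass: "(\<Sum>v\<in>V. \<kappa> * u v) \<le> exp (\<Lambda> * t) * ?Z"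
  proof -
    have "(\<Sum>v\<in>V. \<kappa> * u v) = (\<Sum>w\<in>V. \<kappa> * exp (F w) * (\<Sum>v\<in>V. p t v w))"
      unfolding u_def sum_distrib_left by (subst sum.swap) (simp add: mult_ac)
    also have "\<dots> \<le> (\<Sum>w\<in>V. \<kappa> * exp (F w) * exp (\<Lambda> * t))"
      using \<kappa> t by (intro sum_mono mult_left_mono transition_column_sum_bound[OF V p col]) auto
    finally show ?thesis by (simp add: sum_distrib_left mult_ac)
  qed
  have "(\<integral>\<omega>. F (X t \<omega>) \<partial>\<Omega>) = (\<Sum>w\<in>V. measure \<Omega> {\<omega> \<in> space \<Omega>. X t \<omega> = w} * F w)"
    using t by (intro expectation_finite_range[OF \<Omega> V X]) simp
  also have "\<dots> = (\<Sum>w\<in>V. (\<Sum>v\<in>V. measure \<Omega> {\<omega> \<in> space \<Omega>. X 0 \<omega> = v} * p t v w) * F w)"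
    using marg[OF t] by (intro sum.cong) auto
  also have "\<dots> = (\<Sum>v\<in>V. measure \<Omega> {\<omega> \<in> space \<Omega>. X 0 \<omega> = v} * (\<Sum>w\<in>V. p t v w * F w))"
    unfolding sum_distrib_left sum_distrib_right by (subst sum.swap) (simp add: mult_ac)
  also have "\<dots> \<le> (\<Sum>v\<in>V. measure \<Omega> {\<omega> \<in> space \<Omega>. X 0 \<omega> = v} * ln (u v))"
    using jensen by (intro sum_mono mult_left_mono) auto
  also have "\<dots> = (\<integral>\<omega>. ln (u (X 0 \<omega>)) \<partial>\<Omega>)"
    using expectation_finite_range(1)[OF \<Omega> V X[of 0], of "\<lambda>v. ln (u v)"] by simp
  also have "\<dots> \<le> h + ln (exp (\<Lambda> * t) * ?Z)"
    using Z by (intro gibbs upos mass) auto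
  also have "\<dots> = h + \<Lambda> * t + ln ?Z" using Z by (simp add: ln_mult)
  finally show ?thesis .
qed

section \<open>Test functionals of the microscopic system\<close>

lemma nn_integral_exp_Ico:
  assumes "0 < b" "0 < \<epsilon>"
  shows "(\<integral>\<^sup>+y. ennreal (b * exp (- b * y)) * indicator {x..<x + \<epsilon>} y \<partial>lborel) = ennreal (exp (- b * x) - exp (- b * (x + \<epsilon>)))"
proof -
  have "(\<integral>\<^sup>+y. ennreal (b * exp (- b * y)) * indicator {x..<x + \<epsilon>} y \<partial>lborel)
     = (\<integral>\<^sup>+y. ennreal (b * exp (- b * y)) * indicator {x..x + \<epsilon>} y \<partial>lborel)"
  proof (rule nn_integral_cong_AE)
    show "AE y in lborel. ennreal (b * exp (- b * y)) * indicator {x..<x + \<epsilon>} y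
        = ennreal (b * exp (- b * y)) * indicator {x..x + \<epsilon>} y"
      using AE_lborel_singleton[of "x + \<epsilon>"] by eventually_elim (auto simp: indicator_def)
  qed
  also have "\<dots> = (- exp (- b * (x + \<epsilon>))) - (- exp (- b * x))"
    using assms by (intro nn_integral_FTC_Icc) (auto intro!: derivative_eq_intros)
  finally show ?thesis by simp
qed

lemma g_weight_eq:
  assumes "0 < b" "0 < \<epsilon>"
  shows "g_weight \<epsilon> b x = exp (- b * x) * (1 - exp (- b * \<epsilon>))"
proof -
  have "((\<lambda>y. exp (- b * y)) has_integral (- exp (- b * (x + \<epsilon>)) / b - (- exp (- b * x) / b))) {x..x + \<epsilon>}"
    using assms by (intro fundamental_theorem_of_calculus)
      (auto intro!: derivative_eq_intros simp: has_real_derivative_iff_has_vector_derivative[symmetric])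
  then have "integral {x..x + \<epsilon>} (\<lambda>y. exp (- b * y)) = - exp (- b * (x + \<epsilon>)) / b - (- exp (- b * x) / b)"
    by (rule integral_unique)
  then show ?thesis
    using assms by (simp add: g_weight_def field_simps exp_add[symmetric])
qed

lemma g_weight_pos: "0 < b \<Longrightarrow> 0 < \<epsilon> \<Longrightarrow> 0 < g_weight \<epsilon> b x"
  by (simp add: g_weight_eq)

text \<open>The weight of a grid point is the exponential measure of the cell to its right, where the function is
smaller than at the grid point by at most \<open>l * \<epsilon>\<close>; so the sum is compared with an integral.\<close>

lemma site_exponential_moment:
  assumes b: "0 < b" and eps: "0 < \<epsilon>" and \<theta>: "0 \<le> \<theta>" and f: "f \<in> borel_measurable borel"
    and lip: "\<And>x y. x \<le> y \<Longrightarrow> f x \<le> f y + l * (y - x)" and l: "0 \<le> l"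
    and moment: "(\<integral>\<^sup>+x. ennreal (b * exp (- b * x) * exp (\<theta> * f x)) * indicator {0..} x \<partial>lborel) \<le> ennreal z"
    and z: "0 \<le> z"
  shows "(\<Sum>m<M. g_weight \<epsilon> b (real m * \<epsilon>) * exp (\<theta> * f (real m * \<epsilon>))) \<le> exp (\<theta> * l * \<epsilon>) * z"
proof -
  have [measurable]: "f \<in> borel_measurable borel" by fact
  let ?h = "\<lambda>x. ennreal (b * exp (- b * x) * exp (\<theta> * f x))"
  let ?a = "\<lambda>m. g_weight \<epsilon> b (real m * \<epsilon>) * exp (\<theta> * f (real m * \<epsilon>))"
  have site: "ennreal (?a m) \<le> ennreal (exp (\<theta> * l * \<epsilon>)) * (\<integral>\<^sup>+x. ?h x * indicator {real m * \<epsilon>..<real m * \<epsilon> + \<epsilon>} x \<partial>lborel)" for m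
  proof -
    let ?x = "real m * \<epsilon>"
    have "ennreal (?a m) = ennreal (exp (\<theta> * f ?x)) * (\<integral>\<^sup>+y. ennreal (b * exp (- b * y)) * indicator {?x..<?x + \<epsilon>} y \<partial>lborel)"
      using g_weight_pos[OF b eps, of ?x]
      by (subst nn_integral_exp_Ico[OF b eps])
        (simp add: g_weight_eq[OF b eps] ennreal_mult[symmetric] algebra_simps exp_add[symmetric])
    also have "\<dots> = (\<integral>\<^sup>+y. ennreal (exp (\<theta> * f ?x)) * (ennreal (b * exp (- b * y)) * indicator {?x..<?x + \<epsilon>} y) \<partial>lborel)"
      by (rule nn_integral_cmult[symmetric]) measurable
    also have "\<dots> \<le> (\<integral>\<^sup>+y. ennreal (exp (\<theta> * l * \<epsilon>)) * (?h y * indicator {?x..<?x + \<epsilon>} y) \<partial>lborel)"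
    proof (rule nn_integral_mono)
      fix y :: real
      show "ennreal (exp (\<theta> * f ?x)) * (ennreal (b * exp (- b * y)) * indicator {?x..<?x + \<epsilon>} y)
        \<le> ennreal (exp (\<theta> * l * \<epsilon>)) * (?h y * indicator {?x..<?x + \<epsilon>} y)"
      proof (cases "y \<in> {?x..<?x + \<epsilon>}")
        case True
        then have "f ?x \<le> f y + l * (y - ?x)" by (intro lip) simp
        also have "\<dots> \<le> f y + l * \<epsilon>" using True l by (intro add_left_mono mult_left_mono) auto
        finally have "\<theta> * f ?x \<le> \<theta> * (f y + l * \<epsilon>)" using \<theta> by (rule mult_left_mono)
        then have "exp (\<theta> * f ?x) \<le> exp (\<theta> * l * \<epsilon>) * exp (\<theta> * f y)"
          by (simp add: exp_add[symmetric] algebra_simps)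
        then have "exp (\<theta> * f ?x) * (b * exp (- b * y)) \<le> exp (\<theta> * l * \<epsilon>) * exp (\<theta> * f y) * (b * exp (- b * y))"
          using b by (intro mult_right_mono) auto
        then show ?thesis using True b by (simp add: ennreal_mult[symmetric] mult_ac)
      qed simp
    qed
    also have "\<dots> = ennreal (exp (\<theta> * l * \<epsilon>)) * (\<integral>\<^sup>+y. ?h y * indicator {?x..<?x + \<epsilon>} y \<partial>lborel)"
      by (rule nn_integral_cmult) measurable
    finally show ?thesis .
  qed
  have "ennreal (\<Sum>m<M. ?a m) \<le> ennreal (exp (\<theta> * l * \<epsilon>)) * (\<integral>\<^sup>+x. ?h x * indicator {0..<real M * \<epsilon>} x \<partial>lborel)"
  proof (induction M)
    case (Suc M)
    have "indicator {0..<a + \<epsilon>} x = (indicator {0..<a} x + indicator {a..<a + \<epsilon>} x :: ennreal)" if "0 \<le> a" for a x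
      using eps that by (auto simp: indicator_def)
    from this[of "real M * \<epsilon>"] have ind: "indicator {0..<real (Suc M) * \<epsilon>} x
        = (indicator {0..<real M * \<epsilon>} x + indicator {real M * \<epsilon>..<real M * \<epsilon> + \<epsilon>} x :: ennreal)" for x
      using eps by (simp add: distrib_right add.commute)
    have "ennreal (\<Sum>m<Suc M. ?a m) = ennreal (\<Sum>m<M. ?a m) + ennreal (?a M)"
      using g_weight_pos[OF b eps] by (simp add: ennreal_plus[symmetric] sum_nonneg less_imp_le del: ennreal_plus)
    also have "\<dots> \<le> ennreal (exp (\<theta> * l * \<epsilon>)) * (\<integral>\<^sup>+x. ?h x * indicator {0..<real M * \<epsilon>} x \<partial>lborel)
      + ennreal (exp (\<theta> * l * \<epsilon>)) * (\<integral>\<^sup>+x. ?h x * indicator {real M * \<epsilon>..<real M * \<epsilon> + \<epsilon>} x \<partial>lborel)"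
      by (intro add_mono Suc site)
    also have "\<dots> = ennreal (exp (\<theta> * l * \<epsilon>)) * (\<integral>\<^sup>+x. ?h x * indicator {0..<real (Suc M) * \<epsilon>} x \<partial>lborel)"
      unfolding ind distrib_left by (subst nn_integral_add) (auto simp: distrib_left)
    finally show ?case .
  qed simp
  also have "\<dots> \<le> ennreal (exp (\<theta> * l * \<epsilon>)) * (\<integral>\<^sup>+x. ?h x * indicator {0..} x \<partial>lborel)"
    by (intro mult_left_mono nn_integral_mono) (auto simp: indicator_def)
  also have "\<dots> \<le> ennreal (exp (\<theta> * l * \<epsilon>)) * ennreal z"
    using moment by (rule mult_left_mono) simp
  finally show ?thesis
    using z by (simp add: ennreal_mult[symmetric])
qed

lemma configuration_facts:
  assumes w: "w \<in> configurations N L \<epsilon>" and eps: "0 < \<epsilon>"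
  shows "0 \<le> w i \<or> i \<notin> {1..L}" "i \<in> {1..L} \<Longrightarrow> w i \<le> real N * \<epsilon>" "i \<in> {1..L} \<Longrightarrow> \<exists>m\<le>N. w i = real m * \<epsilon>"
    "(\<Sum>i=1..L. w i) = real N * \<epsilon>"
proof -
  have grid: "\<exists>m::nat. w i = real m * \<epsilon>" if "i \<in> {1..L}" for i
    using w that by (auto simp: configurations_def grid_def PiE_iff)
  then have pos: "0 \<le> w i" if "i \<in> {1..L}" for i using eps that by force
  then show "0 \<le> w i \<or> i \<notin> {1..L}" by auto
  show sum: "(\<Sum>i=1..L. w i) = real N * \<epsilon>" using w by (simp add: configurations_def)
  show le: "w i \<le> real N * \<epsilon>" if "i \<in> {1..L}" for i
    unfolding sum[symmetric] using that pos by (intro member_le_sum) auto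
  show "\<exists>m\<le>N. w i = real m * \<epsilon>" if i: "i \<in> {1..L}" for i
    using grid[OF i] le[OF i] eps by auto
qed

lemma configurations_subset:
  assumes "0 < \<epsilon>"
  shows "configurations N L \<epsilon> \<subseteq> {1..L} \<rightarrow>\<^sub>E (\<lambda>m. real m * \<epsilon>) ` {..<Suc N}"
proof
  fix w assume w: "w \<in> configurations N L \<epsilon>"
  then have "w \<in> extensional {1..L}" by (auto simp: configurations_def grid_def PiE_iff)
  moreover have "w i \<in> (\<lambda>m. real m * \<epsilon>) ` {..<Suc N}" if "i \<in> {1..L}" for i
    using configuration_facts(3)[OF w assms that] by (auto simp: less_Suc_eq_le)
  ultimately show "w \<in> {1..L} \<rightarrow>\<^sub>E (\<lambda>m. real m * \<epsilon>) ` {..<Suc N}" by (auto simp: PiE_iff)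
qed

lemma finite_configurations: "0 < \<epsilon> \<Longrightarrow> finite (configurations N L \<epsilon>)"
  by (rule finite_subset[OF configurations_subset]) (auto intro: finite_PiE)

text \<open>The weights are geometric, so their product depends on the configuration only through the total mass.\<close>

lemma reference_weight_configuration:
  assumes w: "w \<in> configurations N L \<epsilon>" and "0 < \<epsilon>" "0 < b"
  shows "(\<Prod>i=1..L. g_weight \<epsilon> b (w i)) = exp (- b * (real N * \<epsilon>)) * (1 - exp (- b * \<epsilon>)) ^ L"
proof -
  have "(\<Prod>i=1..L. g_weight \<epsilon> b (w i)) = (\<Prod>i=1..L. exp (- b * w i)) * (1 - exp (- b * \<epsilon>)) ^ L"
    using assms by (simp add: g_weight_eq prod.distrib)
  also have "(\<Prod>i=1..L. exp (- b * w i)) = exp (- b * (\<Sum>i=1..L. w i))"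
    by (simp add: exp_sum[symmetric] sum_distrib_left)
  finally show ?thesis using configuration_facts(4)[OF w \<open>0 < \<epsilon>\<close>] by simp
qed

text \<open>The exponential of a maximum is at most the sum of the exponentials, and each of these factorises
over the sites once the constraint on the total mass is dropped.\<close>

lemma max_exponential_sum_bound:
  assumes b: "0 < b" and eps: "0 < \<epsilon>" and \<theta>: "0 \<le> \<theta>" and A: "0 \<le> A"
    and site: "\<And>j. j \<le> k \<Longrightarrow> (\<Sum>m<Suc N. g_weight \<epsilon> b (real m * \<epsilon>) * exp (\<theta> * f j (real m * \<epsilon>))) \<le> A"
  shows "(\<Sum>w\<in>configurations N L \<epsilon>. (\<Prod>i=1..L. g_weight \<epsilon> b (w i)) * exp (\<theta> * Max ((\<lambda>j. \<Sum>i=1..L. f j (w i)) ` {..k})))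
    \<le> real (Suc k) * A ^ L"
proof -
  let ?g = "\<lambda>w. \<Prod>i=1..L. g_weight \<epsilon> b (w i)" and ?M = "\<lambda>w. Max ((\<lambda>j. \<Sum>i=1..L. f j (w i)) ` {..k})"
  let ?h = "\<lambda>j w. \<Prod>i=1..L. g_weight \<epsilon> b (w i) * exp (\<theta> * f j (w i))"
  let ?V = "configurations N L \<epsilon>"
  have g: "0 \<le> ?g w" for w
    using g_weight_pos[OF b eps] by (intro prod_nonneg) (auto intro: less_imp_le)
  have "(\<Sum>w\<in>?V. ?g w * exp (\<theta> * ?M w))
    \<le> (\<Sum>w\<in>?V. ?g w * (\<Sum>j\<le>k. exp (\<theta> * (\<Sum>i=1..L. f j (w i)))))"
  proof (intro sum_mono mult_left_mono g)
    fix w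
    have "?M w \<in> (\<lambda>j. \<Sum>i=1..L. f j (w i)) ` {..k}"
      by (intro Max_in) auto
    then obtain j where j: "?M w = (\<Sum>i=1..L. f j (w i))" "j \<in> {..k}" by (rule imageE)
    show "exp (\<theta> * ?M w) \<le> (\<Sum>j\<le>k. exp (\<theta> * (\<Sum>i=1..L. f j (w i))))"
      unfolding j(1) using j(2) by (intro member_le_sum[of j "{..k}" "\<lambda>j. exp (\<theta> * (\<Sum>i=1..L. f j (w i)))"]) auto
  qed
  also have "\<dots> = (\<Sum>j\<le>k. \<Sum>w\<in>?V. ?h j w)"
    unfolding sum_distrib_left by (subst sum.swap) (simp add: prod.distrib exp_sum[symmetric])
  also have "\<dots> \<le> (\<Sum>j\<le>k. A ^ L)"
  proof (rule sum_mono)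
    fix j assume j: "j \<in> {..k}"
    let ?G = "(\<lambda>m. real m * \<epsilon>) ` {..<Suc N}"
    have inj: "inj_on (\<lambda>m. real m * \<epsilon>) {..<Suc N}" using eps by (auto simp: inj_on_def)
    have "(\<Sum>w\<in>?V. ?h j w)
      \<le> (\<Sum>w\<in>{1..L} \<rightarrow>\<^sub>E ?G. ?h j w)"
      using configurations_subset[OF eps] g_weight_pos[OF b eps]
      by (intro sum_mono2 finite_PiE prod_nonneg) (auto intro: less_imp_le)
    also have "\<dots> = (\<Prod>i=1..L. \<Sum>x\<in>?G. g_weight \<epsilon> b x * exp (\<theta> * f j x))"
      by (rule prod_sum_PiE[symmetric]) auto
    also have "\<dots> = (\<Sum>m<Suc N. g_weight \<epsilon> b (real m * \<epsilon>) * exp (\<theta> * f j (real m * \<epsilon>))) ^ L"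
      using inj by (simp add: sum.reindex del: sum.lessThan_Suc)
    also have "\<dots> \<le> A ^ L"
      using site[of j] j g_weight_pos[OF b eps]
      by (intro power_mono sum_nonneg) (auto intro: less_imp_le)
    finally show "(\<Sum>w\<in>?V. ?h j w) \<le> A ^ L" .
  qed
  also have "\<dots> = real (Suc k) * A ^ L" by simp
  finally show ?thesis .
qed

lemma sigma_finite_reference_measure: "sigma_finite_measure (reference_measure L \<epsilon> b)"
proof -
  have "countable (grid L \<epsilon>)" unfolding grid_def by (intro countable_PiE) auto
  then interpret sigma_finite_measure "count_space (grid L \<epsilon>)"
    by (rule sigma_finite_measure_count_space_countable)
  show ?thesis
    unfolding reference_measure_def point_measure_def
    by (subst sigma_finite_iff_density_finite) auto
qed

text \<open>The initial law is carried by the configurations of the given total mass, so \<open>u\<close> may be extended by zero to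
the whole grid. What remains of the reference measure is its constant weight on these configurations.\<close>

lemma initial_gibbs_inequality:
  assumes mp: "markov_process \<Omega> (configurations N L \<epsilon>) G X" and eps: "0 < \<epsilon>" and b: "0 < b"
    and ent: "relative_entropy (distr \<Omega> (count_space (grid L \<epsilon>)) (X 0)) (reference_measure L \<epsilon> b) \<le> ereal h"
    and u: "\<And>v. v \<in> configurations N L \<epsilon> \<Longrightarrow> 0 < u v"
    and z: "0 < z" "(\<Sum>v\<in>configurations N L \<epsilon>. exp (- b * (real N * \<epsilon>)) * (1 - exp (- b * \<epsilon>)) ^ L * u v) \<le> z"
  shows "(\<integral>\<omega>. ln (u (X 0 \<omega>)) \<partial>\<Omega>) \<le> h + ln z"
proof -
  let ?V = "configurations N L \<epsilon>" and ?\<mu> = "distr \<Omega> (count_space (grid L \<epsilon>)) (X 0)"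
  have \<Omega>: "prob_space \<Omega>" and X0: "X 0 \<in> measurable \<Omega> (count_space ?V)"
    using mp by (auto simp: markov_process_def)
  interpret prob_space \<Omega> by fact
  have V: "?V \<subseteq> grid L \<epsilon>" "finite ?V" using finite_configurations[OF eps] by (auto simp: configurations_def)
  have X0V: "X 0 \<omega> \<in> ?V" if "\<omega> \<in> space \<Omega>" for \<omega> using measurable_space[OF X0 that] by simp
  have X0g [measurable]: "X 0 \<in> measurable \<Omega> (count_space (grid L \<epsilon>))"
    by (rule measurable_compose[OF X0, of "\<lambda>x. x"]) (use V in auto)
  define u' where "u' v = (if v \<in> ?V then u v else 0)" for v
  have eq: "(\<integral>v. ln (u' v) \<partial>?\<mu>) = (\<integral>\<omega>. ln (u (X 0 \<omega>)) \<partial>\<Omega>)"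
    using X0V by (subst integral_distr) (auto simp: u'_def intro!: Bochner_Integration.integral_cong)
  have "(\<integral>v. ln (u' v) \<partial>?\<mu>) \<le> h + ln z"
  proof (rule gibbs_variational_inequality[OF _ sigma_finite_reference_measure _ ent])
    show "prob_space ?\<mu>" by (intro prob_space_distr) simp
    show "sets ?\<mu> = sets (reference_measure L \<epsilon> b)" by (simp add: reference_measure_def sets_point_measure)
    show "u' \<in> borel_measurable (reference_measure L \<epsilon> b)" by (simp add: reference_measure_def)
    show "AE x in ?\<mu>. 0 < u' x"
      using X0V u by (subst AE_distr_iff) (auto simp: u'_def)
    have "integrable \<Omega> (\<lambda>\<omega>. ln (u' (X 0 \<omega>)))"
      by (rule expectation_finite_range(2)[OF \<Omega> V(2) X0])
    then show "integrable ?\<mu> (\<lambda>x. ln (u' x))" by (subst integrable_distr_eq) auto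
    show "(\<integral>\<^sup>+x. ennreal (u' x) \<partial>reference_measure L \<epsilon> b) \<le> ennreal z"
    proof -
      let ?f = "\<lambda>\<eta>. ennreal (\<Prod>i=1..L. g_weight \<epsilon> b (\<eta> i))"
      have sub: "{a \<in> grid L \<epsilon>. 0 < ?f a \<and> 0 < ennreal (u' a)} \<subseteq> ?V"
        by (auto simp: u'_def split: if_splits)
      have g: "0 \<le> (\<Prod>i=1..L. g_weight \<epsilon> b (w i))" for w
        using g_weight_pos[OF b eps] by (intro prod_nonneg) (auto intro: less_imp_le)
      have "(\<integral>\<^sup>+x. ennreal (u' x) \<partial>reference_measure L \<epsilon> b)
          = (\<Sum>a | a \<in> grid L \<epsilon> \<and> 0 < ?f a \<and> 0 < ennreal (u' a). ?f a * ennreal (u' a))"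
        unfolding reference_measure_def
        by (rule nn_integral_point_measure) (rule finite_subset[OF sub V(2)])
      also have "\<dots> \<le> (\<Sum>a\<in>?V. ?f a * ennreal (u' a))"
        using sub V(2) by (intro sum_mono2) auto
      also have "\<dots> = (\<Sum>a\<in>?V. ennreal (exp (- b * (real N * \<epsilon>)) * (1 - exp (- b * \<epsilon>)) ^ L * u a))"
      proof (intro sum.cong refl)
        fix a assume a: "a \<in> ?V"
        show "?f a * ennreal (u' a) = ennreal (exp (- b * (real N * \<epsilon>)) * (1 - exp (- b * \<epsilon>)) ^ L * u a)"
          unfolding reference_weight_configuration[OF a eps b]
          using a u[OF a] b eps by (simp add: u'_def ennreal_mult)
      qed
      also have "\<dots> = ennreal (\<Sum>a\<in>?V. exp (- b * (real N * \<epsilon>)) * (1 - exp (- b * \<epsilon>)) ^ L * u a)"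
        using u b eps by (intro sum_ennreal) (auto intro: less_imp_le)
      also have "\<dots> \<le> ennreal z" using z(2) by (rule ennreal_leI)
      finally show ?thesis .
    qed
  qed (rule z)
  then show ?thesis unfolding eq .
qed

text \<open>For the jump \<open>(x, y, d)\<close> only one configuration leads to \<open>w\<close>, namely \<open>w\<close> with \<open>d * \<epsilon>\<close> moved back from \<open>y\<close> to
\<open>x\<close>. The kernel at that jump is at most \<open>C * (1 + w x) * (1 + w y) * (1 + z) * \<phi> z\<close> with \<open>z = d * \<epsilon>\<close>,
because \<open>1 + w x + z \<le> (1 + w x) * (1 + z)\<close>. The terms for leaving \<open>w\<close> are at most zero and are dropped.\<close>

lemma generator_column_sum:
  assumes w: "w \<in> configurations N L \<epsilon>" and L: "2 \<le> L" and eps: "0 < \<epsilon>"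
    and K0: "\<And>x y z. 0 < x \<Longrightarrow> 0 \<le> y \<Longrightarrow> 0 \<le> z \<Longrightarrow> 0 \<le> K x y z"
    and KC: "\<And>x y z. 0 < x \<Longrightarrow> 0 \<le> y \<Longrightarrow> 0 \<le> z \<Longrightarrow> K x y z \<le> C * (1 + x) * (1 + y) * \<phi> z"
    and C: "0 \<le> C" and \<phi>: "\<And>z. 0 \<le> z \<Longrightarrow> 0 \<le> \<phi> z"
  shows "(\<Sum>v\<in>configurations N L \<epsilon>. micro_generator K L \<epsilon> (\<lambda>u. of_bool (u = w)) v)
    \<le> C / (real L - 1) * (real L + real N * \<epsilon>)\<^sup>2 * (\<Sum>d=1..N. \<epsilon> * ((1 + real d * \<epsilon>) * \<phi> (real d * \<epsilon>)))"
proof -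
  let ?V = "configurations N L \<epsilon>"
  have V: "finite ?V" by (rule finite_configurations[OF eps])
  have w0: "0 \<le> w i" if "i \<in> {1..L}" for i using configuration_facts(1)[OF w eps, of i] that by auto
  define A where "A x y d = C * (1 + w x) * (1 + w y) * (\<epsilon> * ((1 + real d * \<epsilon>) * \<phi> (real d * \<epsilon>)))" for x y d
  define src where "src x y d = w(x := w x + real d * \<epsilon>, y := w y - real d * \<epsilon>)" for x y and d :: nat
  define term' where "term' v x y d = K (v x) (v y) (real d * \<epsilon>) * \<epsilon> *
      (of_bool (v(x := v x - real d * \<epsilon>, y := v y + real d * \<epsilon>) = w) - of_bool (v = w))" for v x y and d :: nat
  have A0: "0 \<le> A x y d" if "x \<in> {1..L}" "y \<in> {1..L}" for x y d
    unfolding A_def using w0 that C \<phi>[of "real d * \<epsilon>"] eps by (intro mult_nonneg_nonneg add_nonneg_nonneg) auto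
  have term_le: "term' v x y d \<le> A x y d * of_bool (v = src x y d)"
    if v: "v \<in> ?V" and xy: "x \<in> {1..L}" "y \<in> {1..L}" "x \<noteq> y" and d: "1 \<le> d" "real d \<le> v x / \<epsilon>" for v x y d
  proof -
    let ?z = "real d * \<epsilon>"
    have z: "0 < ?z" "?z \<le> v x" using d eps by (auto simp: pos_le_divide_eq)
    have vy: "0 \<le> v y" using configuration_facts(1)[OF v eps, of y] xy by auto
    have k0: "0 \<le> K (v x) (v y) ?z * \<epsilon>" using K0[of "v x" "v y" ?z] z vy eps by auto
    show ?thesis
    proof (cases "v(x := v x - ?z, y := v y + ?z) = w")
      case False
      then have "term' v x y d \<le> 0" unfolding term'_def using k0 by (auto simp: mult_le_0_iff)
      then show ?thesis using A0[OF xy(1,2), of d] by (auto simp: of_bool_def)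
    next
      case True
      then have wx: "w x = v x - ?z" "w y = v y + ?z" using xy(3) by (auto dest: fun_cong)
      have vs: "v = src x y d"
        unfolding src_def True[symmetric] using xy(3) by (auto simp: fun_eq_iff)
      have "term' v x y d \<le> K (v x) (v y) ?z * \<epsilon> * 1"
        unfolding term'_def using k0 by (intro mult_left_mono) auto
      also have "\<dots> \<le> C * (1 + v x) * (1 + v y) * \<phi> ?z * \<epsilon>"
        using KC[of "v x" "v y" ?z] z vy eps by simp
      also have "\<dots> = C * \<phi> ?z * \<epsilon> * ((1 + v x) * (1 + v y))" by (simp add: mult_ac)
      also have "\<dots> \<le> C * \<phi> ?z * \<epsilon> * ((1 + w x) * (1 + ?z) * (1 + w y))"
      proof (rule mult_left_mono)
        have "0 \<le> w x * ?z" using z w0[OF xy(1)] by simp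
        then have "1 + v x \<le> (1 + w x) * (1 + ?z)" using wx by (simp add: distrib_left distrib_right)
        moreover have "1 + v y \<le> 1 + w y" using wx z by simp
        ultimately show "(1 + v x) * (1 + v y) \<le> (1 + w x) * (1 + ?z) * (1 + w y)"
          using vy z by (intro mult_mono) auto
        show "0 \<le> C * \<phi> ?z * \<epsilon>" using C \<phi>[of ?z] z eps by simp
      qed
      also have "\<dots> = A x y d" by (simp add: A_def mult_ac)
      finally show ?thesis using vs by simp
    qed
  qed
  have inner: "(\<Sum>d | 1 \<le> d \<and> real d \<le> v x / \<epsilon>. term' v x y d) \<le> (\<Sum>d=1..N. A x y d * of_bool (v = src x y d))"
    if v: "v \<in> ?V" and xy: "x \<in> {1..L}" "y \<in> {1..L}" "x \<noteq> y" for v x y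
  proof -
    have sub: "{d. 1 \<le> d \<and> real d \<le> v x / \<epsilon>} \<subseteq> {1..N}"
    proof
      fix d assume d: "d \<in> {d. 1 \<le> d \<and> real d \<le> v x / \<epsilon>}"
      then have "real d * \<epsilon> \<le> v x" using eps by (simp add: pos_le_divide_eq)
      also have "\<dots> \<le> real N * \<epsilon>" by (rule configuration_facts(2)[OF v eps xy(1)])
      finally show "d \<in> {1..N}" using d eps by simp
    qed
    have "(\<Sum>d | 1 \<le> d \<and> real d \<le> v x / \<epsilon>. term' v x y d)
      \<le> (\<Sum>d | 1 \<le> d \<and> real d \<le> v x / \<epsilon>. A x y d * of_bool (v = src x y d))"
      using term_le[OF v xy] by (intro sum_mono) auto
    also have "\<dots> \<le> (\<Sum>d=1..N. A x y d * of_bool (v = src x y d))"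
      using sub A0[OF xy(1,2)] by (intro sum_mono2) auto
    finally show ?thesis .
  qed
  have "(\<Sum>v\<in>?V. micro_generator K L \<epsilon> (\<lambda>u. of_bool (u = w)) v)
    = 1 / (real L - 1) * (\<Sum>v\<in>?V. \<Sum>x\<in>{1..L}. \<Sum>y\<in>{1..L} - {x}. \<Sum>d | 1 \<le> d \<and> real d \<le> v x / \<epsilon>. term' v x y d)"
    unfolding micro_generator_def term'_def sum_distrib_left[symmetric] by simp
  also have "\<dots> \<le> 1 / (real L - 1) * (\<Sum>v\<in>?V. \<Sum>x\<in>{1..L}. \<Sum>y\<in>{1..L} - {x}. \<Sum>d=1..N. A x y d * of_bool (v = src x y d))"
    using L inner by (intro mult_left_mono sum_mono) auto
  also have "\<dots> = 1 / (real L - 1) * (\<Sum>x\<in>{1..L}. \<Sum>y\<in>{1..L} - {x}. \<Sum>d=1..N. A x y d * (\<Sum>v\<in>?V. of_bool (v = src x y d)))"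
    unfolding sum_distrib_left by (subst sum.swap, subst sum.swap[of _ _ ?V], subst sum.swap[of _ _ ?V]) simp
  also have "\<dots> \<le> 1 / (real L - 1) * (\<Sum>x\<in>{1..L}. \<Sum>y\<in>{1..L} - {x}. \<Sum>d=1..N. A x y d * 1)"
  proof (intro mult_left_mono sum_mono)
    show "(\<Sum>v\<in>?V. of_bool (v = src x y d)) \<le> (1 :: real)" for x y d
      using V by (simp add: of_bool_def sum.delta)
  qed (use L A0 in auto)
  also have "\<dots> \<le> 1 / (real L - 1) * (\<Sum>x\<in>{1..L}. \<Sum>y\<in>{1..L}. \<Sum>d=1..N. A x y d)"
    using L A0 by (intro mult_left_mono sum_mono) (auto intro!: sum_mono2 sum_nonneg)
  also have "(\<Sum>x\<in>{1..L}. \<Sum>y\<in>{1..L}. \<Sum>d=1..N. A x y d)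
      = C * (\<Sum>x\<in>{1..L}. 1 + w x)\<^sup>2 * (\<Sum>d=1..N. \<epsilon> * ((1 + real d * \<epsilon>) * \<phi> (real d * \<epsilon>)))"
    unfolding A_def power2_eq_square sum_distrib_left[symmetric] sum_distrib_right[symmetric]
    by (simp add: mult.assoc sum_distrib_left[symmetric] sum_distrib_right[symmetric])
  also have "(\<Sum>x\<in>{1..L}. 1 + w x) = real L + real N * \<epsilon>"
    using configuration_facts(4)[OF w eps] by (simp add: sum.distrib)
  finally show ?thesis by (simp add: mult_ac)
qed

lemma integral_empirical:
  assumes "f \<in> borel_measurable borel"
  shows "(\<integral>x. f x \<partial>empirical L \<eta>) = (\<Sum>i=1..L. f (\<eta> i)) / real L"
proof -
  have "\<eta> \<in> measurable (uniform_count_measure {1..L}) borel"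
    by (auto simp: uniform_count_measure_def point_measure_def)
  then have "(\<integral>x. f x \<partial>empirical L \<eta>) = (\<integral>i. f (\<eta> i) \<partial>uniform_count_measure {1..L})"
    unfolding empirical_def using assms by (intro integral_distr)
  then show ?thesis by (simp add: integral_uniform_count_measure)
qed

lemma max_test_empirical:
  assumes "1 \<le> L"
  shows "max_test \<delta> k (empirical L \<eta>) = Max ((\<lambda>j. \<Sum>i=1..L. test_fun \<delta> j (\<eta> i)) ` {..k}) / real L"
proof -
  have "mono (\<lambda>x. x / real L)" by (auto simp: mono_def divide_right_mono)
  then have "Max ((\<lambda>j. \<Sum>i=1..L. test_fun \<delta> j (\<eta> i)) ` {..k}) / real L
      = Max ((\<lambda>x. x / real L) ` (\<lambda>j. \<Sum>i=1..L. test_fun \<delta> j (\<eta> i)) ` {..k})"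
    by (rule mono_Max_commute) auto
  then show ?thesis by (simp add: max_test_def integral_empirical test_fun(3) image_image)
qed

text \<open>The exponential bound for Markov processes is applied to \<open>\<theta>\<close> times the unnormalised maximum over the test
functions, and the result divided by \<open>\<theta> * L\<close>. The condition \<open>b * exp \<theta> * \<delta> \<le> 1\<close> makes the
exponential moment of each site at most \<open>2\<close>, up to the discretisation error.\<close>

lemma expected_max_test_bound:
  assumes mp: "markov_process \<Omega> (configurations N L \<epsilon>) G X" and L: "1 \<le> L" and eps: "0 < \<epsilon>" and b: "0 < b"
    and ent: "relative_entropy (distr \<Omega> (count_space (grid L \<epsilon>)) (X 0)) (reference_measure L \<epsilon> b) \<le> ereal h"
    and col: "\<And>w. w \<in> configurations N L \<epsilon> \<Longrightarrow>
      (\<Sum>v\<in>configurations N L \<epsilon>. G (\<lambda>u. of_bool (u = w)) v) \<le> \<Lambda>"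
    and \<theta>: "0 < \<theta>" and \<delta>: "0 < \<delta>" "b * exp \<theta> * \<delta> \<le> 1" and t: "0 < t"
  shows "(\<integral>\<omega>. max_test \<delta> k (empirical L (X t \<omega>)) \<partial>\<Omega>)
    \<le> (h + \<Lambda> * t + ln (real (Suc k)) + real L * (1 + \<theta> * Max (test_slope ` {..k}) * \<epsilon>)) / (\<theta> * real L)"
proof -
  let ?V = "configurations N L \<epsilon>"
  let ?l = "Max (test_slope ` {..k})"
  define \<kappa> where "\<kappa> = exp (- b * (real N * \<epsilon>)) * (1 - exp (- b * \<epsilon>)) ^ L"
  define F where "F w = \<theta> * Max ((\<lambda>j. \<Sum>i=1..L. test_fun \<delta> j (w i)) ` {..k})" for w :: "nat \<Rightarrow> real"
  have \<kappa>: "0 < \<kappa>" using b eps by (simp add: \<kappa>_def)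
  have V: "finite ?V" by (rule finite_configurations[OF eps])
  have \<Omega>: "prob_space \<Omega>" and X0: "X 0 \<in> measurable \<Omega> (count_space ?V)"
    using mp by (auto simp: markov_process_def)
  interpret prob_space \<Omega> by fact
  obtain \<omega>0 where "\<omega>0 \<in> space \<Omega>" using not_empty by blast
  then have Vne: "?V \<noteq> {}" using measurable_space[OF X0] by auto
  have l: "test_slope j \<le> ?l" if "j \<le> k" for j using that by (intro Max_ge) auto
  have l0: "0 \<le> ?l" by (rule order_trans[OF less_imp_le[OF test_slope_pos[of 0]] l]) simp
  have site: "(\<Sum>m<Suc N. g_weight \<epsilon> b (real m * \<epsilon>) * exp (\<theta> * test_fun \<delta> j (real m * \<epsilon>))) \<le> exp (\<theta> * ?l * \<epsilon>) * 2" if j: "j \<le> k" for j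
  proof (rule site_exponential_moment[OF b eps less_imp_le[OF \<theta>] test_fun(3) _ l0])
    show "test_fun \<delta> j x \<le> test_fun \<delta> j y + ?l * (y - x)" if "x \<le> y" for x y
      using test_fun(4)[OF that, of \<delta> j] mult_right_mono[OF l[OF j], of "y - x"] that by simp
    have "(\<integral>\<^sup>+x. ennreal (b * exp (- b * x) * exp (\<theta> * test_fun \<delta> j x)) * indicator {0..} x \<partial>lborel)
      \<le> 1 + ennreal (b * exp \<theta>) * emeasure lborel (test_set \<delta> (fst (prod_decode j)))"
      unfolding test_fun_alt by (intro exp_moment_mollified test_set test_slope_pos b less_imp_le[OF \<theta>])
    also have "\<dots> \<le> 1 + ennreal (b * exp \<theta>) * ennreal \<delta>"
      by (intro add_left_mono mult_left_mono test_set) simp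
    also have "\<dots> = ennreal (1 + b * exp \<theta> * \<delta>)"
      using b \<delta>(1) by (simp add: ennreal_mult[symmetric] ennreal_plus[symmetric] ennreal_1[symmetric] del: ennreal_plus ennreal_1)
    also have "\<dots> \<le> ennreal 2" using \<delta>(2) by (intro ennreal_leI) simp
    finally show "(\<integral>\<^sup>+x. ennreal (b * exp (- b * x) * exp (\<theta> * test_fun \<delta> j x)) * indicator {0..} x \<partial>lborel) \<le> ennreal 2" .
  qed simp
  have "(\<Sum>w\<in>?V. \<kappa> * exp (F w)) = (\<Sum>w\<in>?V. (\<Prod>i=1..L. g_weight \<epsilon> b (w i)) * exp (F w))"
  proof (intro sum.cong refl)
    fix w assume w: "w \<in> ?V"
    show "\<kappa> * exp (F w) = (\<Prod>i=1..L. g_weight \<epsilon> b (w i)) * exp (F w)"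
      unfolding reference_weight_configuration[OF w eps b] \<kappa>_def ..
  qed
  also have "\<dots> \<le> real (Suc k) * (exp (\<theta> * ?l * \<epsilon>) * 2) ^ L"
    unfolding F_def by (intro max_exponential_sum_bound b eps less_imp_le[OF \<theta>] site) auto
  finally have Z: "(\<Sum>w\<in>?V. \<kappa> * exp (F w)) \<le> real (Suc k) * (exp (\<theta> * ?l * \<epsilon>) * 2) ^ L" .
  have Zpos: "0 < (\<Sum>w\<in>?V. \<kappa> * exp (F w))" using V Vne \<kappa> by (intro sum_pos) auto
  have "ln (\<Sum>w\<in>?V. \<kappa> * exp (F w)) \<le> ln (real (Suc k) * (exp (\<theta> * ?l * \<epsilon>) * 2) ^ L)"
    using Z Zpos by simp
  also have "\<dots> = ln (real (Suc k)) + real L * (\<theta> * ?l * \<epsilon> + ln 2)"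
    by (simp add: ln_mult ln_realpow distrib_left del: of_nat_Suc)
  also have "\<dots> \<le> ln (real (Suc k)) + real L * (1 + \<theta> * ?l * \<epsilon>)"
    using ln_le_minus_one[of 2] by (intro add_left_mono mult_left_mono) auto
  finally have lnZ: "ln (\<Sum>w\<in>?V. \<kappa> * exp (F w)) \<le> ln (real (Suc k)) + real L * (1 + \<theta> * ?l * \<epsilon>)" .
  have "(\<integral>\<omega>. F (X t \<omega>) \<partial>\<Omega>) \<le> h + \<Lambda> * t + ln (\<Sum>w\<in>?V. \<kappa> * exp (F w))"
    by (rule markov_exponential_bound[OF mp V col _ \<kappa> t])
      (use initial_gibbs_inequality[OF mp eps b ent] in \<open>auto simp: \<kappa>_def\<close>)
  then have FE: "(\<integral>\<omega>. F (X t \<omega>) \<partial>\<Omega>) \<le> h + \<Lambda> * t + ln (real (Suc k)) + real L * (1 + \<theta> * ?l * \<epsilon>)"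
    using lnZ by simp
  have "max_test \<delta> k (empirical L (X t \<omega>)) = F (X t \<omega>) / (\<theta> * real L)" for \<omega>
    using \<theta> by (simp add: max_test_empirical[OF L] F_def)
  then have "(\<integral>\<omega>. max_test \<delta> k (empirical L (X t \<omega>)) \<partial>\<Omega>) = (\<integral>\<omega>. F (X t \<omega>) \<partial>\<Omega>) / (\<theta> * real L)"
    by simp
  then show ?thesis using FE \<theta> by (simp add: divide_right_mono)
qed

section \<open>Uniform estimates and passage to the limit\<close>

text \<open>On each of the \<open>N\<close> cells replacing the function by its value at the right end costs at most \<open>\<epsilon> * r\<close>.\<close>

lemma riemann_sum_le_integral:
  assumes int: "set_integrable lborel {0..} f" and pos: "\<And>x. 0 \<le> x \<Longrightarrow> 0 \<le> f x" and eps: "0 < \<epsilon>"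
    and osc: "\<And>x y. 0 \<le> x \<Longrightarrow> 0 \<le> y \<Longrightarrow> \<bar>x - y\<bar> \<le> \<epsilon> \<Longrightarrow> \<bar>f x - f y\<bar> \<le> r"
  shows "(\<Sum>d=1..N. \<epsilon> * f (real d * \<epsilon>)) \<le> (LBINT x:{0..}. f x) + real N * \<epsilon> * r"
proof -
  have sub: "set_integrable lborel A f" if "A \<subseteq> {0..}" "A \<in> sets borel" for A
    using set_integrable_subset[OF int, of A] that by simp
  have cell: "\<epsilon> * f (a + \<epsilon>) \<le> (LBINT x:{a<..a + \<epsilon>}. f x) + \<epsilon> * r" if a: "0 \<le> a" for a
  proof -
    let ?I = "{a<..a + \<epsilon>}"
    have "\<epsilon> * (f (a + \<epsilon>) - r) = (LBINT x:?I. f (a + \<epsilon>) - r)"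
      using eps by (simp add: set_lebesgue_integral_def)
    also have "\<dots> \<le> (LBINT x:?I. f x)"
    proof (rule set_integral_mono)
      show "set_integrable lborel ?I (\<lambda>x. f (a + \<epsilon>) - r)"
        using eps by (simp add: set_integrable_def)
      show "set_integrable lborel ?I f" using a by (intro sub) auto
      show "f (a + \<epsilon>) - r \<le> f x" if "x \<in> ?I" for x
        using osc[of "a + \<epsilon>" x] that a eps by (simp add: abs_le_iff)
    qed
    finally show ?thesis by (simp add: right_diff_distrib)
  qed
  have "(\<Sum>d=1..N. \<epsilon> * f (real d * \<epsilon>)) \<le> (LBINT x:{0<..real N * \<epsilon>}. f x) + real N * \<epsilon> * r"
  proof (induction N)
    case 0
    then show ?case by (simp add: set_lebesgue_integral_def)
  next
    case (Suc N)
    define a where "a = real N * \<epsilon>"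
    have a: "0 \<le> a" using eps by (simp add: a_def)
    have e: "real (Suc N) * \<epsilon> = a + \<epsilon>" by (simp add: a_def distrib_right)
    have un: "{0<..a + \<epsilon>} = {0<..a} \<union> {a<..a + \<epsilon>}" using a eps by auto
    have "(LBINT x:{0<..a + \<epsilon>}. f x) = (LBINT x:{0<..a}. f x) + (LBINT x:{a<..a + \<epsilon>}. f x)"
      unfolding un
    proof (rule set_integral_Un)
      show "set_integrable lborel {0<..a} f" "set_integrable lborel {a<..a + \<epsilon>} f"
        using a by (auto intro!: sub)
    qed auto
    moreover have "(\<Sum>d=1..Suc N. \<epsilon> * f (real d * \<epsilon>)) = (\<Sum>d=1..N. \<epsilon> * f (real d * \<epsilon>)) + \<epsilon> * f (a + \<epsilon>)"
      unfolding e[symmetric] by simp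
    ultimately show ?case
      using Suc cell[OF a] unfolding e a_def[symmetric] distrib_right by linarith
  qed
  also have "(LBINT x:{0<..real N * \<epsilon>}. f x) \<le> (LBINT x:{0..}. f x)"
    unfolding set_lebesgue_integral_def
  proof (rule integral_mono)
    have "{0<..real N * \<epsilon>} \<subseteq> {0..}" by auto
    from sub[OF this] show "integrable lborel (\<lambda>x. indicator {0<..real N * \<epsilon>} x *\<^sub>R f x)"
      by (simp add: set_integrable_def)
    show "integrable lborel (\<lambda>x. indicator {0..} x *\<^sub>R f x)" using int by (simp add: set_integrable_def)
    show "indicator {0<..real N * \<epsilon>} x *\<^sub>R f x \<le> indicator {0..} x *\<^sub>R f x" for x
      using pos by (auto simp: indicator_def)
  qed
  finally show ?thesis by simp
qed

text \<open>For small \<open>r\<close> the supremum defining the modulus is over a bounded set, which makes it an upper bound.\<close>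

lemma modulus_of_continuity_bound:
  assumes "uniformly_continuous_on S f"
  shows "\<exists>d>0. \<forall>r<d. \<forall>x\<in>S. \<forall>y\<in>S. \<bar>x - y\<bar> \<le> r \<longrightarrow> \<bar>f x - f y\<bar> \<le> modulus_of_continuity S f r"
proof -
  obtain d where d: "0 < d" "\<And>x y. x \<in> S \<Longrightarrow> y \<in> S \<Longrightarrow> dist y x < d \<Longrightarrow> dist (f y) (f x) < 1"
    using assms unfolding uniformly_continuous_on_def by (metis zero_less_one)
  have "\<bar>f x - f y\<bar> \<le> modulus_of_continuity S f r"
    if "r < d" "x \<in> S" "y \<in> S" "\<bar>x - y\<bar> \<le> r" for r x y
  proof -
    let ?A = "{(x, y). x \<in> S \<and> y \<in> S \<and> \<bar>x - y\<bar> \<le> r}"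
    have "(case (x, y) of (x, y) \<Rightarrow> \<bar>f x - f y\<bar>) \<le> (SUP (x, y)\<in>?A. \<bar>f x - f y\<bar>)"
    proof (rule cSUP_upper)
      show "(x, y) \<in> ?A" using that by simp
      show "bdd_above ((\<lambda>(x, y). \<bar>f x - f y\<bar>) ` ?A)"
      proof (rule bdd_aboveI2[of _ _ 1])
        fix p assume "p \<in> ?A"
        then show "(case p of (x, y) \<Rightarrow> \<bar>f x - f y\<bar>) \<le> 1"
          using d(2)[of "snd p" "fst p"] that(1) by (auto simp: dist_real_def)
      qed
    qed
    then show ?thesis by (simp add: modulus_of_continuity_def)
  qed
  then show ?thesis using d(1) by blast
qed

text \<open>With \<open>m = N * \<epsilon> \<le> B * L\<close>, the error of the Riemann sum over the jump sizes is at most \<open>m\<close> times the modulus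
of continuity at \<open>\<epsilon>\<close>, hence bounded. The sum over pairs of sites contributes
\<open>(L + m)\<^sup>2 / (L - 1)\<close>, which is of order \<open>L\<close>.\<close>

lemma generator_column_sums_linear:
  assumes kernel: "existence_kernel K \<phi>"
    and params: "\<And>n. 1 \<le> N n" "\<And>n. 2 \<le> L n" "\<And>n. 0 < \<epsilon> n"
    and eps_lim: "\<epsilon> \<longlonglongrightarrow> 0"
    and density_lim: "(\<lambda>n. real (N n) * \<epsilon> n / real (L n)) \<longlonglongrightarrow> \<rho>"
    and modulus_lim:
      "(\<lambda>n. real (L n) * modulus_of_continuity {0..} (\<lambda>x. (1 + x) * \<phi> x) (\<epsilon> n)) \<longlonglongrightarrow> 0"
  obtains C where "0 \<le> C" "\<forall>\<^sub>F n in sequentially. \<forall>w\<in>configurations (N n) (L n) (\<epsilon> n).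
    (\<Sum>v\<in>configurations (N n) (L n) (\<epsilon> n). micro_generator K (L n) (\<epsilon> n) (\<lambda>u. of_bool (u = w)) v) \<le> C * real (L n)"
proof -
  let ?V = "\<lambda>n. configurations (N n) (L n) (\<epsilon> n)"
  let ?col = "\<lambda>n w. \<Sum>v\<in>?V n. micro_generator K (L n) (\<epsilon> n) (\<lambda>u. of_bool (u = w)) v"
  let ?f = "\<lambda>x. (1 + x) * \<phi> x"
  let ?\<omega> = "\<lambda>n. modulus_of_continuity {0..} ?f (\<epsilon> n)"
  have K0: "\<And>x y z. 0 < x \<Longrightarrow> 0 \<le> y \<Longrightarrow> 0 \<le> z \<Longrightarrow> 0 \<le> K x y z"
    and \<phi>0: "\<And>z. 0 \<le> z \<Longrightarrow> 0 \<le> \<phi> z"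
    and uc: "uniformly_continuous_on {0..} \<phi>" "uniformly_continuous_on {0..} (\<lambda>z. z * \<phi> z)"
    and ints: "set_integrable lborel {0..} \<phi>" "set_integrable lborel {0..} (\<lambda>z. z * \<phi> z)"
    using kernel by (auto simp: existence_kernel_def)
  have "\<exists>C. \<forall>x>0. \<forall>y\<ge>0. \<forall>z\<ge>0. K x y z \<le> C * (1 + x) * (1 + y) * \<phi> z"
    using kernel unfolding existence_kernel_def by (elim conjE)
  then obtain C0 where C0: "\<And>x y z. 0 < x \<Longrightarrow> 0 \<le> y \<Longrightarrow> 0 \<le> z \<Longrightarrow> K x y z \<le> C0 * (1 + x) * (1 + y) * \<phi> z"
    by blast
  define C where "C = max C0 0"
  have KC: "K x y z \<le> C * (1 + x) * (1 + y) * \<phi> z" if "0 < x" "0 \<le> y" "0 \<le> z" for x y z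
  proof -
    have "C0 * (1 + x) * (1 + y) * \<phi> z \<le> C * (1 + x) * (1 + y) * \<phi> z"
      using that \<phi>0[of z] by (intro mult_right_mono) (auto simp: C_def)
    then show ?thesis using C0[OF that] by simp
  qed
  have "uniformly_continuous_on {0..} (\<lambda>x. \<phi> x + x * \<phi> x)"
    by (rule uniformly_continuous_on_add[OF uc])
  then have "uniformly_continuous_on {0..} ?f" by (simp add: distrib_right)
  from modulus_of_continuity_bound[OF this] obtain d where d: "0 < d"
    "\<forall>r<d. \<forall>x\<in>{0..}. \<forall>y\<in>{0..}. \<bar>x - y\<bar> \<le> r \<longrightarrow> \<bar>?f x - ?f y\<bar> \<le> modulus_of_continuity {0..} ?f r"
    by blast
  have "set_integrable lborel {0..} (\<lambda>x. \<phi> x + x * \<phi> x)" by (rule set_integral_add[OF ints])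
  then have fint: "set_integrable lborel {0..} ?f" by (simp add: distrib_right)
  define I where "I = (LBINT x:{0..}. ?f x)"
  have I0: "0 \<le> I" unfolding I_def set_lebesgue_integral_def
    using \<phi>0 by (intro integral_nonneg_AE) (auto simp: indicator_def)
  obtain B where B: "0 < B" "\<And>n. norm (real (N n) * \<epsilon> n / real (L n)) \<le> B"
    using convergent_imp_Bseq[of "\<lambda>n. real (N n) * \<epsilon> n / real (L n)"] density_lim
    unfolding Bseq_def convergent_def by blast
  have ev1: "\<forall>\<^sub>F n in sequentially. \<epsilon> n < d" by (rule order_tendstoD(2)[OF eps_lim d(1)])
  have ev2: "\<forall>\<^sub>F n in sequentially. real (L n) * ?\<omega> n < 1" by (rule order_tendstoD(2)[OF modulus_lim]) simp
  define C1 where "C1 = C * 2 * (1 + B)\<^sup>2 * (I + B)"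
  have "\<forall>\<^sub>F n in sequentially. \<forall>w\<in>?V n.
    ?col n w \<le> C1 * real (L n)"
    using ev1 ev2
  proof eventually_elim
    case (elim n)
    let ?L = "real (L n)" and ?m = "real (N n) * \<epsilon> n" and ?R = "\<Sum>d=1..N n. \<epsilon> n * ?f (real d * \<epsilon> n)"
    have L2: "2 \<le> ?L" using params(2)[of n] by simp
    have m0: "0 \<le> ?m" using params(3)[of n] by simp
    have mB: "?m \<le> B * ?L"
    proof -
      have "?m / ?L \<le> B" using B(2)[of n] unfolding real_norm_def by linarith
      then show ?thesis using L2 by (simp add: pos_divide_le_eq)
    qed
    have osc: "\<bar>?f x - ?f y\<bar> \<le> ?\<omega> n" if "0 \<le> x" "0 \<le> y" "\<bar>x - y\<bar> \<le> \<epsilon> n" for x y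
      using d(2)[rule_format, OF elim(1), of x y] that by simp
    have \<omega>0: "0 \<le> ?\<omega> n" using osc[of 0 0] params(3)[of n] by simp
    have "?R \<le> I + ?m * ?\<omega> n"
      unfolding I_def using \<phi>0 params(3) osc by (intro riemann_sum_le_integral[OF fint]) auto
    also have "?m * ?\<omega> n \<le> B * ?L * ?\<omega> n" using mB \<omega>0 by (rule mult_right_mono)
    also have "\<dots> \<le> B * 1"
      unfolding mult.assoc using elim(2) B(1) by (intro mult_left_mono) auto
    finally have R: "?R \<le> I + B" by simp
    have R0: "0 \<le> ?R" using \<phi>0 params(3)[of n] by (intro sum_nonneg mult_nonneg_nonneg) auto
    have square: "C / (?L - 1) * (?L + ?m)\<^sup>2 \<le> C * 2 * (1 + B)\<^sup>2 * ?L"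
    proof -
      have "(?L + ?m)\<^sup>2 \<le> (?L * (1 + B))\<^sup>2"
        using mB m0 L2 by (intro power_mono) (auto simp: algebra_simps)
      also have "\<dots> = (1 + B)\<^sup>2 * ?L * ?L" by (simp add: power_mult_distrib power2_eq_square mult_ac)
      also have "\<dots> \<le> (1 + B)\<^sup>2 * ?L * (2 * (?L - 1))"
        using L2 by (intro mult_left_mono) auto
      also have "\<dots> = 2 * (1 + B)\<^sup>2 * ?L * (?L - 1)" by (simp only: mult_ac)
      finally have "(?L + ?m)\<^sup>2 / (?L - 1) \<le> 2 * (1 + B)\<^sup>2 * ?L"
        using L2 by (intro pos_divide_le_eq[THEN iffD2]) auto
      then have "C * ((?L + ?m)\<^sup>2 / (?L - 1)) \<le> C * (2 * (1 + B)\<^sup>2 * ?L)"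
        by (rule mult_left_mono) (simp add: C_def)
      then show ?thesis by (simp add: mult_ac)
    qed
    show ?case
    proof
      fix w assume w: "w \<in> ?V n"
      have "?col n w
        \<le> C / (?L - 1) * (?L + ?m)\<^sup>2 * ?R"
        by (rule generator_column_sum[OF w params(2,3) K0 KC _ \<phi>0]) (auto simp: C_def)
      also have "\<dots> \<le> (C * 2 * (1 + B)\<^sup>2 * ?L) * (I + B)"
      proof (rule mult_mono[OF square R _ R0])
        show "0 \<le> C * 2 * (1 + B)\<^sup>2 * ?L" using B(1) by (simp add: C_def)
      qed
      finally show "?col n w \<le> C1 * ?L"
        by (simp add: C1_def mult_ac)
    qed
  qed
  moreover have "0 \<le> C1" unfolding C1_def using I0 B(1) by (simp add: C_def)
  ultimately show ?thesis using that by blast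
qed

lemma empirical_in_P_le:
  assumes w: "w \<in> configurations N L \<epsilon>" and L: "1 \<le> L" and eps: "0 < \<epsilon>" and \<rho>: "real N * \<epsilon> / real L \<le> \<rho>"
  shows "empirical L w \<in> mspace (P_le \<rho>)"
proof -
  have m: "w \<in> measurable (uniform_count_measure {1..L}) borel"
    by (auto simp: uniform_count_measure_def point_measure_def)
  have "prob_space (uniform_count_measure {1..L})" using L by (intro prob_space_uniform_count_measure) auto
  then have "prob_space (empirical L w)"
    unfolding empirical_def by (rule prob_space.prob_space_distr[OF _ m])
  then interpret E: prob_space "empirical L w" .
  have sets: "sets (empirical L w) = sets borel" by (simp add: empirical_def)
  have w0: "0 \<le> w i" if "i \<in> {1..L}" for i using configuration_facts(1)[OF w eps, of i] that by auto
  have "emeasure (empirical L w) {0..} = ennreal (1 / real L) * (\<Sum>i=1..L. 1)"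
    unfolding emeasure_empirical[OF atLeast_borel] using w0 by (intro arg_cong2[of _ _ _ _ "(*)"] sum.cong refl) (auto simp: indicator_def)
  also have "\<dots> = 1" using L by (simp add: ennreal_of_nat_eq_real_of_nat ennreal_mult[symmetric])
  finally have one: "measure (empirical L w) {0..} = 1" by (simp add: measure_def)
  have "integrable (uniform_count_measure {1..L}) w"
    unfolding uniform_count_measure_def by (intro integrable_point_measure_finite) auto
  then have "integrable (empirical L w) (\<lambda>x. x)"
    unfolding empirical_def by (subst integrable_distr_eq[OF m]) auto
  then have "empirical L w \<in> P1" using sets one E.prob_space_axioms by (simp add: P1_def)
  moreover have "(\<integral>x. x \<partial>empirical L w) \<le> \<rho>"
    using integral_empirical[of "\<lambda>x. x" L w] configuration_facts(4)[OF w eps] \<rho> by simp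
  ultimately show ?thesis by (simp add: P_le_def)
qed

lemma expected_time_integral_bound:
  assumes mp: "markov_process \<Omega> (configurations N L \<epsilon>) G X" and L: "1 \<le> L" and eps: "0 < \<epsilon>"
    and T: "0 \<le> T"
    and bound: "\<And>t. 0 < t \<Longrightarrow> t \<le> T \<Longrightarrow> (\<integral>\<omega>. max_test \<delta> k (empirical L (X t \<omega>)) \<partial>\<Omega>) \<le> M"
  shows "(\<integral>\<omega>. time_integral (max_test \<delta> k) T (empirical_path L X \<omega>) \<partial>\<Omega>) \<le> T * M"
proof -
  let ?V = "configurations N L \<epsilon>"
  let ?Z = "\<lambda>t \<omega>. max_test \<delta> k (empirical L (X t \<omega>))"
  have \<Omega>: "prob_space \<Omega>" and X: "\<And>t. 0 \<le> t \<Longrightarrow> X t \<in> measurable \<Omega> (count_space ?V)"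
    and right: "\<And>\<omega> t. \<omega> \<in> space \<Omega> \<Longrightarrow> 0 \<le> t \<Longrightarrow> \<forall>\<^sub>F s in at_right t. X s \<omega> = X t \<omega>"
    using mp by (auto simp: markov_process_def)
  interpret prob_space \<Omega> by fact
  interpret pair_sigma_finite lborel \<Omega> ..
  have XV: "X t \<omega> \<in> ?V" if "0 \<le> t" "\<omega> \<in> space \<Omega>" for t \<omega>
    using measurable_space[OF X[OF that(1)] that(2)] by simp
  have Zb: "0 \<le> ?Z t \<omega>" "?Z t \<omega> \<le> 1" if "0 \<le> t" "\<omega> \<in> space \<Omega>" for t \<omega>
  proof -
    have "empirical L (X t \<omega>) \<in> P1"
      using empirical_in_P_le[OF XV[OF that] L eps order_refl] by (simp add: P_le_def)
    then show "0 \<le> ?Z t \<omega>" "?Z t \<omega> \<le> 1" using max_test_bounds P1_facts(1,2) by blast+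
  qed
  have joint: "(\<lambda>(t, \<omega>). indicator {0<..T} t * ?Z t \<omega>) \<in> borel_measurable (lborel \<Otimes>\<^sub>M \<Omega>)"
  proof (rule right_continuous_jointly_measurable)
    show "?Z t \<in> borel_measurable \<Omega>" if "0 \<le> t" for t
      by (rule measurable_compose[OF X[OF that], of "\<lambda>w. max_test \<delta> k (empirical L w)"]) simp
    show "((\<lambda>s. ?Z s \<omega>) \<longlongrightarrow> ?Z t \<omega>) (at_right t)" if "0 \<le> t" "\<omega> \<in> space \<Omega>" for t \<omega>
      by (rule tendsto_eventually) (use right[OF that(2,1)] in \<open>auto elim: eventually_mono\<close>)
  qed
  have int: "integrable (lborel \<Otimes>\<^sub>M \<Omega>) (case_prod (\<lambda>t \<omega>. indicator {0<..T} t * ?Z t \<omega>))"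
  proof (rule Bochner_Integration.integrable_bound[OF _ joint])
    have "integrable (lborel \<Otimes>\<^sub>M \<Omega>) (indicator ({0<..T} \<times> space \<Omega>) :: _ \<Rightarrow> real)"
    proof (rule integrable_real_indicator)
      have "emeasure (lborel \<Otimes>\<^sub>M \<Omega>) ({0<..T} \<times> space \<Omega>) = emeasure lborel {0<..T} * emeasure \<Omega> (space \<Omega>)"
        by (rule sigma_finite_measure.emeasure_pair_measure_Times[OF prob_space_imp_sigma_finite[OF \<Omega>]]) auto
      then show "emeasure (lborel \<Otimes>\<^sub>M \<Omega>) ({0<..T} \<times> space \<Omega>) < \<infinity>" using T emeasure_space_1 by simp
    qed auto
    then show "integrable (lborel \<Otimes>\<^sub>M \<Omega>) (\<lambda>p. indicator ({0<..T} \<times> space \<Omega>) p :: real)" .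
    show "AE p in lborel \<Otimes>\<^sub>M \<Omega>. norm (case p of (t, \<omega>) \<Rightarrow> indicator {0<..T} t * ?Z t \<omega>)
        \<le> norm (indicator ({0<..T} \<times> space \<Omega>) p :: real)"
      using Zb by (intro AE_I2) (auto simp: indicator_def space_pair_measure)
  qed
  have "(\<integral>\<omega>. time_integral (max_test \<delta> k) T (empirical_path L X \<omega>) \<partial>\<Omega>)
    = (\<integral>\<omega>. (\<integral>t. indicator {0<..T} t * ?Z t \<omega> \<partial>lborel) \<partial>\<Omega>)"
    unfolding time_integral_def
    by (intro Bochner_Integration.integral_cong refl) (auto simp: empirical_path_def indicator_def)
  also have "\<dots> = (\<integral>t. (\<integral>\<omega>. indicator {0<..T} t * ?Z t \<omega> \<partial>\<Omega>) \<partial>lborel)"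
    by (rule Fubini_integral[OF int])
  also have "\<dots> \<le> (\<integral>t. indicator {0<..T} t * M \<partial>lborel)"
  proof (rule integral_mono)
    show "integrable lborel (\<lambda>t. \<integral>\<omega>. indicator {0<..T} t * ?Z t \<omega> \<partial>\<Omega>)"
      using integrable_fst'[OF int] by simp
    show "integrable lborel (\<lambda>t. indicator {0<..T} t * M)" using T by simp
    show "(\<integral>\<omega>. indicator {0<..T} t * ?Z t \<omega> \<partial>\<Omega>) \<le> indicator {0<..T} t * M" for t
      using bound[of t] by (simp add: indicator_def)
  qed
  also have "\<dots> = T * M" using T by simp
  finally show ?thesis .
qed

lemma P_le_cadlag_P1:
  assumes "c \<in> cadlag (P_le \<rho>)" "0 \<le> t"
  shows "c t \<in> P1"
proof -
  have "c t \<in> mspace (P_le \<rho>)" using assms unfolding cadlag_def by auto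
  then show ?thesis by (simp add: P_le_def)
qed

lemma max_test_lipschitz_P_le:
  assumes "x \<in> mspace (P_le \<rho>)" "y \<in> mspace (P_le \<rho>)"
  shows "\<bar>max_test \<delta> k x - max_test \<delta> k y\<bar> \<le> (2 * Max (test_slope ` {..k})) * mdist (P_le \<rho>) x y"
  using max_test_W1_lipschitz[of x y \<delta> k] assms by (simp add: P_le_def)

lemma max_test_bounded_P_le: "x \<in> mspace (P_le \<rho>) \<Longrightarrow> \<bar>max_test \<delta> k x\<bar> \<le> 1"
  using max_test_bounds[of x \<delta> k] P1_facts(1,2)[of x] by (simp add: P_le_def)

lemma time_integral_max_test_continuous:
  "continuous_map (skorokhod_topology (P_le \<rho>)) euclideanreal (time_integral (max_test \<delta> k) T)"
  by (rule time_integral_continuous[where \<psi> = "max_test \<delta> k" and \<Lambda> = "2 * Max (test_slope ` {..k})" and B = 1])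
    (rule max_test_lipschitz_P_le max_test_bounded_P_le; assumption)+

lemma max_test_path_measurable:
  assumes "c \<in> cadlag (P_le \<rho>)"
  shows "(\<lambda>t. indicator {0<..T} t * max_test \<delta> k (c t)) \<in> borel_measurable lborel"
  using cadlag_lipschitz_compose(1)[where \<psi> = "max_test \<delta> k", OF assms max_test_lipschitz_P_le]
  by (rule right_continuous_measurable[where g = "\<lambda>t. max_test \<delta> k (c t)"])

lemma nn_time_integral_max_test:
  assumes c: "c \<in> cadlag (P_le \<rho>)" and T: "0 \<le> T"
  shows "(\<integral>\<^sup>+t. ennreal (indicator {0<..T} t * max_test \<delta> k (c t)) \<partial>lborel) = ennreal (time_integral (max_test \<delta> k) T c)"
    and "0 \<le> time_integral (max_test \<delta> k) T c" "time_integral (max_test \<delta> k) T c \<le> T"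
proof -
  have b: "0 \<le> max_test \<delta> k (c t)" "max_test \<delta> k (c t) \<le> 1" if "0 \<le> t" for t
    using max_test_bounds P1_facts(1,2) P_le_cadlag_P1[OF c that] by blast+
  have iT: "integrable lborel (\<lambda>t. indicator {0<..T} t :: real)" using T by simp
  have int: "integrable lborel (\<lambda>t. indicator {0<..T} t * max_test \<delta> k (c t))"
  proof (rule Bochner_Integration.integrable_bound[OF iT max_test_path_measurable[OF c]])
    show "AE t in lborel. norm (indicator {0<..T} t * max_test \<delta> k (c t)) \<le> norm (indicator {0<..T} t :: real)"
      using b by (auto simp: indicator_def)
  qed
  have nn: "0 \<le> indicator {0<..T} t * max_test \<delta> k (c t)" for t using b[of t] by (auto simp: indicator_def)
  show "(\<integral>\<^sup>+t. ennreal (indicator {0<..T} t * max_test \<delta> k (c t)) \<partial>lborel) = ennreal (time_integral (max_test \<delta> k) T c)"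
    unfolding time_integral_def by (rule nn_integral_eq_integral[OF int]) (use nn in auto)
  show "0 \<le> time_integral (max_test \<delta> k) T c"
    unfolding time_integral_def using nn by (intro integral_nonneg_AE) auto
  have "time_integral (max_test \<delta> k) T c \<le> (\<integral>t. indicator {0<..T} t \<partial>lborel)"
    unfolding time_integral_def using b by (intro integral_mono int iT) (auto simp: indicator_def)
  then show "time_integral (max_test \<delta> k) T c \<le> T" using T by simp
qed

text \<open>The expectation of the time integral of the supremum over \<open>k\<close> is at most \<open>M / (m + 1)\<close> by monotone
convergence. Therefore the infimum over \<open>m\<close> of these time integrals vanishes for almost every path, and for
such a path the infimum over \<open>m\<close> of the suprema vanishes at almost every time.\<close>

lemma density_at_almost_all_times:
  assumes P: "prob_space P" "sets P = sets (borel_of (skorokhod_topology (P_le \<rho>)))"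
    and \<delta>: "\<And>m. 0 < \<delta> m" and T: "0 \<le> T"
    and bound: "\<And>m k. (\<integral>c. time_integral (max_test (\<delta> m) k) T c \<partial>P) \<le> M / real (Suc m)"
  shows "AE c in P. AE t in lborel. t \<in> {0<..T} \<longrightarrow>
    (\<exists>f :: real \<Rightarrow> ennreal. f \<in> borel_measurable lborel \<and> c t = density lborel f)"
proof -
  interpret prob_space P by fact
  let ?m = "P_le \<rho>"
  have "{U. openin (skorokhod_topology ?m) U} \<subseteq> Pow (topspace (skorokhod_topology ?m))"
    using openin_subset by blast
  then have "space (borel_of (skorokhod_topology ?m)) = cadlag ?m" by (simp add: borel_of_def)
  then have space: "space P = cadlag ?m" using sets_eq_imp_space_eq[OF P(2)] by simp
  define \<Phi> where "\<Phi> m k c = ennreal (time_integral (max_test (\<delta> m) k) T c)" for m k c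
  have tm: "time_integral (max_test (\<delta> m) k) T \<in> borel_measurable P" for m k
    using continuous_map_borel_of_measurable[OF time_integral_max_test_continuous] P(2)
    by (simp cong: measurable_cong_sets)
  then have \<Phi>m [measurable]: "\<Phi> m k \<in> borel_measurable P" for m k unfolding \<Phi>_def by measurable
  have \<Phi>_nn: "\<Phi> m k c = (\<integral>\<^sup>+t. ennreal (indicator {0<..T} t * max_test (\<delta> m) k (c t)) \<partial>lborel)" if "c \<in> cadlag ?m" for m k c
    unfolding \<Phi>_def by (rule nn_time_integral_max_test(1)[OF that T, symmetric])
  have mono: "ennreal (indicator {0<..T} t * max_test (\<delta> m) k (c t)) \<le> ennreal (indicator {0<..T} t * max_test (\<delta> m) (Suc k) (c t))" for m k c t
    using max_test_mono[of k "Suc k" "\<delta> m" "c t"] by (intro ennreal_leI mult_left_mono) auto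
  have \<Phi>_mono: "\<Phi> m k c \<le> \<Phi> m (Suc k) c" if "c \<in> cadlag ?m" for m k c
    unfolding \<Phi>_nn[OF that] by (intro nn_integral_mono mono)
  define S where "S m c = (SUP k. \<Phi> m k c)" for m c
  have Sm [measurable]: "S m \<in> borel_measurable P" for m unfolding S_def by measurable
  have SE: "(\<integral>\<^sup>+c. S m c \<partial>P) \<le> ennreal (M / real (Suc m))" for m
  proof -
    have "(\<integral>\<^sup>+c. S m c \<partial>P) = (SUP k. \<integral>\<^sup>+c. \<Phi> m k c \<partial>P)"
      unfolding S_def using \<Phi>_mono space
      by (intro nn_integral_monotone_convergence_SUP_AE) auto
    also have "\<dots> \<le> ennreal (M / real (Suc m))"
    proof (rule SUP_least)
      fix k
      have "integrable P (time_integral (max_test (\<delta> m) k) T)"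
        using nn_time_integral_max_test(2,3)[OF _ T] space tm
        by (intro integrable_const_bound[of _ T]) (auto intro!: AE_I2)
      then have "(\<integral>\<^sup>+c. \<Phi> m k c \<partial>P) = ennreal (\<integral>c. time_integral (max_test (\<delta> m) k) T c \<partial>P)"
        unfolding \<Phi>_def using nn_time_integral_max_test(2)[OF _ T] space
        by (intro nn_integral_eq_integral) (auto intro!: AE_I2)
      also have "\<dots> \<le> ennreal (M / real (Suc m))" by (rule ennreal_leI[OF bound])
      finally show "(\<integral>\<^sup>+c. \<Phi> m k c \<partial>P) \<le> ennreal (M / real (Suc m))" .
    qed
    finally show ?thesis .
  qed
  have lim0: "(\<lambda>m. ennreal (M / real (Suc m))) \<longlonglongrightarrow> 0"
  proof -
    have "(\<lambda>m. M * inverse (real (Suc m))) \<longlonglongrightarrow> M * 0"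
      by (intro tendsto_mult tendsto_const LIMSEQ_inverse_real_of_nat)
    then have "(\<lambda>m. ennreal (M / real (Suc m))) \<longlonglongrightarrow> ennreal 0"
      by (intro tendsto_ennrealI) (simp add: divide_inverse)
    then show ?thesis by simp
  qed
  have "(\<integral>\<^sup>+c. (INF m. S m c) \<partial>P) \<le> 0"
  proof (rule LIMSEQ_le_const[OF lim0])
    have "(\<integral>\<^sup>+c. (INF m. S m c) \<partial>P) \<le> ennreal (M / real (Suc m))" for m
      by (rule order_trans[OF nn_integral_mono SE]) (rule INF_lower, simp)
    then show "\<exists>N. \<forall>m\<ge>N. (\<integral>\<^sup>+c. (INF m. S m c) \<partial>P) \<le> ennreal (M / real (Suc m))" by blast
  qed
  then have INF0: "AE c in P. (INF m. S m c) = 0"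
    by (subst nn_integral_0_iff_AE[symmetric]) auto
  show ?thesis
  proof (rule AE_mp[OF INF0], rule AE_I2, rule impI)
    fix c assume "c \<in> space P" and S0: "(INF m. S m c) = 0"
    then have c: "c \<in> cadlag ?m" using space by simp
    let ?g = "\<lambda>m k t. ennreal (indicator {0<..T} t * max_test (\<delta> m) k (c t))"
    have gm [measurable]: "?g m k \<in> borel_measurable lborel" for m k
      using max_test_path_measurable[OF c] by measurable
    have "(\<integral>\<^sup>+t. (INF m. SUP k. ?g m k t) \<partial>lborel) \<le> S m c" for m
    proof -
      have "(\<integral>\<^sup>+t. (INF m. SUP k. ?g m k t) \<partial>lborel) \<le> (\<integral>\<^sup>+t. (SUP k. ?g m k t) \<partial>lborel)"
        by (intro nn_integral_mono INF_lower) simp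
      also have "\<dots> = (SUP k. \<integral>\<^sup>+t. ?g m k t \<partial>lborel)"
        by (intro nn_integral_monotone_convergence_SUP_AE AE_I2 mono gm)
      also have "\<dots> = S m c" unfolding S_def \<Phi>_nn[OF c] ..
      finally show ?thesis .
    qed
    then have "(\<integral>\<^sup>+t. (INF m. SUP k. ?g m k t) \<partial>lborel) \<le> (INF m. S m c)" by (intro INF_greatest)
    then have "(\<integral>\<^sup>+t. (INF m. SUP k. ?g m k t) \<partial>lborel) = 0" using S0 by simp
    then have INF0': "AE t in lborel. (INF m. SUP k. ?g m k t) = 0"
      by (subst nn_integral_0_iff_AE[symmetric]) auto
    show "AE t in lborel. t \<in> {0<..T} \<longrightarrow>
      (\<exists>f :: real \<Rightarrow> ennreal. f \<in> borel_measurable lborel \<and> c t = density lborel f)"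
    proof (rule AE_mp[OF INF0'], intro AE_I2 impI)
      fix t assume g0: "(INF m. SUP k. ?g m k t) = 0" and t: "t \<in> {0<..T}"
      have "c t \<in> P1" using P_le_cadlag_P1[OF c] t by simp
      then have ct: "prob_space (c t)" "sets (c t) = sets borel" using P1_facts by blast+
      show "\<exists>f :: real \<Rightarrow> ennreal. f \<in> borel_measurable lborel \<and> c t = density lborel f"
      proof (rule density_exists_if_max_test_small[OF ct \<delta>])
        fix e :: real assume e: "0 < e"
        have "(INF m. SUP k. ?g m k t) < ennreal e" using g0 e by simp
        then obtain m where m: "(SUP k. ?g m k t) < ennreal e" by (auto simp: INF_less_iff)
        have "max_test (\<delta> m) k (c t) \<le> e" for k
        proof -
          have "?g m k t \<le> (SUP k. ?g m k t)" by (rule SUP_upper) simp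
          then have "ennreal (max_test (\<delta> m) k (c t)) < ennreal e" using m t by simp
          then show ?thesis using e max_test_bounds(1)[OF ct] by (simp add: ennreal_less_iff)
        qed
        then show "\<exists>m. \<forall>k. max_test (\<delta> m) k (c t) \<le> e" by blast
      qed
    qed
  qed
qed

theorem proposition1p9:
  fixes K :: "real \<Rightarrow> real \<Rightarrow> real \<Rightarrow> real" and \<phi> :: "real \<Rightarrow> real"
    and \<rho> \<rho>_bar b :: real
    and N L :: "nat \<Rightarrow> nat" and \<epsilon> :: "nat \<Rightarrow> real"
    and \<Omega> :: "nat \<Rightarrow> 'w measure" and X :: "nat \<Rightarrow> real \<Rightarrow> 'w \<Rightarrow> nat \<Rightarrow> real"
    and P :: "(real \<Rightarrow> real measure) measure"
  assumes kernel: "existence_kernel K \<phi>"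
    and "0 \<le> \<rho>"
    and params: "\<And>n. 1 \<le> N n" "\<And>n. 2 \<le> L n" "\<And>n. 0 < \<epsilon> n"
    and N_lim: "filterlim N at_top sequentially"
    and L_lim: "filterlim L at_top sequentially"
    and eps_lim: "\<epsilon> \<longlonglongrightarrow> 0"
    and density_lim: "(\<lambda>n. real (N n) * \<epsilon> n / real (L n)) \<longlonglongrightarrow> \<rho>"
    and rho_bar: "\<rho>_bar = (SUP n. real (N n) * \<epsilon> n / real (L n))"
    and modulus_lim:
      "(\<lambda>n. real (L n) * modulus_of_continuity {0..} (\<lambda>x. (1 + x) * \<phi> x) (\<epsilon> n)) \<longlonglongrightarrow> 0"
    and process: "\<And>n. markov_process (\<Omega> n) (configurations (N n) (L n) (\<epsilon> n))
      (micro_generator K (L n) (\<epsilon> n)) (X n)"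
    and limit_law: "prob_space P" "sets P = sets (borel_of (skorokhod_topology (P_le \<rho>_bar)))"
    and weak_limit: "weakly_converges (skorokhod_topology (P_le \<rho>_bar))
      (\<lambda>n. distr (\<Omega> n) (borel_of (skorokhod_topology (P_le \<rho>_bar))) (empirical_path (L n) (X n))) P"
    and "0 < b"
    and entropy: "(SUP n. relative_entropy
      (distr (\<Omega> n) (count_space (grid (L n) (\<epsilon> n))) (X n 0))
      (reference_measure (L n) (\<epsilon> n) b) / ereal (real (L n))) < \<infinity>"
  shows "AE c in P. AE t in lborel. 0 \<le> t \<longrightarrow>
    (\<exists>f :: real \<Rightarrow> ennreal. f \<in> borel_measurable lborel \<and> c t = density lborel f)"
proof -
  let ?D = "\<lambda>(c :: real \<Rightarrow> real measure) t. \<exists>f :: real \<Rightarrow> ennreal. f \<in> borel_measurable lborel \<and> c t = density lborel f"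
  let ?V = "\<lambda>n. configurations (N n) (L n) (\<epsilon> n)"
  let ?m = "P_le \<rho>_bar"
  let ?ent = "\<lambda>n. relative_entropy (distr (\<Omega> n) (count_space (grid (L n) (\<epsilon> n))) (X n 0)) (reference_measure (L n) (\<epsilon> n) b)"
  have L1: "1 \<le> L n" for n using params(2)[of n] by simp
  obtain C0 where ent: "?ent n \<le> ereal (C0 * real (L n))" for n
  proof -
    obtain C0 where C0: "(SUP n. ?ent n / ereal (real (L n))) \<le> ereal C0"
      using entropy by (cases "SUP n. ?ent n / ereal (real (L n))") auto
    have "?ent n \<le> ereal (C0 * real (L n))" for n
    proof -
      have "?ent n / ereal (real (L n)) \<le> (SUP n. ?ent n / ereal (real (L n)))" by (rule SUP_upper) simp
      then have "?ent n / ereal (real (L n)) \<le> ereal C0" using C0 by (rule order_trans)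
      then show ?thesis using L1[of n] by (cases "?ent n") (auto simp: pos_divide_le_eq)
    qed
    then show ?thesis using that by blast
  qed
  obtain C1 where C1: "0 \<le> C1" and col: "\<forall>\<^sub>F n in sequentially. \<forall>w\<in>?V n.
      (\<Sum>v\<in>?V n. micro_generator K (L n) (\<epsilon> n) (\<lambda>u. of_bool (u = w)) v) \<le> C1 * real (L n)"
    by (rule generator_column_sums_linear[OF kernel params eps_lim density_lim modulus_lim])
  have "bdd_above (range (\<lambda>n. real (N n) * \<epsilon> n / real (L n)))"
  proof -
    obtain B where "\<And>n. norm (real (N n) * \<epsilon> n / real (L n)) \<le> B"
      using convergent_imp_Bseq[of "\<lambda>n. real (N n) * \<epsilon> n / real (L n)"] density_lim
      unfolding Bseq_def convergent_def by blast
    then have "real (N n) * \<epsilon> n / real (L n) \<le> B" for n unfolding real_norm_def abs_le_iff by blast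
    then show ?thesis by (intro bdd_aboveI2)
  qed
  then have \<rho>_le: "real (N n) * \<epsilon> n / real (L n) \<le> \<rho>_bar" for n
    unfolding rho_bar by (intro cSUP_upper) auto
  have path_meas: "empirical_path (L n) (X n) \<in> measurable (\<Omega> n) (borel_of (skorokhod_topology ?m))" for n
    unfolding empirical_path_def
  proof (rule step_process_measurable_skorokhod[of "?V n"])
    show "countable (?V n)" using finite_configurations[OF params(3)] by (rule countable_finite)
    show "X n t \<in> measurable (\<Omega> n) (count_space (?V n))" if "0 \<le> t" for t
      using process[of n] that by (auto simp: markov_process_def)
    show "step_path (\<lambda>t. X n t \<omega>)" if "\<omega> \<in> space (\<Omega> n)" for \<omega>
      using process[of n] that unfolding markov_process_def step_path_def by meson
    show "empirical (L n) v \<in> mspace ?m" if "v \<in> ?V n" for v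
      by (rule empirical_in_P_le[OF that L1 params(3) \<rho>_le])
  qed
  \<comment> \<open>\<open>\<delta>\<close> is the largest value for which the exponential moments with parameter \<open>\<theta>\<close> are under control\<close>
  define \<theta> where "\<theta> m = real (Suc m)" for m
  define \<delta> where "\<delta> m = exp (- \<theta> m) / b" for m
  have \<delta>: "0 < \<delta> m" "b * exp (\<theta> m) * \<delta> m \<le> 1" for m
    using \<open>0 < b\<close> by (simp_all add: \<delta>_def exp_minus)
  have limit_bound: "(\<integral>c. time_integral (max_test (\<delta> m) k) T c \<partial>P) \<le> T * (C0 + C1 * T + 1) / real (Suc m)"
    if T: "0 \<le> T" for m k T
  proof -
    let ?F = "time_integral (max_test (\<delta> m) k) T" and ?l = "Max (test_slope ` {..k})"
    have cont: "continuous_map (skorokhod_topology ?m) euclideanreal ?F"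
      by (rule time_integral_max_test_continuous)
    have "bounded (?F ` topspace (skorokhod_topology ?m))"
      using nn_time_integral_max_test(2,3)[OF _ T] by (intro boundedI[of _ T]) auto
    then have "(\<lambda>n. \<integral>c. ?F c \<partial>distr (\<Omega> n) (borel_of (skorokhod_topology ?m)) (empirical_path (L n) (X n)))
        \<longlonglongrightarrow> (\<integral>c. ?F c \<partial>P)"
      using weak_limit cont unfolding weakly_converges_def by blast
    moreover have "(\<integral>c. ?F c \<partial>distr (\<Omega> n) (borel_of (skorokhod_topology ?m)) (empirical_path (L n) (X n)))
        = (\<integral>\<omega>. ?F (empirical_path (L n) (X n) \<omega>) \<partial>\<Omega> n)" for n
      by (rule integral_distr[OF path_meas continuous_map_borel_of_measurable[OF cont]])
    ultimately have conv: "(\<lambda>n. \<integral>\<omega>. ?F (empirical_path (L n) (X n) \<omega>) \<partial>\<Omega> n) \<longlonglongrightarrow> (\<integral>c. ?F c \<partial>P)" by simp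
    \<comment> \<open>the last two terms, from the number of test functions and from the discretisation, vanish in the limit\<close>
    define M where "M n = (C0 + C1 * T + 1) / \<theta> m + ln (real (Suc k)) / \<theta> m * inverse (real (L n)) + ?l * \<epsilon> n" for n
    have "\<forall>\<^sub>F n in sequentially. (\<integral>\<omega>. ?F (empirical_path (L n) (X n) \<omega>) \<partial>\<Omega> n) \<le> T * M n"
      using col
    proof eventually_elim
      case (elim n)
      show ?case
      proof (rule expected_time_integral_bound[OF process L1 params(3) T])
        fix t assume t: "0 < t" "t \<le> T"
        have Lpos: "0 < real (L n)" using L1[of n] by simp
        have \<theta>pos: "0 < \<theta> m" by (simp add: \<theta>_def)
        have "(\<integral>\<omega>. max_test (\<delta> m) k (empirical (L n) (X n t \<omega>)) \<partial>\<Omega> n)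
          \<le> (C0 * real (L n) + C1 * real (L n) * t + ln (real (Suc k)) + real (L n) * (1 + \<theta> m * ?l * \<epsilon> n)) / (\<theta> m * real (L n))"
          using elim by (intro expected_max_test_bound[OF process L1 params(3) \<open>0 < b\<close> ent _ \<theta>pos \<delta> t(1)]) auto
        also have "\<dots> \<le> (C0 * real (L n) + C1 * real (L n) * T + ln (real (Suc k)) + real (L n) * (1 + \<theta> m * ?l * \<epsilon> n)) / (\<theta> m * real (L n))"
          using C1 Lpos \<theta>pos t by (intro divide_right_mono add_right_mono add_left_mono mult_left_mono) auto
        also have "\<dots> = M n" unfolding M_def using Lpos \<theta>pos by (simp add: field_simps del: of_nat_Suc)
        finally show "(\<integral>\<omega>. max_test (\<delta> m) k (empirical (L n) (X n t \<omega>)) \<partial>\<Omega> n) \<le> M n" .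
      qed
    qed
    moreover have "(\<lambda>n. T * M n) \<longlonglongrightarrow> T * ((C0 + C1 * T + 1) / \<theta> m + ln (real (Suc k)) / \<theta> m * 0 + ?l * 0)"
    proof -
      have "filterlim (\<lambda>n. real (L n)) at_top sequentially"
        by (rule filterlim_compose[OF filterlim_real_sequentially L_lim])
      then have "(\<lambda>n. inverse (real (L n))) \<longlonglongrightarrow> 0"
        by (rule filterlim_compose[OF tendsto_inverse_0_at_top[OF filterlim_ident]])
      then show ?thesis unfolding M_def by (intro tendsto_intros eps_lim)
    qed
    ultimately have "(\<integral>c. ?F c \<partial>P) \<le> T * ((C0 + C1 * T + 1) / \<theta> m + ln (real (Suc k)) / \<theta> m * 0 + ?l * 0)"
      using conv by (intro tendsto_le[OF sequentially_bot])
    then show ?thesis by (simp add: \<theta>_def)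
  qed
  have "AE c in P. AE t in lborel. t \<in> {0<..real i} \<longrightarrow> ?D c t" for i
    by (rule density_at_almost_all_times[OF limit_law \<delta>(1) _ limit_bound]) auto
  then have all_i: "AE c in P. \<forall>i. AE t in lborel. t \<in> {0<..real i} \<longrightarrow> ?D c t"
    by (subst AE_all_countable) auto
  show ?thesis
  proof (rule AE_mp[OF all_i], rule AE_I2, rule impI)
    fix c assume "\<forall>i. AE t in lborel. t \<in> {0<..real i} \<longrightarrow> ?D c t"
    then have "AE t in lborel. \<forall>i. t \<in> {0<..real i} \<longrightarrow> ?D c t"
      by (subst AE_all_countable) auto
    moreover have "AE t in lborel. t \<noteq> (0 :: real)" by (rule AE_lborel_singleton)
    ultimately show "AE t in lborel. 0 \<le> t \<longrightarrow> ?D c t"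
    proof eventually_elim
      case (elim t)
      obtain i where "t \<le> real i" using real_arch_simple by blast
      then show ?case using elim(1)[rule_format, of i] elim(2) by auto
    qed
  qed
qed

end
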